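(* Regard $\mathbf{Set}$ as a coloured category whose equimorphisms are the bijections, and in which every object is discrete. Let $\mathbf{Set}\text{-}\mathbf{FairCat}$ be the category of fair $\mathbf{Set}$-categories and let $\mathbf{Cat}$ be the category of small categories and functors. There is an adjoint equivalence of categories $$\mathbf{Set}\text{-}\mathbf{FairCat}\ \rightleftarrows\ \mathbf{Cat}.$$
   Context: A coloured category is a category with a chosen subcategory containing all objects; the arrows of this subcategory are called coloured arrows or equimorphisms. A functor between coloured categories is colour-preserving if it sends coloured arrows to coloured arrows. The fat delta $\Delta_{\mathrm{fat}}$: let $\Delta$ be the category of nonempty finite ordinals $\mathbf n=\{0\le\dots\le n\}$ and order-preserving maps. Objects of $\Delta_{\mathrm{fat}}$ are the epimorphisms $e:\mathbf m\twoheadrightarrow\mathbf k$ of $\Delta$; an arrow from $e:\mathbf m\twoheadrightarrow\mathbf k$ to $e':\mathbf m'\twoheadrightarrow\mathbf k'$ is a pair $(f,g)$ with $f:\mathbf m\to\mathbf m'$ a monomorphism in $\Delta$, $g:\mathbf k\to\mathbf k'$ any arrow in $\Delta$, and $ge=e'f$. (Equivalently: an object is a column of $m+1$ dots in which some pairs of consecutive dots are linked, namely those with the same image under $e$; an arrow is an injective order-preserving map on dots sending linked dots to dots connected by links.) The functor $\pi:\Delta_{\mathrm{fat}}\to\Delta$ sends $e$ to $\mathbf k$. The coloured arrows of $\Delta_{\mathrm{fat}}$ are the vertical ones, i.e. those sent by $\pi$ to identity arrows. Write $\bullet=(\mathbf 0\twoheadrightarrow\mathbf 0)$ (one dot). $\bullet$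 is declared to be the only discrete object. For objects $m,n$ of $\Delta_{\mathrm{fat}}$, $m\dotplus n$ denotes the pushout of $m\leftarrow\bullet\to n$, where $\bullet$ is included as the last dot of $m$ and the first dot of $n$. A fair $\mathbf{Set}$-category is a functor $X:\Delta_{\mathrm{fat}}^{\mathrm{op}}\to\mathbf{Set}$ which preserves colours (vertical arrows go to bijections), discrete objects (no condition, since every set is discrete), and fibre products over discrete objects: for all $m,n$ the canonical map $X_{m\dotplus n}\to X_m\times_{X_\bullet}X_n$ is an isomorphism. Morphisms of fair $\mathbf{Set}$-categories are natural transformations. *)

theory Defs
  imports "HOL-Library.FuncSet"
begin

section \<open>Categories, functors and natural transformations\<close>

record ('o, 'a) cat =
  Obj :: "'o set"
  Arr :: "'a set"
  Dom :: "'a \<Rightarrow> 'o"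
  Cod :: "'a \<Rightarrow> 'o"
  Ident :: "'o \<Rightarrow> 'a"
  Comp :: "'a \<Rightarrow> 'a \<Rightarrow> 'a"

text \<open>\<open>Comp C g f\<close> is the composite ``first \<open>f\<close>, then \<open>g\<close>''.\<close>

definition hom :: "('o, 'a, 'z) cat_scheme \<Rightarrow> 'o \<Rightarrow> 'o \<Rightarrow> 'a set" where
  "hom C x y = {f \<in> Arr C. Dom C f = x \<and> Cod C f = y}"

locale category =
  fixes C :: "('o, 'a, 'z) cat_scheme"
  assumes Dom_Obj: "f \<in> Arr C \<Longrightarrow> Dom C f \<in> Obj C"
    and Cod_Obj: "f \<in> Arr C \<Longrightarrow> Cod C f \<in> Obj C"
    and Id_hom: "x \<in> Obj C \<Longrightarrow> Ident C x \<in> hom C x x"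
    and Comp_hom: "\<lbrakk>f \<in> hom C x y; g \<in> hom C y z\<rbrakk> \<Longrightarrow> Comp C g f \<in> hom C x z"
    and Comp_Id: "f \<in> Arr C \<Longrightarrow> Comp C f (Ident C (Dom C f)) = f"
    and Id_Comp: "f \<in> Arr C \<Longrightarrow> Comp C (Ident C (Cod C f)) f = f"
    and Comp_assoc: "\<lbrakk>f \<in> hom C w x; g \<in> hom C x y; h \<in> hom C y z\<rbrakk>
      \<Longrightarrow> Comp C h (Comp C g f) = Comp C (Comp C h g) f"

definition opposite :: "('o, 'a, 'z) cat_scheme \<Rightarrow> ('o, 'a, 'z) cat_scheme" where
  "opposite C = C\<lparr>Dom := Cod C, Cod := Dom C, Comp := (\<lambda>g f. Comp C f g)\<rparr>"

definition is_epi :: "('o, 'a, 'z) cat_scheme \<Rightarrow> 'a \<Rightarrow> bool" where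
  "is_epi C e \<longleftrightarrow> e \<in> Arr C \<and>
    (\<forall>y. \<forall>g \<in> hom C (Cod C e) y. \<forall>h \<in> hom C (Cod C e) y. Comp C g e = Comp C h e \<longrightarrow> g = h)"

definition is_mono :: "('o, 'a, 'z) cat_scheme \<Rightarrow> 'a \<Rightarrow> bool" where
  "is_mono C m \<longleftrightarrow> m \<in> Arr C \<and>
    (\<forall>x. \<forall>g \<in> hom C x (Dom C m). \<forall>h \<in> hom C x (Dom C m). Comp C m g = Comp C m h \<longrightarrow> g = h)"

definition is_iso :: "('o, 'a, 'z) cat_scheme \<Rightarrow> 'a \<Rightarrow> bool" where
  "is_iso C f \<longleftrightarrow> f \<in> Arr C \<and>
    (\<exists>g \<in> hom C (Cod C f) (Dom C f).
      Comp C g f = Ident C (Dom C f) \<and> Comp C f g = Ident C (Cod C f))"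

text \<open>\<open>i\<close> and \<open>j\<close> are the coprojections of a pushout of the span \<open>a\<close>, \<open>b\<close>; the pushout object
  is \<open>Cod C i = Cod C j\<close>.\<close>

definition pushout :: "('o, 'a, 'z) cat_scheme \<Rightarrow> 'a \<Rightarrow> 'a \<Rightarrow> 'a \<Rightarrow> 'a \<Rightarrow> bool" where
  "pushout C a b i j \<longleftrightarrow>
    a \<in> Arr C \<and> b \<in> Arr C \<and> i \<in> Arr C \<and> j \<in> Arr C \<and>
    Dom C a = Dom C b \<and> Dom C i = Cod C a \<and> Dom C j = Cod C b \<and> Cod C i = Cod C j \<and>
    Comp C i a = Comp C j b \<and>
    (\<forall>z. \<forall>u \<in> hom C (Cod C a) z. \<forall>v \<in> hom C (Cod C b) z. Comp C u a = Comp C v b \<longrightarrow>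
      (\<exists>!w. w \<in> hom C (Cod C i) z \<and> Comp C w i = u \<and> Comp C w j = v))"

record ('o, 'a, 'p, 'b) fctr =
  FObj :: "'o \<Rightarrow> 'p"
  FArr :: "'a \<Rightarrow> 'b"

text \<open>The values of functors and natural transformations outside their domains are fixed to
  \<open>undefined\<close>, so that equality in HOL is the mathematical equality.\<close>

locale is_functor = A: category A + B: category B
  for A :: "('o, 'a, 'y) cat_scheme" and B :: "('p, 'b, 'z) cat_scheme" +
  fixes F :: "('o, 'a, 'p, 'b) fctr"
  assumes FObj_Obj: "x \<in> Obj A \<Longrightarrow> FObj F x \<in> Obj B"
    and FArr_hom: "f \<in> hom A x y \<Longrightarrow> FArr F f \<in> hom B (FObj F x) (FObj F y)"
    and FArr_Id: "x \<in> Obj A \<Longrightarrow> FArr F (Ident A x) = Ident B (FObj F x)"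
    and FArr_Comp: "\<lbrakk>f \<in> hom A x y; g \<in> hom A y z\<rbrakk>
      \<Longrightarrow> FArr F (Comp A g f) = Comp B (FArr F g) (FArr F f)"
    and FObj_extensional: "FObj F \<in> extensional (Obj A)"
    and FArr_extensional: "FArr F \<in> extensional (Arr A)"

definition id_fctr :: "('o, 'a, 'z) cat_scheme \<Rightarrow> ('o, 'a, 'o, 'a) fctr" where
  "id_fctr A = \<lparr>FObj = (\<lambda>x \<in> Obj A. x), FArr = (\<lambda>f \<in> Arr A. f)\<rparr>"

definition comp_fctr :: "('o, 'a, 'z) cat_scheme \<Rightarrow> ('p, 'b, 'q, 'c) fctr \<Rightarrow> ('o, 'a, 'p, 'b) fctr
    \<Rightarrow> ('o, 'a, 'q, 'c) fctr" where
  "comp_fctr A G F =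
    \<lparr>FObj = compose (Obj A) (FObj G) (FObj F), FArr = compose (Arr A) (FArr G) (FArr F)\<rparr>"

locale nat_trans = F: is_functor A B F + G: is_functor A B G
  for A :: "('o, 'a, 'y) cat_scheme" and B :: "('p, 'b, 'z) cat_scheme"
    and F :: "('o, 'a, 'p, 'b) fctr" and G :: "('o, 'a, 'p, 'b) fctr" +
  fixes \<tau> :: "'o \<Rightarrow> 'b"
  assumes component: "x \<in> Obj A \<Longrightarrow> \<tau> x \<in> hom B (FObj F x) (FObj G x)"
    and natural: "f \<in> hom A x y \<Longrightarrow> Comp B (\<tau> y) (FArr F f) = Comp B (FArr G f) (\<tau> x)"
    and component_extensional: "\<tau> \<in> extensional (Obj A)"

locale nat_iso = nat_trans +
  assumes component_iso: "x \<in> Obj A \<Longrightarrow> is_iso B (\<tau> x)"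

locale adjoint_equivalence = F: is_functor A B F + G: is_functor B A G
    + unit: nat_iso A A "id_fctr A" "comp_fctr A G F" \<eta>
    + counit: nat_iso B B "comp_fctr B F G" "id_fctr B" \<epsilon>
  for A :: "('o, 'a, 'y) cat_scheme" and B :: "('p, 'b, 'z) cat_scheme"
    and F :: "('o, 'a, 'p, 'b) fctr" and G :: "('p, 'b, 'o, 'a) fctr"
    and \<eta> :: "'o \<Rightarrow> 'a" and \<epsilon> :: "'p \<Rightarrow> 'b" +
  assumes triangle_F: "x \<in> Obj A \<Longrightarrow> Comp B (\<epsilon> (FObj F x)) (FArr F (\<eta> x)) = Ident B (FObj F x)"
    and triangle_G: "y \<in> Obj B \<Longrightarrow> Comp A (FArr G (\<epsilon> y)) (\<eta> (FObj G y)) = Ident A (FObj G y)"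

text \<open>A category presented by hom-sets \<open>H x y\<close>, which need not be disjoint: an arrow carries
  its source and target. In \<open>c x g f\<close>, the object \<open>x\<close> is the source of \<open>f\<close>.\<close>

datatype ('o, 'm) arrow = Arrow (src: 'o) (body: 'm) (tgt: 'o)

definition cat_of_homs :: "'o set \<Rightarrow> ('o \<Rightarrow> 'o \<Rightarrow> 'm set) \<Rightarrow> ('o \<Rightarrow> 'm) \<Rightarrow> ('o \<Rightarrow> 'm \<Rightarrow> 'm \<Rightarrow> 'm)
    \<Rightarrow> ('o, ('o, 'm) arrow) cat" where
  "cat_of_homs Ob H i c =
    \<lparr>Obj = Ob,
     Arr = {a. src a \<in> Ob \<and> tgt a \<in> Ob \<and> body a \<in> H (src a) (tgt a)},
     Dom = src,
     Cod = tgt,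
     Ident = (\<lambda>x. Arrow x (i x) x),
     Comp = (\<lambda>b a. Arrow (src a) (c (src a) (body b) (body a)) (tgt b))\<rparr>"


section \<open>Coloured categories with discrete objects\<close>

record ('o, 'a) ccat = "('o, 'a) cat" +
  Col :: "'a set"
  Disc :: "'o set"

locale coloured_category = category C
  for C :: "('o, 'a, 'z) ccat_scheme" +
  assumes Col_Arr: "Col C \<subseteq> Arr C"
    and Id_Col: "x \<in> Obj C \<Longrightarrow> Ident C x \<in> Col C"
    and Comp_Col: "\<lbrakk>f \<in> Col C; g \<in> Col C; Dom C g = Cod C f\<rbrakk> \<Longrightarrow> Comp C g f \<in> Col C"
    and Disc_Obj: "Disc C \<subseteq> Obj C"

definition add_colours :: "('o, 'a) cat \<Rightarrow> 'a set \<Rightarrow> 'o set \<Rightarrow> ('o, 'a) ccat" where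
  "add_colours C cols disc =
    \<lparr>Obj = Obj C, Arr = Arr C, Dom = Dom C, Cod = Cod C, Ident = Ident C, Comp = Comp C,
     Col = cols, Disc = disc\<rparr>"

locale colour_preserving_functor = is_functor A B F + A: coloured_category A + B: coloured_category B
  for A :: "('o, 'a, 'y) ccat_scheme" and B :: "('p, 'b, 'z) ccat_scheme"
    and F :: "('o, 'a, 'p, 'b) fctr" +
  assumes preserves_colours: "f \<in> Col A \<Longrightarrow> FArr F f \<in> Col B"


section \<open>The fat delta\<close>

text \<open>The object \<open>n\<close> of \<open>Delta\<close> is the ordinal with the \<open>n + 1\<close> elements \<open>0, \<dots>, n\<close>.\<close>

definition Delta :: "(nat, (nat, nat \<Rightarrow> nat) arrow) cat" where
  "Delta = cat_of_homs UNIV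
    (\<lambda>m n. {f \<in> {..m} \<rightarrow>\<^sub>E {..n}. mono_on {..m} f})
    (\<lambda>m. \<lambda>i \<in> {..m}. i)
    (\<lambda>m g f. compose {..m} g f)"

type_synonym fat_obj = "(nat, nat \<Rightarrow> nat) arrow"
type_synonym fat_arr =
  "(fat_obj, (nat, nat \<Rightarrow> nat) arrow \<times> (nat, nat \<Rightarrow> nat) arrow) arrow"

definition fat_cat :: "(fat_obj, fat_arr) cat" where
  "fat_cat = cat_of_homs {e. is_epi Delta e}
    (\<lambda>e e'. {(f, g). is_mono Delta f \<and> f \<in> hom Delta (Dom Delta e) (Dom Delta e') \<and>
                     g \<in> hom Delta (Cod Delta e) (Cod Delta e') \<and>
                     Comp Delta g e = Comp Delta e' f})
    (\<lambda>e. (Ident Delta (Dom Delta e), Ident Delta (Cod Delta e)))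
    (\<lambda>_ (f', g') (f, g). (Comp Delta f' f, Comp Delta g' g))"

definition fat_proj :: "(fat_obj, fat_arr, nat, (nat, nat \<Rightarrow> nat) arrow) fctr" where
  "fat_proj = \<lparr>FObj = (\<lambda>e \<in> Obj fat_cat. Cod Delta e), FArr = (\<lambda>a \<in> Arr fat_cat. snd (body a))\<rparr>"

definition vertical :: "fat_arr set" where
  "vertical = {a \<in> Arr fat_cat. \<exists>k \<in> Obj Delta. FArr fat_proj a = Ident Delta k}"

definition one_dot :: fat_obj where
  "one_dot = Ident Delta 0"

definition fat_delta :: "(fat_obj, fat_arr) ccat" where
  "fat_delta = add_colours fat_cat vertical {one_dot}"

text \<open>The arrow from \<open>one_dot\<close> to \<open>e\<close> that hits the dot \<open>i \<le> Dom Delta e\<close>. The dots of \<open>e\<close> are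
  \<open>0, \<dots>, Dom Delta e\<close>.\<close>

definition dot_inclusion :: "fat_obj \<Rightarrow> nat \<Rightarrow> fat_arr" where
  "dot_inclusion e i =
    Arrow one_dot
      (Arrow 0 (\<lambda>_ \<in> {..0}. i) (Dom Delta e), Arrow 0 (\<lambda>_ \<in> {..0}. body e i) (Cod Delta e)) e"

definition first_dot :: "fat_obj \<Rightarrow> fat_arr" where
  "first_dot e = dot_inclusion e 0"

definition last_dot :: "fat_obj \<Rightarrow> fat_arr" where
  "last_dot e = dot_inclusion e (Dom Delta e)"


section \<open>Small sets and small categories\<close>

text \<open>The size convention: all elements live in an arbitrary infinite type \<open>'u\<close>, and a set or category
  is small if its underlying sets satisfy \<open>small\<close>. The small sets of a
  Grothendieck universe or of a model of ZFC are an instance, as are, over any infinite type, all sets,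
  all countable sets and all finite sets. Closure under power sets is deliberately not required, since
  HOL cannot exhibit an uncountable inaccessible.\<close>

locale smallness =
  fixes small :: "'u set \<Rightarrow> bool"
  assumes infinite_type: "infinite (UNIV :: 'u set)"
    and small_finite: "finite A \<Longrightarrow> small A"
    and small_subset: "\<lbrakk>small A; B \<subseteq> A\<rbrakk> \<Longrightarrow> small B"
    and small_image: "small A \<Longrightarrow> small (f ` A)"
    and small_Union: "\<lbrakk>small I; \<And>i. i \<in> I \<Longrightarrow> small (S i)\<rbrakk> \<Longrightarrow> small (\<Union>i \<in> I. S i)"

definition SET :: "('u set \<Rightarrow> bool) \<Rightarrow> ('u set, ('u set, 'u \<Rightarrow> 'u) arrow) ccat" where
  "SET small =
    (let S = cat_of_homs {A. small A} (\<lambda>A B. A \<rightarrow>\<^sub>E B) (\<lambda>A. \<lambda>x \<in> A. x) (\<lambda>A g f. compose A g f)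
     in add_colours S {a \<in> Arr S. bij_betw (body a) (src a) (tgt a)} (Obj S))"

text \<open>The structure maps are fixed to \<open>undefined\<close> where they are meaningless, so that each
  small category on given carriers is represented exactly once.\<close>

locale small_category = category C
  for small :: "'u set \<Rightarrow> bool" and C :: "('u, 'u) cat" +
  assumes small_Obj: "small (Obj C)"
    and small_Arr: "small (Arr C)"
    and Dom_extensional: "Dom C \<in> extensional (Arr C)"
    and Cod_extensional: "Cod C \<in> extensional (Arr C)"
    and Id_extensional: "Ident C \<in> extensional (Obj C)"
    and Comp_extensional:
      "\<not> (f \<in> Arr C \<and> g \<in> Arr C \<and> Dom C g = Cod C f) \<Longrightarrow> Comp C g f = undefined"

definition CAT :: "('u set \<Rightarrow> bool)
    \<Rightarrow> (('u, 'u) cat, (('u, 'u) cat, ('u, 'u, 'u, 'u) fctr) arrow) cat" where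
  "CAT small = cat_of_homs {C. small_category small C}
    (\<lambda>C D. {F. is_functor C D F}) id_fctr (\<lambda>C G F. comp_fctr C G F)"


section \<open>Fair Set-categories\<close>

type_synonym 'u fat_presheaf =
  "(fat_obj, fat_arr, 'u set, ('u set, 'u \<Rightarrow> 'u) arrow) fctr"

text \<open>The object \<open>Cod fat_delta i\<close> in the last axiom is the pushout of \<open>m\<close> and \<open>n\<close> over \<open>one_dot\<close>.
  It is only determined up to isomorphism; the condition is imposed for every choice.\<close>

locale fair_Set_category =
  colour_preserving_functor "opposite fat_delta" "SET small" X
  for small :: "'u set \<Rightarrow> bool" and X :: "'u fat_presheaf" +
  assumes preserves_discrete: "x \<in> Disc (opposite fat_delta) \<Longrightarrow> FObj X x \<in> Disc (SET small)"
    and preserves_fibre_products: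
      "\<lbrakk>m \<in> Obj fat_delta; n \<in> Obj fat_delta; pushout fat_delta (last_dot m) (first_dot n) i j\<rbrakk>
        \<Longrightarrow> bij_betw (\<lambda>x. (body (FArr X i) x, body (FArr X j) x)) (FObj X (Cod fat_delta i))
              {(s, t). s \<in> FObj X m \<and> t \<in> FObj X n \<and>
                body (FArr X (last_dot m)) s = body (FArr X (first_dot n)) t}"

definition SetFairCat :: "('u set \<Rightarrow> bool)
    \<Rightarrow> ('u fat_presheaf, ('u fat_presheaf, fat_obj \<Rightarrow> ('u set, 'u \<Rightarrow> 'u) arrow) arrow) cat" where
  "SetFairCat small = cat_of_homs {X. fair_Set_category small X}
    (\<lambda>X Y. {\<tau>. nat_trans (opposite fat_delta) (SET small) X Y \<tau>})
    (\<lambda>X. \<lambda>e \<in> Obj fat_delta. Ident (SET small) (FObj X e))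
    (\<lambda>_ \<sigma> \<tau>. \<lambda>e \<in> Obj fat_delta. Comp (SET small) (\<sigma> e) (\<tau> e))"

end

theory Submission
  imports Defs
begin

text \<open>A fair presheaf \<open>X\<close> has an underlying category: objects are the elements over one dot, arrows those
  over two unlinked dots, and three unlinked dots give the composition. The identities come from two
  linked dots, whose fibre is in bijection with the objects by colour preservation. An arrow of the
  fat delta is determined by its map on dots, and every object is an iterated pushout of pairs of
  consecutive dots; hence an element over \<open>e\<close> is the same as a functor from the chain of dots of \<open>e\<close>
  that sends links to identities. This makes the passage to the underlying category fully
  faithful. It is essentially surjective because the nerve of a category, pulled back along the
  projection to the simplex category, is fair and has that category as underlying category.\<close>

section \<open>Categories and equivalences\<close>

text \<open>The fat delta has no degeneracies: its arrows are injective on dots, so no arrow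
  collapses two dots to one, and identities are available only as inverses of the bijections
  attached to vertical arrows. That the two ends of a linked pair agree and that identities are
  neutral is therefore not formal; both facts are extracted with the help of vertical arrows into
  objects with three dots. Once composites can be computed inside a single element, an equation in
  the underlying category is read off from the faces of an element over a large enough object. In
  the other direction the obstacle is size: the values of a presheaf are sets of elements of one
  type \<open>'u\<close>, so a functor from an ordinal has to be coded by a single element, which an
  injective pairing on an infinite type makes possible. The fibre product condition ranges over all
  choices of pushout, but pushouts of one span are isomorphic, so an explicit concatenation
  suffices. The adjoint equivalence is assembled by choosing preimages, with the unit made from the
  inverse of the counit so that the triangle identities hold.\<close>

lemma homI: "\<lbrakk>f \<in> Arr C; Dom C f = x; Cod C f = y\<rbrakk> \<Longrightarrow> f \<in> hom C x y"
  by (simp add: hom_def)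

lemma homD:
  assumes "f \<in> hom C x y"
  shows "f \<in> Arr C" "Dom C f = x" "Cod C f = y"
  using assms by (auto simp: hom_def)

lemma (in category) hom_Obj:
  assumes "f \<in> hom C x y"
  shows "x \<in> Obj C" "y \<in> Obj C"
  using assms Dom_Obj Cod_Obj by (auto simp: hom_def)

lemma (in category) Comp_Id': "f \<in> hom C x y \<Longrightarrow> Comp C f (Ident C x) = f"
  using Comp_Id by (auto simp: hom_def)

lemma (in category) Id_Comp': "f \<in> hom C x y \<Longrightarrow> Comp C (Ident C y) f = f"
  using Id_Comp by (auto simp: hom_def)

lemma cat_of_homs_simps [simp]:
  "Obj (cat_of_homs Ob H i c) = Ob"
  "Dom (cat_of_homs Ob H i c) = src"
  "Cod (cat_of_homs Ob H i c) = tgt"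
  "Ident (cat_of_homs Ob H i c) x = Arrow x (i x) x"
  "Comp (cat_of_homs Ob H i c) b a = Arrow (src a) (c (src a) (body b) (body a)) (tgt b)"
  "a \<in> Arr (cat_of_homs Ob H i c) \<longleftrightarrow> src a \<in> Ob \<and> tgt a \<in> Ob \<and> body a \<in> H (src a) (tgt a)"
  by (simp_all add: cat_of_homs_def)

lemma hom_cat_of_homs [simp]:
  "a \<in> hom (cat_of_homs Ob H i c) x y \<longleftrightarrow>
    src a = x \<and> tgt a = y \<and> x \<in> Ob \<and> y \<in> Ob \<and> body a \<in> H x y"
  by (auto simp: hom_def)

lemma category_cat_of_homs:
  assumes "\<And>x. x \<in> Ob \<Longrightarrow> i x \<in> H x x"
    and "\<And>x y z f g. \<lbrakk>x \<in> Ob; y \<in> Ob; z \<in> Ob; f \<in> H x y; g \<in> H y z\<rbrakk> \<Longrightarrow> c x g f \<in> H x z"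
    and "\<And>x y f. \<lbrakk>x \<in> Ob; y \<in> Ob; f \<in> H x y\<rbrakk> \<Longrightarrow> c x f (i x) = f"
    and "\<And>x y f. \<lbrakk>x \<in> Ob; y \<in> Ob; f \<in> H x y\<rbrakk> \<Longrightarrow> c x (i y) f = f"
    and "\<And>w x y z f g h. \<lbrakk>w \<in> Ob; x \<in> Ob; y \<in> Ob; z \<in> Ob; f \<in> H w x; g \<in> H x y; h \<in> H y z\<rbrakk>
      \<Longrightarrow> c w h (c w g f) = c w (c x h g) f"
  shows "category (cat_of_homs Ob H i c)"
  by unfold_locales (auto intro: assms(1,2) simp: assms(3-5) arrow.expand)

lemma opposite_simps [simp]:
  "Obj (opposite C) = Obj C" "Arr (opposite C) = Arr C" "Dom (opposite C) = Cod C"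
  "Cod (opposite C) = Dom C" "Ident (opposite C) = Ident C" "Comp (opposite C) g f = Comp C f g"
  by (simp_all add: opposite_def)

lemma hom_opposite [simp]: "hom (opposite C) x y = hom C y x"
  by (auto simp: hom_def)

lemma category_opposite:
  assumes "category C" shows "category (opposite C)"
proof -
  interpret category C by fact
  show ?thesis
    by unfold_locales (auto simp: Dom_Obj Cod_Obj Id_hom Comp_Id Id_Comp Comp_assoc intro: Comp_hom)
qed

lemma fctr_eqI:
  fixes F G :: "('o, 'a, 'p, 'b) fctr"
  assumes "FObj F = FObj G" "FArr F = FArr G" shows "F = G"
  using assms by simp

lemma functor_eqI:
  assumes F: "is_functor A B F" and G: "is_functor A B G"
    and obj: "\<And>x. x \<in> Obj A \<Longrightarrow> FObj F x = FObj G x"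
    and arr: "\<And>f. f \<in> Arr A \<Longrightarrow> FArr F f = FArr G f"
  shows "F = G"
proof (rule fctr_eqI)
  show "FObj F = FObj G"
    using is_functor.FObj_extensional[OF F] is_functor.FObj_extensional[OF G] obj
    by (rule extensionalityI)
  show "FArr F = FArr G"
    using is_functor.FArr_extensional[OF F] is_functor.FArr_extensional[OF G] arr
    by (rule extensionalityI)
qed

lemma id_fctr_simps [simp]:
  "x \<in> Obj A \<Longrightarrow> FObj (id_fctr A) x = x" "f \<in> Arr A \<Longrightarrow> FArr (id_fctr A) f = f"
  by (simp_all add: id_fctr_def)

lemma comp_fctr_simps [simp]:
  "x \<in> Obj A \<Longrightarrow> FObj (comp_fctr A G F) x = FObj G (FObj F x)"
  "f \<in> Arr A \<Longrightarrow> FArr (comp_fctr A G F) f = FArr G (FArr F f)"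
  by (simp_all add: comp_fctr_def compose_def)

lemma is_functor_id:
  assumes "category A" shows "is_functor A A (id_fctr A)"
proof -
  interpret category A by fact
  show ?thesis
    by unfold_locales
      (auto simp: id_fctr_def hom_def Dom_Obj Cod_Obj Id_hom[unfolded hom_def, simplified]
        Comp_hom[unfolded hom_def, simplified])
qed

lemma is_functor_comp:
  assumes "is_functor A B F" "is_functor B C G" shows "is_functor A C (comp_fctr A G F)"
proof -
  interpret F: is_functor A B F by fact
  interpret G: is_functor B C G by fact
  show ?thesis
  proof unfold_locales
    fix f x y assume f: "f \<in> hom A x y"
    then show "FArr (comp_fctr A G F) f \<in> hom C (FObj (comp_fctr A G F) x) (FObj (comp_fctr A G F) y)"
      using F.A.hom_Obj[OF f] by (simp add: F.FArr_hom G.FArr_hom homD)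
  next
    fix x assume x: "x \<in> Obj A"
    then show "FArr (comp_fctr A G F) (Ident A x) = Ident C (FObj (comp_fctr A G F) x)"
      using F.A.Id_hom[OF x] by (simp add: F.FArr_Id G.FArr_Id F.FObj_Obj homD)
  next
    fix f g x y z assume fg: "f \<in> hom A x y" "g \<in> hom A y z"
    then have "FArr F f \<in> hom B (FObj F x) (FObj F y)" "FArr F g \<in> hom B (FObj F y) (FObj F z)"
      by (auto intro: F.FArr_hom)
    then show "FArr (comp_fctr A G F) (Comp A g f)
        = Comp C (FArr (comp_fctr A G F) g) (FArr (comp_fctr A G F) f)"
      using fg F.A.Comp_hom[OF fg] by (simp add: F.FArr_Comp G.FArr_Comp homD)
  qed (auto simp: comp_fctr_def compose_def G.FObj_Obj F.FObj_Obj)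
qed

lemma is_isoE:
  assumes "is_iso C f" "f \<in> hom C x y"
  obtains g where "g \<in> hom C y x" "Comp C g f = Ident C x" "Comp C f g = Ident C y"
  using assms by (auto simp: is_iso_def hom_def)

lemma is_isoI:
  assumes "f \<in> hom C x y" "g \<in> hom C y x" "Comp C g f = Ident C x" "Comp C f g = Ident C y"
  shows "is_iso C f"
  using assms by (auto simp: is_iso_def hom_def)

section \<open>Adjoint equivalences from fully faithful, essentially surjective functors\<close>

definition fully_faithful where
  "fully_faithful A B F \<longleftrightarrow>
    (\<forall>x \<in> Obj A. \<forall>y \<in> Obj A. bij_betw (FArr F) (hom A x y) (hom B (FObj F x) (FObj F y)))"

definition essentially_surjective where
  "essentially_surjective A B F \<longleftrightarrow>
    (\<forall>y \<in> Obj B. \<exists>x \<in> Obj A. \<exists>f \<in> hom B (FObj F x) y. is_iso B f)"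

text \<open>For every \<open>y\<close> an isomorphism \<open>e y\<close> onto \<open>y\<close> from
  the image of an object \<open>g y\<close> is chosen. The functor \<open>G\<close> lifts
  conjugation by these isomorphisms through \<open>F\<close>, the counit is \<open>e\<close> itself
  and the unit lifts its inverse \<open>e'\<close>. Equations in \<open>A\<close> are tested after
  applying \<open>F\<close>, where they follow from the inverse laws of \<open>e\<close> and
  \<open>e'\<close>.\<close>

lemma adjoint_equivalence_of_fully_faithful:
  assumes isF: "is_functor A B F" and ff: "fully_faithful A B F"
    and es: "essentially_surjective A B F"
  shows "\<exists>G \<eta> \<epsilon>. adjoint_equivalence A B F G \<eta> \<epsilon>"
proof -
  interpret F: is_functor A B F by fact
  have "\<forall>y \<in> Obj B. \<exists>x e e'. x \<in> Obj A \<and> e \<in> hom B (FObj F x) y \<and> e' \<in> hom B y (FObj F x)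
      \<and> Comp B e' e = Ident B (FObj F x) \<and> Comp B e e' = Ident B y"
    using es unfolding essentially_surjective_def by (metis is_isoE)
  then obtain g e e' where ch: "\<And>y. y \<in> Obj B \<Longrightarrow> g y \<in> Obj A \<and> e y \<in> hom B (FObj F (g y)) y
      \<and> e' y \<in> hom B y (FObj F (g y)) \<and> Comp B (e' y) (e y) = Ident B (FObj F (g y))
      \<and> Comp B (e y) (e' y) = Ident B y"
    by metis
  then have g: "\<And>y. y \<in> Obj B \<Longrightarrow> g y \<in> Obj A"
    and e: "\<And>y. y \<in> Obj B \<Longrightarrow> e y \<in> hom B (FObj F (g y)) y"
    and e': "\<And>y. y \<in> Obj B \<Longrightarrow> e' y \<in> hom B y (FObj F (g y))"
    and e'e: "\<And>y. y \<in> Obj B \<Longrightarrow> Comp B (e' y) (e y) = Ident B (FObj F (g y))"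
    and ee': "\<And>y. y \<in> Obj B \<Longrightarrow> Comp B (e y) (e' y) = Ident B y"
    by blast+
  have "\<exists>f. f \<in> hom A x y \<and> FArr F f = h"
    if "x \<in> Obj A" "y \<in> Obj A" "h \<in> hom B (FObj F x) (FObj F y)" for x y h
    using ff that unfolding fully_faithful_def bij_betw_def by (metis imageE)
  then obtain L where L: "\<And>x y h. \<lbrakk>x \<in> Obj A; y \<in> Obj A; h \<in> hom B (FObj F x) (FObj F y)\<rbrakk>
      \<Longrightarrow> L x y h \<in> hom A x y \<and> FArr F (L x y h) = h"
    by metis
  have faithful: "f = f'" if "f \<in> hom A x y" "f' \<in> hom A x y" "FArr F f = FArr F f'" for x y f f'
  proof -
    have "x \<in> Obj A" "y \<in> Obj A" using F.A.hom_Obj that by blast+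
    then have "inj_on (FArr F) (hom A x y)" using ff unfolding fully_faithful_def bij_betw_def by blast
    then show ?thesis using that by (meson inj_onD)
  qed
  \<comment> \<open>\<open>k h\<close> is \<open>h\<close> conjugated by the chosen isomorphisms,
    that is, the arrow that \<open>G h\<close> has to become under \<open>F\<close>. Naturality of
    \<open>e\<close>, recorded below as \<open>e_k\<close>, is built into it.\<close>
  define k where "k h = Comp B (e' (Cod B h)) (Comp B h (e (Dom B h)))" for h
  define G where "G = \<lparr>FObj = restrict g (Obj B),
    FArr = (\<lambda>h \<in> Arr B. L (g (Dom B h)) (g (Cod B h)) (k h))\<rparr>"
  have k: "k h \<in> hom B (FObj F (g x)) (FObj F (g y))" if "h \<in> hom B x y" for h x y
    using that e[of x] e'[of y] F.B.hom_Obj[OF that] unfolding k_def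
    by (auto simp: homD intro!: F.B.Comp_hom)
  have GObj: "FObj G y = g y" if "y \<in> Obj B" for y using that by (simp add: G_def)
  have GArr: "FArr G h \<in> hom A (g x) (g y)" "FArr F (FArr G h) = k h" if "h \<in> hom B x y" for h x y
    using that k[OF that] L[of "g x" "g y" "k h"] g F.B.hom_Obj[OF that]
    by (auto simp: G_def homD)
  have e_k: "Comp B (e y) (k h) = Comp B h (e x)" if h: "h \<in> hom B x y" for h x y
  proof -
    have xy: "x \<in> Obj B" "y \<in> Obj B" using F.B.hom_Obj[OF h] by auto
    have "Comp B (e y) (k h) = Comp B (Comp B (e y) (e' y)) (Comp B h (e x))"
      unfolding k_def homD[OF h]
      by (rule F.B.Comp_assoc[OF _ e'[OF xy(2)] e[OF xy(2)]])
        (rule F.B.Comp_hom[OF e[OF xy(1)] h])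
    also have "\<dots> = Comp B h (e x)"
      using ee'[OF xy(2)] F.B.Id_Comp'[OF F.B.Comp_hom[OF e[OF xy(1)] h]] by simp
    finally show ?thesis .
  qed
  \<comment> \<open>Each \<open>e y\<close> is left cancellable because \<open>e' y\<close> is a
    left inverse; this reduces functoriality of \<open>k\<close> to \<open>e_k\<close>.\<close>
  have e_cancel: "u = v" if "u \<in> hom B x (FObj F (g y))" "v \<in> hom B x (FObj F (g y))"
    "Comp B (e y) u = Comp B (e y) v" "y \<in> Obj B" for u v x y
    by (metis that F.B.Comp_assoc F.B.Id_Comp' e'e e e')
  have functor_G: "is_functor B A G"
  proof unfold_locales
    fix x assume x: "x \<in> Obj B"
    then show "FObj G x \<in> Obj A" by (simp add: GObj g)
    have "k (Ident B x) = Ident B (FObj F (g x))"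
      by (rule e_cancel[OF k[OF F.B.Id_hom[OF x]] _ _ x])
        (simp_all add: F.B.Id_hom x g F.FObj_Obj e_k[OF F.B.Id_hom[OF x]] F.B.Id_Comp'[OF e[OF x]]
          F.B.Comp_Id'[OF e[OF x]])
    then show "FArr G (Ident B x) = Ident A (FObj G x)"
      by (intro faithful[of _ "g x" "g x"])
       (simp_all add: GObj GArr[OF F.B.Id_hom[OF x]] x g F.FArr_Id F.A.Id_hom)
  next
    fix f x y assume "f \<in> hom B x y"
    then show "FArr G f \<in> hom A (FObj G x) (FObj G y)"
      using F.B.hom_Obj[of f x y] by (simp add: GObj GArr)
  next
    fix f h x y z assume f: "f \<in> hom B x y" and h: "h \<in> hom B y z"
    have hf: "Comp B h f \<in> hom B x z" using f h by (rule F.B.Comp_hom)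
    have obj: "x \<in> Obj B" "y \<in> Obj B" "z \<in> Obj B" using F.B.hom_Obj f h by blast+
    have "k (Comp B h f) = Comp B (k h) (k f)"
    proof (rule e_cancel[OF k[OF hf] F.B.Comp_hom[OF k[OF f] k[OF h]] _ obj(3)])
      have "Comp B (e z) (Comp B (k h) (k f)) = Comp B (Comp B h (e y)) (k f)"
        using F.B.Comp_assoc[OF k[OF f] k[OF h] e[OF obj(3)]] e_k[OF h] by simp
      also have "\<dots> = Comp B h (Comp B f (e x))"
        using F.B.Comp_assoc[OF k[OF f] e[OF obj(2)] h] e_k[OF f] by simp
      also have "\<dots> = Comp B (e z) (k (Comp B h f))"
        using F.B.Comp_assoc[OF e[OF obj(1)] f h] e_k[OF hf] by simp
      finally show "Comp B (e z) (k (Comp B h f)) = Comp B (e z) (Comp B (k h) (k f))" ..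
    qed
    then show "FArr G (Comp B h f) = Comp A (FArr G h) (FArr G f)"
      by (intro faithful[OF GArr(1)[OF hf] F.A.Comp_hom[OF GArr(1)[OF f] GArr(1)[OF h]]])
        (simp add: GArr(2)[OF hf] GArr(2)[OF h] GArr(2)[OF f] F.FArr_Comp[OF GArr(1)[OF f] GArr(1)[OF h]])
  qed (simp_all add: G_def)
  define \<eta> where "\<eta> = (\<lambda>x \<in> Obj A. L x (g (FObj F x)) (e' (FObj F x)))"
  define \<eta>' where "\<eta>' x = L (g (FObj F x)) x (e (FObj F x))" for x
  have \<eta>: "\<eta> x \<in> hom A x (g (FObj F x))" "FArr F (\<eta> x) = e' (FObj F x)"
    "\<eta>' x \<in> hom A (g (FObj F x)) x" "FArr F (\<eta>' x) = e (FObj F x)" if "x \<in> Obj A" for x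
    using that L[of x "g (FObj F x)" "e' (FObj F x)"] L[of "g (FObj F x)" x "e (FObj F x)"]
      e e' g F.FObj_Obj[of x] by (auto simp: \<eta>_def \<eta>'_def)
  have \<eta>_inv: "Comp A (\<eta>' x) (\<eta> x) = Ident A x" "Comp A (\<eta> x) (\<eta>' x) = Ident A (g (FObj F x))"
    if x: "x \<in> Obj A" for x
  proof -
    note y = F.FObj_Obj[OF x]
    show "Comp A (\<eta>' x) (\<eta> x) = Ident A x"
      by (rule faithful[OF F.A.Comp_hom[OF \<eta>(1)[OF x] \<eta>(3)[OF x]] F.A.Id_hom[OF x]])
        (simp add: F.FArr_Comp[OF \<eta>(1)[OF x] \<eta>(3)[OF x]] \<eta> x F.FArr_Id ee' y)
    show "Comp A (\<eta> x) (\<eta>' x) = Ident A (g (FObj F x))"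
      by (rule faithful[OF F.A.Comp_hom[OF \<eta>(3)[OF x] \<eta>(1)[OF x]] F.A.Id_hom])
        (simp_all add: F.FArr_Comp[OF \<eta>(3)[OF x] \<eta>(1)[OF x]] \<eta> x F.FArr_Id e'e y g)
  qed
  define \<epsilon> where "\<epsilon> = restrict e (Obj B)"
  have "nat_iso A A (id_fctr A) (comp_fctr A G F) \<eta>"
  proof (intro nat_iso.intro nat_trans.intro nat_iso_axioms.intro nat_trans_axioms.intro
      is_functor_id is_functor_comp[OF isF functor_G] F.A.category_axioms)
    fix f x y assume f: "f \<in> hom A x y"
    have xy: "x \<in> Obj A" "y \<in> Obj A" using F.A.hom_Obj[OF f] by auto
    note Ff = F.FArr_hom[OF f] and yB = F.FObj_Obj[OF xy(2)] and xB = F.FObj_Obj[OF xy(1)]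
    have GFf: "FArr G (FArr F f) \<in> hom A (g (FObj F x)) (g (FObj F y))" by (rule GArr[OF Ff])
    have "Comp A (\<eta> y) f = Comp A (FArr G (FArr F f)) (\<eta> x)"
    proof (rule faithful[OF F.A.Comp_hom[OF f \<eta>(1)] F.A.Comp_hom[OF \<eta>(1) GFf]])
      have "Comp B (k (FArr F f)) (e' (FObj F x)) = Comp B (e' (FObj F y)) (FArr F f)"
      proof (rule e_cancel[OF F.B.Comp_hom[OF e' k[OF Ff]] F.B.Comp_hom[OF Ff e'] _ yB])
        show "Comp B (e (FObj F y)) (Comp B (k (FArr F f)) (e' (FObj F x)))
            = Comp B (e (FObj F y)) (Comp B (e' (FObj F y)) (FArr F f))"
          using F.B.Comp_assoc[OF e'[OF xB] k[OF Ff] e[OF yB]] F.B.Comp_assoc[OF Ff e'[OF yB] e[OF yB]]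
            F.B.Comp_assoc[OF e'[OF xB] e[OF xB] Ff]
          by (simp add: e_k[OF Ff] ee' xB yB F.B.Comp_Id'[OF Ff] F.B.Id_Comp'[OF Ff])
      qed (use xB yB in auto)
      then show "FArr F (Comp A (\<eta> y) f) = FArr F (Comp A (FArr G (FArr F f)) (\<eta> x))"
        by (simp add: F.FArr_Comp[OF f \<eta>(1)] F.FArr_Comp[OF \<eta>(1) GFf] \<eta> xy GArr(2)[OF Ff])
    qed (use xy in auto)
    then show "Comp A (\<eta> y) (FArr (id_fctr A) f) = Comp A (FArr (comp_fctr A G F) f) (\<eta> x)"
      using f by (simp add: homD)
  next
    fix x assume x: "x \<in> Obj A"
    then show "\<eta> x \<in> hom A (FObj (id_fctr A) x) (FObj (comp_fctr A G F) x)"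
      using \<eta>(1)[OF x] by (simp add: GObj F.FObj_Obj)
    show "is_iso A (\<eta> x)"
      using is_isoI[OF \<eta>(1)[OF x] \<eta>(3)[OF x]] \<eta>_inv[OF x] by simp
  qed (simp add: \<eta>_def)
  moreover have "nat_iso B B (comp_fctr B F G) (id_fctr B) \<epsilon>"
  proof (intro nat_iso.intro nat_trans.intro nat_iso_axioms.intro nat_trans_axioms.intro
      is_functor_id is_functor_comp[OF functor_G isF] F.B.category_axioms)
    fix f x y assume f: "f \<in> hom B x y"
    then show "Comp B (\<epsilon> y) (FArr (comp_fctr B F G) f) = Comp B (FArr (id_fctr B) f) (\<epsilon> x)"
      using e_k[OF f] F.B.hom_Obj[OF f] by (simp add: homD GArr(2)[OF f] \<epsilon>_def)
  next
    fix x assume x: "x \<in> Obj B"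
    then show "\<epsilon> x \<in> hom B (FObj (comp_fctr B F G) x) (FObj (id_fctr B) x)"
      using e[OF x] by (simp add: \<epsilon>_def GObj)
    show "is_iso B (\<epsilon> x)" using is_isoI[OF e e'] x e'e ee' by (simp add: \<epsilon>_def)
  qed (simp add: \<epsilon>_def)
  moreover have "Comp B (\<epsilon> (FObj F x)) (FArr F (\<eta> x)) = Ident B (FObj F x)" if "x \<in> Obj A" for x
    using that by (simp add: \<epsilon>_def \<eta> ee' F.FObj_Obj)
  moreover have "Comp A (FArr G (\<epsilon> y)) (\<eta> (FObj G y)) = Ident A (FObj G y)" if y: "y \<in> Obj B" for y
  proof -
    note gy = g[OF y] and ey = e[OF y]
    note FGy = F.FObj_Obj[OF gy]
    \<comment> \<open>\<open>e_k\<close> for the arrow \<open>e y\<close> itself equates both sides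
      after composition with \<open>e y\<close>; the triangle identity for \<open>G\<close> rests on
      this.\<close>
    have "k (e y) = e (FObj F (g y))"
      by (rule e_cancel[OF k[OF ey] e[OF FGy] _ y]) (rule e_k[OF ey])
    then have "FArr F (FArr G (e y)) = e (FObj F (g y))" using GArr(2)[OF ey] by simp
    then show ?thesis
      by (intro faithful[of _ "g y" "g y"])
       (simp_all add: GObj y \<epsilon>_def F.A.Comp_hom[OF \<eta>(1)[OF gy] GArr(1)[OF ey]] F.A.Id_hom[OF gy]
        F.FArr_Comp[OF \<eta>(1)[OF gy] GArr(1)[OF ey]] F.FArr_Id[OF gy] \<eta>[OF gy] ee'[OF FGy])
  qed
  ultimately show ?thesis
    using isF functor_G
    by (intro exI adjoint_equivalence.intro adjoint_equivalence_axioms.intro) auto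
qed

section \<open>The fat delta\<close>

lemma Obj_Delta [simp]: "Obj Delta = UNIV"
  and Dom_Delta [simp]: "Dom Delta = src"
  and Cod_Delta [simp]: "Cod Delta = tgt"
  and Ident_Delta [simp]: "Ident Delta n = Arrow n (\<lambda>i \<in> {..n}. i) n"
  and Comp_Delta [simp]: "Comp Delta g f = Arrow (src f) (compose {..src f} (body g) (body f)) (tgt g)"
  by (simp_all add: Delta_def)

lemma Arr_Delta:
  "f \<in> Arr Delta \<longleftrightarrow> body f \<in> {..src f} \<rightarrow>\<^sub>E {..tgt f} \<and> mono_on {..src f} (body f)"
  by (simp add: Delta_def)

lemma hom_Delta:
  "f \<in> hom Delta m n \<longleftrightarrow> src f = m \<and> tgt f = n \<and> body f \<in> {..m} \<rightarrow>\<^sub>E {..n} \<and> mono_on {..m} (body f)"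
  by (auto simp: Delta_def)

lemma category_Delta: "category Delta"
  unfolding Delta_def
proof (rule category_cat_of_homs)
  fix w x y z :: nat and f g h
  assume "f \<in> {f \<in> {..w} \<rightarrow>\<^sub>E {..x}. mono_on {..w} f}" "g \<in> {f \<in> {..x} \<rightarrow>\<^sub>E {..y}. mono_on {..x} f}"
    "h \<in> {f \<in> {..y} \<rightarrow>\<^sub>E {..z}. mono_on {..y} f}"
  then show "compose {..w} h (compose {..w} g f) = compose {..w} (compose {..x} h g) f"
    by (auto intro: compose_assoc)
next
  fix x y z :: nat and f g
  assume f: "f \<in> {f \<in> {..x} \<rightarrow>\<^sub>E {..y}. mono_on {..x} f}"
    and g: "g \<in> {f \<in> {..y} \<rightarrow>\<^sub>E {..z}. mono_on {..y} f}"
  have "mono_on {..x} (compose {..x} g f)"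
  proof (rule mono_onI)
    fix i j assume ij: "i \<in> {..x}" "j \<in> {..x}" "i \<le> j"
    then have "f i \<le> f j" "f i \<in> {..y}" "f j \<in> {..y}" using f by (auto simp: mono_on_def)
    then show "compose {..x} g f i \<le> compose {..x} g f j"
      using g ij by (auto simp: compose_def mono_on_def)
  qed
  then show "compose {..x} g f \<in> {f \<in> {..x} \<rightarrow>\<^sub>E {..z}. mono_on {..x} f}"
    using f g by (auto simp: compose_def PiE_iff)
qed (auto simp: compose_def mono_on_def fun_eq_iff PiE_iff extensional_def)

text \<open>Elements of an ordinal are the arrows into it from the ordinal 0, so testing a
  monomorphism on these arrows gives injectivity.\<close>

lemma is_mono_Delta:
  "is_mono Delta f \<longleftrightarrow> f \<in> Arr Delta \<and> inj_on (body f) {..src f}"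
proof safe
  assume m: "is_mono Delta f"
  then show "f \<in> Arr Delta" by (simp add: is_mono_def)
  show "inj_on (body f) {..src f}"
  proof (rule inj_onI)
    fix i j :: nat assume ij: "i \<in> {..src f}" "j \<in> {..src f}" "body f i = body f j"
    define p where "p i = Arrow 0 (\<lambda>_ \<in> {..0::nat}. i) (src f)" for i :: nat
    have p: "p k \<in> hom Delta 0 (src f)" if "k \<le> src f" for k
      using that by (auto simp: p_def hom_Delta mono_on_def)
    have eq: "Comp Delta f (p i) = Comp Delta f (p j)"
      using ij by (auto simp: p_def compose_def fun_eq_iff)
    have "\<forall>g \<in> hom Delta 0 (src f). \<forall>h \<in> hom Delta 0 (src f). Comp Delta f g = Comp Delta f h \<longrightarrow> g = h"
      using m unfolding is_mono_def Dom_Delta by blast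
    then have "p i = p j" using p[of i] p[of j] ij eq by (simp del: Comp_Delta)
    then have "body (p i) 0 = body (p j) 0" by simp
    then show "i = j" by (simp add: p_def)
  qed
next
  assume f: "f \<in> Arr Delta" "inj_on (body f) {..src f}"
  show "is_mono Delta f"
    unfolding is_mono_def
  proof (intro conjI f allI ballI impI)
    fix x g h assume gh: "g \<in> hom Delta x (Dom Delta f)" "h \<in> hom Delta x (Dom Delta f)"
      and eq: "Comp Delta f g = Comp Delta f h"
    have "body g = body h"
    proof (rule extensionalityI)
      show "body g \<in> extensional {..x}" "body h \<in> extensional {..x}"
        using gh by (auto simp: hom_Delta PiE_def)
      fix i assume i: "i \<in> {..x}"
      have "body f (body g i) = body f (body h i)"
        using eq gh i by (auto simp: hom_Delta compose_def fun_eq_iff restrict_def split: if_splits)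
      moreover have "body g i \<in> {..src f}" "body h i \<in> {..src f}" using gh i by (auto simp: hom_Delta)
      ultimately show "body g i = body h i" using f(2) by (meson inj_onD)
    qed
    then show "g = h" using gh by (simp add: hom_Delta arrow.expand)
  qed
qed

lemma is_epi_Delta:
  "is_epi Delta e \<longleftrightarrow> e \<in> Arr Delta \<and> body e ` {..src e} = {..tgt e}"
proof safe
  fix j assume m: "is_epi Delta e" and j: "j \<le> tgt e"
  show "j \<in> body e ` {..src e}"
  proof (rule ccontr)
    assume n: "j \<notin> body e ` {..src e}"
    \<comment> \<open>If \<open>e\<close> misses \<open>j\<close>, the two threshold maps that
      switch to 1 at \<open>j\<close> and just after \<open>j\<close> agree along \<open>e\<close>
      but differ at \<open>j\<close>.\<close>
    define p where "p = Arrow (tgt e) (\<lambda>i \<in> {..tgt e}. if i < j then 0 else 1::nat) 1"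
    define q where "q = Arrow (tgt e) (\<lambda>i \<in> {..tgt e}. if i \<le> j then 0 else 1::nat) 1"
    have "p \<in> hom Delta (Cod Delta e) 1" "q \<in> hom Delta (Cod Delta e) 1"
      by (auto simp: p_def q_def hom_Delta mono_on_def)
    moreover have "Comp Delta p e = Comp Delta q e"
      using n by (force simp: p_def q_def compose_def fun_eq_iff restrict_def)
    ultimately have "p = q" using m by (simp add: is_epi_def)
    then have "body p j = body q j" by simp
    then show False using j by (simp add: p_def q_def)
  qed
next
  assume f: "e \<in> Arr Delta" "body e ` {..src e} = {..tgt e}"
  show "is_epi Delta e"
    unfolding is_epi_def
  proof (intro conjI f allI ballI impI)
    fix x g h assume gh: "g \<in> hom Delta (Cod Delta e) x" "h \<in> hom Delta (Cod Delta e) x"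
      and eq: "Comp Delta g e = Comp Delta h e"
    have "body g = body h"
    proof (rule extensionalityI)
      show "body g \<in> extensional {..tgt e}" "body h \<in> extensional {..tgt e}"
        using gh by (auto simp: hom_Delta PiE_def)
      fix i assume "i \<in> {..tgt e}"
      then obtain d where "d \<le> src e" "i = body e d" using f(2) by blast
      then show "body g i = body h i"
        using eq by (auto simp: compose_def fun_eq_iff restrict_def split: if_splits)
    qed
    then show "g = h" using gh by (simp add: hom_Delta arrow.expand)
  qed
qed (auto simp: is_epi_def Arr_Delta)

lemma category_fat_cat: "category fat_cat"
proof -
  interpret category Delta by (rule category_Delta)
  have mono_comp: "is_mono Delta (Comp Delta g f)"
    if "is_mono Delta f" "is_mono Delta g" "tgt f = src g" for f g
  proof -
    have "f \<in> hom Delta (src f) (tgt f)" "g \<in> hom Delta (tgt f) (tgt g)"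
      using that by (auto simp: is_mono_Delta intro: homI)
    from Comp_hom[OF this] have "Comp Delta g f \<in> Arr Delta" by (rule homD)
    moreover have "inj_on (compose {..src f} (body g) (body f)) {..src f}"
    proof (rule inj_onI)
      fix i j assume ij: "i \<in> {..src f}" "j \<in> {..src f}"
        and "compose {..src f} (body g) (body f) i = compose {..src f} (body g) (body f) j"
      then have "body g (body f i) = body g (body f j)" by (simp add: compose_def)
      moreover have "body f i \<in> {..src g}" "body f j \<in> {..src g}"
        using ij that by (auto simp: is_mono_Delta Arr_Delta)
      ultimately show "i = j" using that ij by (auto simp: is_mono_Delta dest!: inj_onD)
    qed
    ultimately show ?thesis by (simp add: is_mono_Delta)
  qed
  define H where "H = (\<lambda>e e'. {(f, g). is_mono Delta f \<and> f \<in> hom Delta (Dom Delta e) (Dom Delta e') \<and>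
    g \<in> hom Delta (Cod Delta e) (Cod Delta e') \<and> Comp Delta g e = Comp Delta e' f})"
  define c where "c = (\<lambda>(_ :: fat_obj) (f', g') (f, g). (Comp Delta f' f, Comp Delta g' g))"
  have H: "p \<in> H e e' \<longleftrightarrow> is_mono Delta (fst p) \<and> fst p \<in> hom Delta (src e) (src e') \<and>
    snd p \<in> hom Delta (tgt e) (tgt e') \<and> Comp Delta (snd p) e = Comp Delta e' (fst p)" for p e e'
    by (simp add: H_def case_prod_beta del: Comp_Delta)
  have c: "fst (c x q p) = Comp Delta (fst q) (fst p)" "snd (c x q p) = Comp Delta (snd q) (snd p)" for x p q
    by (simp_all add: c_def case_prod_beta del: Comp_Delta)
  have e_hom: "e \<in> hom Delta (src e) (tgt e)" if "e \<in> {e. is_epi Delta e}" for e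
    using that by (auto simp: is_epi_def intro: homI)
  have "category (cat_of_homs {e. is_epi Delta e} H
      (\<lambda>e. (Ident Delta (Dom Delta e), Ident Delta (Cod Delta e))) c)"
  proof (rule category_cat_of_homs)
    fix e assume "e \<in> {e. is_epi Delta e}"
    note e = e_hom[OF this]
    have "is_mono Delta (Ident Delta (src e))"
      using Id_hom[of "src e"] by (simp add: is_mono_Delta hom_def inj_on_def)
    then show "(Ident Delta (Dom Delta e), Ident Delta (Cod Delta e)) \<in> H e e"
      using Id_hom Comp_Id'[OF e] Id_Comp'[OF e] by (simp add: H del: Ident_Delta Comp_Delta)
  next
    fix x y z p q
    assume p: "p \<in> H x y" and q: "q \<in> H y z"
      and xyz: "x \<in> {e. is_epi Delta e}" "y \<in> {e. is_epi Delta e}" "z \<in> {e. is_epi Delta e}"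
    note h = xyz[THEN e_hom]
    have f: "is_mono Delta (fst p)" "fst p \<in> hom Delta (src x) (src y)"
      "snd p \<in> hom Delta (tgt x) (tgt y)" "Comp Delta (snd p) x = Comp Delta y (fst p)"
      and f': "is_mono Delta (fst q)" "fst q \<in> hom Delta (src y) (src z)"
      "snd q \<in> hom Delta (tgt y) (tgt z)" "Comp Delta (snd q) y = Comp Delta z (fst q)"
      using p q unfolding H by blast+
    have "Comp Delta (Comp Delta (snd q) (snd p)) x = Comp Delta z (Comp Delta (fst q) (fst p))"
      using Comp_assoc[OF h(1) f(3) f'(3)] Comp_assoc[OF f(2) h(2) f'(3)]
        Comp_assoc[OF f(2) f'(2) h(3)] f(4) f'(4) by (simp del: Comp_Delta)
    moreover have "is_mono Delta (Comp Delta (fst q) (fst p))"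
      using mono_comp[OF f(1) f'(1)] f(2) f'(2) by (simp add: hom_Delta)
    moreover note Comp_hom[OF f(2) f'(2)] Comp_hom[OF f(3) f'(3)]
    ultimately show "c x q p \<in> H x z" unfolding H c by blast
  next
    fix x y p assume "p \<in> H x y"
    then have "fst p \<in> hom Delta (src x) (src y)" "snd p \<in> hom Delta (tgt x) (tgt y)"
      unfolding H by blast+
    then show "c x p (Ident Delta (Dom Delta x), Ident Delta (Cod Delta x)) = p"
      "c x (Ident Delta (Dom Delta y), Ident Delta (Cod Delta y)) p = p"
      using Comp_Id' Id_Comp' by (simp_all add: prod_eq_iff c del: Ident_Delta Comp_Delta)
  next
    fix w x y z p q r
    assume "p \<in> H w x" "q \<in> H x y" "r \<in> H y z"
    then have "fst p \<in> hom Delta (src w) (src x)" "snd p \<in> hom Delta (tgt w) (tgt x)"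
      "fst q \<in> hom Delta (src x) (src y)" "snd q \<in> hom Delta (tgt x) (tgt y)"
      "fst r \<in> hom Delta (src y) (src z)" "snd r \<in> hom Delta (tgt y) (tgt z)"
      unfolding H by blast+
    then show "c w r (c w q p) = c w (c x r q) p"
      using Comp_assoc by (simp add: prod_eq_iff c del: Comp_Delta)
  qed
  then show ?thesis unfolding fat_cat_def H_def c_def .
qed

section \<open>Colours on a category and on its opposite\<close>

lemma add_colours_simps [simp]:
  "Obj (add_colours C c d) = Obj C" "Arr (add_colours C c d) = Arr C"
  "Dom (add_colours C c d) = Dom C" "Cod (add_colours C c d) = Cod C"
  "Ident (add_colours C c d) = Ident C" "Comp (add_colours C c d) = Comp C"
  "Col (add_colours C c d) = c" "Disc (add_colours C c d) = d"
  by (simp_all add: add_colours_def)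

lemma hom_add_colours [simp]: "hom (add_colours C c d) = hom C"
  by (simp add: hom_def fun_eq_iff)

lemma category_add_colours: "category C \<Longrightarrow> category (add_colours C c d)"
  by (simp add: category_def)

lemma opposite_colour_simps [simp]: "Col (opposite C) = Col C" "Disc (opposite C) = Disc C"
  by (simp_all add: opposite_def)

lemma fat_delta_simps [simp]:
  "Obj fat_delta = {e. is_epi Delta e}" "Dom fat_delta = src" "Cod fat_delta = tgt"
  "Col fat_delta = vertical" "Disc fat_delta = {one_dot}"
  by (simp_all add: fat_delta_def fat_cat_def)

lemma category_fat_delta: "category fat_delta"
  unfolding fat_delta_def by (rule category_add_colours[OF category_fat_cat])

lemma coloured_category_opposite:
  assumes "coloured_category C" shows "coloured_category (opposite C)"
proof -
  interpret coloured_category C by fact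
  interpret op: category "opposite C" by (rule category_opposite) (rule category_axioms)
  show ?thesis by unfold_locales (use Col_Arr Id_Col Comp_Col Disc_Obj in auto)
qed

section \<open>Arrows of the fat delta as maps on dots\<close>

text \<open>Links are tested on all pairs of dots in one fibre, not only on consecutive ones, and
  monotonicity together with injectivity becomes one strict inequality.\<close>

definition dot_map :: "fat_obj \<Rightarrow> fat_obj \<Rightarrow> (nat \<Rightarrow> nat) \<Rightarrow> bool" where
  "dot_map e e' f \<longleftrightarrow> e \<in> Obj fat_delta \<and> e' \<in> Obj fat_delta \<and>
    (\<forall>d \<le> src e. f d \<le> src e') \<and>
    (\<forall>d d'. d < d' \<and> d' \<le> src e \<longrightarrow> f d < f d' \<and> (body e d = body e d' \<longrightarrow> body e' (f d) = body e' (f d')))"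

text \<open>The second component is forced because \<open>e\<close> is onto; the least dot over
  \<open>i\<close> serves as a representative of its fibre.\<close>

definition fat_arrow :: "fat_obj \<Rightarrow> fat_obj \<Rightarrow> (nat \<Rightarrow> nat) \<Rightarrow> fat_arr" where
  "fat_arrow e e' f = Arrow e
    (Arrow (src e) (\<lambda>d \<in> {..src e}. f d) (src e'),
     Arrow (tgt e) (\<lambda>i \<in> {..tgt e}. body e' (f (LEAST d. body e d = i))) (tgt e')) e'"

lemma fat_obj_props:
  assumes "e \<in> Obj fat_delta"
  shows "\<And>d. d \<le> src e \<Longrightarrow> body e d \<le> tgt e"
    "\<And>d d'. d \<le> d' \<Longrightarrow> d' \<le> src e \<Longrightarrow> body e d \<le> body e d'"
    "\<And>i. i \<le> tgt e \<Longrightarrow> \<exists>d \<le> src e. body e d = i"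
    "body e \<in> extensional {..src e}"
    "body e 0 = 0" "body e (src e) = tgt e"
    "\<And>d. d < src e \<Longrightarrow> body e (Suc d) = body e d \<or> body e (Suc d) = Suc (body e d)"
proof -
  show le: "body e d \<le> tgt e" if "d \<le> src e" for d
    using assms that by (auto simp: is_epi_Delta Arr_Delta)
  show mono: "body e d \<le> body e d'" if "d \<le> d'" "d' \<le> src e" for d d'
    using assms that by (auto simp: is_epi_Delta Arr_Delta mono_on_def)
  show surj: "\<exists>d \<le> src e. body e d = i" if "i \<le> tgt e" for i
  proof -
    have "i \<in> body e ` {..src e}" using assms that by (simp add: is_epi_Delta)
    then show ?thesis by blast
  qed
  show "body e \<in> extensional {..src e}"
    using assms by (auto simp: is_epi_Delta Arr_Delta PiE_def)
  show "body e 0 = 0" using surj[of 0] mono by fastforce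
  obtain d where "d \<le> src e" "body e d = tgt e" using surj by blast
  then show "body e (src e) = tgt e" using mono[of d "src e"] le[of "src e"] by simp
  show "body e (Suc d) = body e d \<or> body e (Suc d) = Suc (body e d)" if d: "d < src e" for d
  proof (rule ccontr)
    assume *: "\<not> ?thesis"
    have "body e d \<le> body e (Suc d)" using d by (intro mono) auto
    \<comment> \<open>A jump by two or more would leave the value \<open>Suc (body e d)\<close>
      without a preimage, against surjectivity.\<close>
    then have lt: "Suc (body e d) < body e (Suc d)" using * by linarith
    then have "Suc (body e d) \<le> tgt e" using le[of "Suc d"] d by linarith
    then obtain c where c: "c \<le> src e" "body e c = Suc (body e d)" using surj by blast
    show False
    proof (cases "c \<le> d")
      case True then show ?thesis using mono[of c d] c d by simp
    next
      case False then show ?thesis using mono[of "Suc d" c] c lt by simp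
    qed
  qed
qed

lemma fat_arrow_sel [simp]:
  "src (fat_arrow e e' f) = e" "tgt (fat_arrow e e' f) = e'"
  by (simp_all add: fat_arrow_def)

lemma hom_fat_delta:
  "a \<in> hom fat_delta e e' \<longleftrightarrow> src a = e \<and> tgt a = e' \<and> e \<in> Obj fat_delta \<and> e' \<in> Obj fat_delta \<and>
    is_mono Delta (fst (body a)) \<and> fst (body a) \<in> hom Delta (src e) (src e') \<and>
    snd (body a) \<in> hom Delta (tgt e) (tgt e') \<and>
    Comp Delta (snd (body a)) e = Comp Delta e' (fst (body a))"
  by (auto simp: fat_delta_def fat_cat_def split: prod.splits)

text \<open>The least dot in the fibre of \<open>d\<close> is connected to \<open>d\<close> by
  links, and \<open>f\<close> keeps such dots in one fibre, so the choice of representative does not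
  matter.\<close>

lemma fat_arrow_snd:
  assumes f: "dot_map e e' f" and d: "d \<le> src e"
  shows "body (snd (body (fat_arrow e e' f))) (body e d) = body e' (f d)"
proof -
  have e: "e \<in> Obj fat_delta" using f by (simp add: dot_map_def)
  define c where "c = (LEAST c. body e c = body e d)"
  have "body e c = body e d" unfolding c_def by (rule LeastI) simp
  moreover have "c \<le> d" unfolding c_def by (rule Least_le) simp
  ultimately have "body e' (f c) = body e' (f d)"
    using f d by (cases "c = d") (auto simp: dot_map_def)
  then show ?thesis using fat_obj_props(1)[OF e d] by (simp add: fat_arrow_def c_def)
qed

lemma fat_arrow_hom:
  assumes f: "dot_map e e' f"
  shows "fat_arrow e e' f \<in> hom fat_delta e e'"
proof -
  have e: "e \<in> Obj fat_delta" "e' \<in> Obj fat_delta" using f by (simp_all add: dot_map_def)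
  have 1: "fst (body (fat_arrow e e' f)) \<in> hom Delta (src e) (src e')"
    using f by (auto simp: hom_Delta fat_arrow_def dot_map_def mono_on_def le_less)
  have "inj_on f {..src e}"
  proof (rule inj_onI)
    fix c d assume "c \<in> {..src e}" "d \<in> {..src e}" "f c = f d"
    then show "c = d" using f by (cases c d rule: linorder_cases) (force simp: dot_map_def)+
  qed
  then have 2: "is_mono Delta (fst (body (fat_arrow e e' f)))"
    using 1 by (simp add: is_mono_Delta hom_def fat_arrow_def)
  let ?g = "body (snd (body (fat_arrow e e' f)))"
  have "mono_on {..tgt e} ?g"
  proof (rule mono_onI)
    fix i j assume ij: "i \<in> {..tgt e}" "j \<in> {..tgt e}" "i \<le> j"
    obtain c d where cd: "c \<le> src e" "body e c = i" "d \<le> src e" "body e d = j"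
      using fat_obj_props(3)[OF e(1)] ij by (metis atMost_iff)
    show "?g i \<le> ?g j"
    proof (cases "i = j")
      case False
      then have "c < d" using fat_obj_props(2)[OF e(1), of d c] cd ij by (meson le_antisym not_less)
      then have "f c < f d" "f d \<le> src e'" using f cd by (auto simp: dot_map_def)
      then show ?thesis
        using fat_arrow_snd[OF f cd(1)] fat_arrow_snd[OF f cd(3)] cd fat_obj_props(2)[OF e(2), of "f c" "f d"]
        by simp
    qed simp
  qed
  moreover have "?g \<in> {..tgt e} \<rightarrow>\<^sub>E {..tgt e'}"
  proof (rule PiE_I)
    fix i assume "i \<in> {..tgt e}"
    then obtain d where "d \<le> src e" "body e d = i" using fat_obj_props(3)[OF e(1)] by auto
    then show "?g i \<in> {..tgt e'}"
      using fat_arrow_snd[OF f, of d] fat_obj_props(1)[OF e(2), of "f d"] f by (simp add: dot_map_def)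
  qed (simp add: fat_arrow_def)
  ultimately have 3: "snd (body (fat_arrow e e' f)) \<in> hom Delta (tgt e) (tgt e')"
    by (simp add: hom_Delta) (simp add: fat_arrow_def)
  have 4: "Comp Delta (snd (body (fat_arrow e e' f))) e = Comp Delta e' (fst (body (fat_arrow e e' f)))"
    using fat_arrow_snd[OF f] by (auto simp: compose_def fun_eq_iff fat_arrow_def restrict_def)
  show ?thesis using 1 2 3 4 e unfolding hom_fat_delta fat_arrow_sel by blast
qed

text \<open>The commuting square determines the second component on the image of \<open>e\<close>,
  which is everything. The last clause allows \<open>f\<close> to be computed from a given
  arrow.\<close>

lemma fat_arrow_cases:
  assumes a: "a \<in> hom fat_delta e e'"
  obtains f where "dot_map e e' f" "a = fat_arrow e e' f" "\<And>d. d \<le> src e \<Longrightarrow> body (fst (body a)) d = f d"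
proof -
  define f where "f = body (fst (body a))"
  have e: "e \<in> Obj fat_delta" "e' \<in> Obj fat_delta" and a': "src a = e" "tgt a = e'"
    and m: "is_mono Delta (fst (body a))" and 1: "fst (body a) \<in> hom Delta (src e) (src e')"
    and 2: "snd (body a) \<in> hom Delta (tgt e) (tgt e')"
    and c: "Comp Delta (snd (body a)) e = Comp Delta e' (fst (body a))"
    using a by (auto simp: hom_fat_delta)
  have g: "body (snd (body a)) (body e d) = body e' (f d)" if "d \<le> src e" for d
  proof -
    have "compose {..src e} (body (snd (body a))) (body e) d = compose {..src e} (body e') f d"
    proof -
      have "src (fst (body a)) = src e" using 1 by (simp add: hom_Delta)
      then show ?thesis using c by (simp add: f_def)
    qed
    then show ?thesis using that by (simp add: compose_def)
  qed
  have f: "dot_map e e' f"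
    unfolding dot_map_def
  proof (intro conjI e allI impI)
    show "f d \<le> src e'" if "d \<le> src e" for d using that 1 by (auto simp: f_def hom_Delta)
    fix d d' assume d: "d < d' \<and> d' \<le> src e"
    then have "f d \<le> f d'" using 1 by (auto simp: f_def hom_Delta mono_on_def)
    moreover have "f d \<noteq> f d'" using m d 1 by (auto simp: is_mono_Delta inj_on_def f_def hom_Delta)
    ultimately show "f d < f d'" by simp
    show "body e' (f d) = body e' (f d')" if "body e d = body e d'" using g[of d] g[of d'] d that by simp
  qed
  have "fst (body a) = fst (body (fat_arrow e e' f))"
    using 1 by (auto simp: hom_Delta fat_arrow_def f_def PiE_def extensional_restrict intro: arrow.expand)
  moreover have "snd (body a) = snd (body (fat_arrow e e' f))"
  proof -
    have "body (snd (body a)) = body (snd (body (fat_arrow e e' f)))"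
    proof (rule extensionalityI[of _ "{..tgt e}"])
      fix i assume "i \<in> {..tgt e}"
      then obtain d where "d \<le> src e" "body e d = i" using fat_obj_props(3)[OF e(1)] by auto
      then show "body (snd (body a)) i = body (snd (body (fat_arrow e e' f))) i"
        using fat_arrow_snd[OF f, of d] g[of d] by simp
    qed (use 2 in \<open>auto simp: hom_Delta fat_arrow_def PiE_def\<close>)
    then show ?thesis using 2 by (intro arrow.expand) (simp add: hom_Delta fat_arrow_def)
  qed
  ultimately have "a = fat_arrow e e' f" using a' by (intro arrow.expand) (simp add: prod_eq_iff)
  then show thesis by (rule that[OF f]) (simp add: f_def)
qed

lemma fat_arrow_cong:
  assumes f: "dot_map e e' f" and eq: "\<And>d. d \<le> src e \<Longrightarrow> f d = f' d"
  shows "fat_arrow e e' f = fat_arrow e e' f'"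
proof -
  have e: "e \<in> Obj fat_delta" using f by (simp add: dot_map_def)
  \<comment> \<open>The second component evaluates \<open>f\<close> at a least dot, which has to lie
    in the range where \<open>f\<close> and \<open>f'\<close> are known to agree.\<close>
  have "(LEAST d. body e d = i) \<le> src e" if i: "i \<le> tgt e" for i
  proof -
    obtain d where "d \<le> src e" "body e d = i" using fat_obj_props(3)[OF e i] by blast
    then show ?thesis using Least_le[of "\<lambda>d. body e d = i" d] by simp
  qed
  then show ?thesis using eq by (auto simp: fat_arrow_def fun_eq_iff)
qed

lemma fat_arrow_eqD:
  assumes "fat_arrow e e' f = fat_arrow e e' f'" "d \<le> src e"
  shows "f d = f' d"
proof -
  have "body (fst (body (fat_arrow e e' f))) d = body (fst (body (fat_arrow e e' f'))) d"
    using assms(1) by simp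
  then show ?thesis using assms(2) by (simp add: fat_arrow_def)
qed

lemma dot_mapD:
  assumes "dot_map e e' f"
  shows "e \<in> Obj fat_delta" "e' \<in> Obj fat_delta" "\<And>d. d \<le> src e \<Longrightarrow> f d \<le> src e'"
    "\<And>d d'. \<lbrakk>d < d'; d' \<le> src e\<rbrakk> \<Longrightarrow> f d < f d'"
    "\<And>d d'. \<lbrakk>d \<le> d'; d' \<le> src e; body e d = body e d'\<rbrakk> \<Longrightarrow> body e' (f d) = body e' (f d')"
  using assms unfolding dot_map_def le_less by blast+

lemma dot_map_comp:
  assumes f: "dot_map e e' f" and g: "dot_map e' e'' g"
  shows "dot_map e e'' (g \<circ> f)"
  unfolding dot_map_def o_apply
proof (intro conjI allI impI)
  fix d d' assume d: "d < d' \<and> d' \<le> src e"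
  then show "g (f d) < g (f d')"
    by (intro dot_mapD(4)[OF g] dot_mapD(4)[OF f] dot_mapD(3)[OF f]) auto
  have "f d \<le> f d'" using dot_mapD(4)[OF f, of d d'] d by simp
  then show "body e'' (g (f d)) = body e'' (g (f d'))" if "body e d = body e d'"
    using d that by (intro dot_mapD(5)[OF g] dot_mapD(5)[OF f] dot_mapD(3)[OF f]) auto
qed (use dot_mapD[OF f] dot_mapD[OF g] in auto)

text \<open>A composite is again given by a map on dots, so only the first components have to be
  compared.\<close>

lemma Comp_fat_arrow:
  assumes f: "dot_map e e' f" and g: "dot_map e' e'' g"
  shows "Comp fat_delta (fat_arrow e' e'' g) (fat_arrow e e' f) = fat_arrow e e'' (g \<circ> f)"
proof -
  interpret category fat_delta by (rule category_fat_delta)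
  have "Comp fat_delta (fat_arrow e' e'' g) (fat_arrow e e' f) \<in> hom fat_delta e e''"
    by (rule Comp_hom[OF fat_arrow_hom[OF f] fat_arrow_hom[OF g]])
  then obtain h where h: "dot_map e e'' h"
    and eq: "Comp fat_delta (fat_arrow e' e'' g) (fat_arrow e e' f) = fat_arrow e e'' h"
    and b: "\<And>d. d \<le> src e \<Longrightarrow> body (fst (body (Comp fat_delta (fat_arrow e' e'' g) (fat_arrow e e' f)))) d = h d"
    using fat_arrow_cases by blast
  have "h d = g (f d)" if "d \<le> src e" for d
    using b[OF that] that f by (simp add: fat_delta_def fat_cat_def fat_arrow_def compose_def dot_map_def)
  then show ?thesis unfolding eq using h by (intro fat_arrow_cong) auto
qed

lemma dot_map_id: "e \<in> Obj fat_delta \<Longrightarrow> dot_map e e (\<lambda>d. d)"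
  by (auto simp: dot_map_def)

lemma Ident_fat_delta:
  assumes "e \<in> Obj fat_delta"
  shows "Ident fat_delta e = fat_arrow e e (\<lambda>d. d)"
proof -
  interpret category fat_delta by (rule category_fat_delta)
  obtain f where f: "dot_map e e f" "Ident fat_delta e = fat_arrow e e f"
    "\<And>d. d \<le> src e \<Longrightarrow> body (fst (body (Ident fat_delta e))) d = f d"
    using Id_hom[OF assms] fat_arrow_cases by blast
  have "f d = d" if "d \<le> src e" for d
    using f(3)[OF that] that by (simp add: fat_delta_def fat_cat_def)
  then show ?thesis using f fat_arrow_cong by simp
qed

lemma Arr_fat_cat: "Arr fat_cat = Arr fat_delta"
  by (simp add: fat_delta_def)

lemma vertical_iff: "a \<in> vertical \<longleftrightarrow> a \<in> Arr fat_delta \<and> (\<exists>k. snd (body a) = Ident Delta k)"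
  by (auto simp: vertical_def Arr_fat_cat fat_proj_def simp del: Ident_Delta)

lemma fat_arrow_vertical:
  assumes f: "dot_map e e' f" and t: "tgt e = tgt e'"
    and b: "\<And>d. d \<le> src e \<Longrightarrow> body e' (f d) = body e d"
  shows "fat_arrow e e' f \<in> vertical"
proof -
  have e: "e \<in> Obj fat_delta" using f by (simp add: dot_map_def)
  note h = fat_arrow_hom[OF f]
  have "body (snd (body (fat_arrow e e' f))) = body (Ident Delta (tgt e))"
  proof (rule extensionalityI[of _ "{..tgt e}"])
    fix i assume i: "i \<in> {..tgt e}"
    then obtain d where "d \<le> src e" "body e d = i" using fat_obj_props(3)[OF e] by auto
    then show "body (snd (body (fat_arrow e e' f))) i = body (Ident Delta (tgt e)) i"
      using fat_arrow_snd[OF f, of d] b i by auto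
  qed (auto simp: fat_arrow_def)
  then have "snd (body (fat_arrow e e' f)) = Ident Delta (tgt e)"
    using t by (intro arrow.expand) (auto simp: fat_arrow_def)
  then show ?thesis using h by (auto simp: vertical_iff hom_def simp del: Ident_Delta)
qed

lemma snd_body_Comp: "snd (body (Comp fat_delta g f)) = Comp Delta (snd (body g)) (snd (body f))"
  by (simp add: fat_delta_def fat_cat_def split: prod.splits)

lemma snd_body_Ident: "snd (body (Ident fat_delta e)) = Ident Delta (tgt e)"
  by (simp add: fat_delta_def fat_cat_def)

lemma coloured_category_fat_delta: "coloured_category fat_delta"
proof -
  interpret category fat_delta by (rule category_fat_delta)
  interpret D: category Delta by (rule category_Delta)
  show ?thesis
  proof unfold_locales
    show "Col fat_delta \<subseteq> Arr fat_delta" by (auto simp: vertical_iff)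
    show "Ident fat_delta x \<in> Col fat_delta" if "x \<in> Obj fat_delta" for x
      using Id_hom[OF that] snd_body_Ident[of x] by (auto simp: vertical_iff homD simp del: Ident_Delta)
    show "Disc fat_delta \<subseteq> Obj fat_delta"
      by (auto simp: one_dot_def is_epi_Delta Arr_Delta mono_on_def)
    fix f g assume f: "f \<in> Col fat_delta" and g: "g \<in> Col fat_delta" and fg: "Dom fat_delta g = Cod fat_delta f"
    then have h: "f \<in> hom fat_delta (src f) (tgt f)" "g \<in> hom fat_delta (tgt f) (tgt g)"
      by (auto simp: vertical_iff hom_def)
    have gf: "Comp fat_delta g f \<in> Arr fat_delta" by (rule homD(1)[OF Comp_hom[OF h]])
    obtain k l where kl: "snd (body f) = Ident Delta k" "snd (body g) = Ident Delta l"
      using f g by (auto simp: vertical_iff simp del: Ident_Delta)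
    moreover have "snd (body f) \<in> hom Delta (tgt (src f)) (tgt (tgt f))"
      "snd (body g) \<in> hom Delta (tgt (tgt f)) (tgt (tgt g))"
      using h unfolding hom_fat_delta by blast+
    ultimately have "tgt (tgt f) = k" "tgt (tgt f) = l" by (simp_all add: hom_Delta)
    then have "snd (body (Comp fat_delta g f)) = Ident Delta k"
      unfolding snd_body_Comp kl using D.Comp_Id'[OF D.Id_hom, of k] by (simp del: Ident_Delta Comp_Delta)
    then show "Comp fat_delta g f \<in> Col fat_delta" using gf by (auto simp: vertical_iff simp del: Ident_Delta)
  qed
qed

lemma dot_inclusion_eq:
  assumes e: "e \<in> Obj fat_delta" and i: "i \<le> src e"
  shows "dot_inclusion e i = fat_arrow one_dot e (\<lambda>_. i)"
  by (auto simp: dot_inclusion_def fat_arrow_def one_dot_def fun_eq_iff)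

section \<open>Objects as patterns of links, and cutting at a dot\<close>

definition links :: "nat \<Rightarrow> (nat \<Rightarrow> nat) \<Rightarrow> fat_obj" where
  "links m b = Arrow m (restrict b {..m}) (b m)"

lemma links_sel [simp]: "src (links m b) = m" "tgt (links m b) = b m"
  "d \<le> m \<Longrightarrow> body (links m b) d = b d"
  by (simp_all add: links_def)

text \<open>With steps of at most one starting from 0, no value up to \<open>b m\<close> can be
  skipped, so \<open>b\<close> is onto.\<close>

lemma links_Obj:
  assumes "b 0 = 0" "\<And>d. d < m \<Longrightarrow> b (Suc d) = b d \<or> b (Suc d) = Suc (b d)"
  shows "links m b \<in> Obj fat_delta"
proof -
  have mono: "b d \<le> b d'" if "d \<le> d'" "d' \<le> m" for d d'
    using that
  proof (induction d' rule: dec_induct)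
    case (step n) then show ?case using assms(2)[of n] by linarith
  qed simp
  have "\<exists>d \<le> n. b d = i" if "i \<le> b n" "n \<le> m" for n i
    using that
  proof (induction n)
    case 0 then show ?case using assms(1) by simp
  next
    case (Suc n)
    show ?case
    proof (cases "i \<le> b n")
      case True
      then show ?thesis using Suc by (auto intro: le_SucI)
    next
      case False
      then show ?thesis using assms(2)[of n] Suc.prems by (intro exI[of _ "Suc n"]) auto
    qed
  qed
  then have "{..b m} \<subseteq> b ` {..m}" by fastforce
  moreover have "b ` {..m} \<subseteq> {..b m}" using mono by auto
  ultimately show ?thesis
    using mono by (auto simp: is_epi_Delta Arr_Delta links_def mono_on_def)
qed

lemma links_body:
  assumes "e \<in> Obj fat_delta" shows "links (src e) (body e) = e"
  using fat_obj_props(4,6)[OF assms] by (intro arrow.expand) (auto simp: links_def extensional_restrict)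

lemma links_cong: "(\<And>d. d \<le> m \<Longrightarrow> b d = c d) \<Longrightarrow> links m b = links m c"
  by (auto simp: links_def fun_eq_iff)

lemma one_dot_links: "one_dot = links 0 (\<lambda>d. d)"
  by (simp add: one_dot_def links_def)

definition initial_part :: "fat_obj \<Rightarrow> nat \<Rightarrow> fat_obj" where
  "initial_part e p = links p (body e)"

text \<open>Subtracting \<open>body e p\<close> makes the first remaining dot lie over 0, as
  \<open>links_Obj\<close> requires.\<close>

definition final_part :: "fat_obj \<Rightarrow> nat \<Rightarrow> fat_obj" where
  "final_part e p = links (src e - p) (\<lambda>d. body e (p + d) - body e p)"

lemma parts:
  assumes e: "e \<in> Obj fat_delta" and p: "p \<le> src e"
  shows "initial_part e p \<in> Obj fat_delta" "final_part e p \<in> Obj fat_delta"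
    "dot_map (initial_part e p) e (\<lambda>d. d)" "dot_map (final_part e p) e (\<lambda>d. p + d)"
    "src (initial_part e p) = p" "src (final_part e p) = src e - p"
proof -
  note pr = fat_obj_props[OF e]
  show 1: "initial_part e p \<in> Obj fat_delta"
    unfolding initial_part_def using pr(5,7) p by (intro links_Obj) auto
  have mono: "body e p \<le> body e (p + d)" if "d \<le> src e - p" for d
    using that p by (intro pr(2)) auto
  show 2: "final_part e p \<in> Obj fat_delta"
    unfolding final_part_def
  proof (rule links_Obj)
    fix d assume "d < src e - p"
    then show "body e (p + Suc d) - body e p = body e (p + d) - body e p \<or>
        body e (p + Suc d) - body e p = Suc (body e (p + d) - body e p)"
      using pr(7)[of "p + d"] mono[of d] by (auto simp: less_diff_conv add.commute)
  qed simp
  show "dot_map (initial_part e p) e (\<lambda>d. d)"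
    using 1 e p by (auto simp: dot_map_def initial_part_def)
  have "body e (p + d) = body e (p + d')"
    if "body e (p + d) - body e p = body e (p + d') - body e p" "d < d'" "d' \<le> src e - p" for d d'
    using that mono[of d] mono[of d'] by simp
  then show "dot_map (final_part e p) e (\<lambda>d. p + d)"
    using 2 e p unfolding dot_map_def by (auto simp: final_part_def)
qed (simp_all add: initial_part_def final_part_def)

lemma one_dot_Obj: "one_dot \<in> Obj fat_delta"
  unfolding one_dot_links by (rule links_Obj) auto

lemma src_one_dot [simp]: "src one_dot = 0" "tgt one_dot = 0"
  by (simp_all add: one_dot_def)

lemma dot_map_one_dot: "e \<in> Obj fat_delta \<Longrightarrow> i \<le> src e \<Longrightarrow> dot_map one_dot e (\<lambda>_. i)"
  using one_dot_Obj by (simp add: dot_map_def)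

text \<open>Both parts contain the cut dot \<open>p\<close>, so two maps that agree there glue to
  one map on dots. Order and links across the cut are checked by passing through
  \<open>p\<close>.\<close>

lemma pushout_parts:
  assumes e: "e \<in> Obj fat_delta" and p: "p \<le> src e"
  shows "pushout fat_delta (last_dot (initial_part e p)) (first_dot (final_part e p))
    (fat_arrow (initial_part e p) e (\<lambda>d. d)) (fat_arrow (final_part e p) e (\<lambda>d. p + d))"
proof -
  define m n where "m = initial_part e p" and "n = final_part e p"
  note pp = parts[OF e p, folded m_def n_def]
  note pr = fat_obj_props[OF e]
  have l: "last_dot m = fat_arrow one_dot m (\<lambda>_. p)" and f: "first_dot n = fat_arrow one_dot n (\<lambda>_. 0)"
    using pp dot_inclusion_eq[of m p] dot_inclusion_eq[of n 0] by (simp_all add: last_dot_def first_dot_def)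
  have dm: "dot_map one_dot m (\<lambda>_. p)" "dot_map one_dot n (\<lambda>_. 0)"
    using pp by (auto intro!: dot_map_one_dot)
  have ex: "\<exists>!w. w \<in> hom fat_delta e z \<and> Comp fat_delta w (fat_arrow m e (\<lambda>d. d)) = u \<and>
      Comp fat_delta w (fat_arrow n e (\<lambda>d. p + d)) = v"
    if u: "u \<in> hom fat_delta m z" and v: "v \<in> hom fat_delta n z"
      and c: "Comp fat_delta u (last_dot m) = Comp fat_delta v (first_dot n)" for z u v
  proof -
    obtain u' where u': "dot_map m z u'" "u = fat_arrow m z u'" using fat_arrow_cases[OF u] by metis
    obtain v' where v': "dot_map n z v'" "v = fat_arrow n z v'" using fat_arrow_cases[OF v] by metis
    have "fat_arrow one_dot z (u' \<circ> (\<lambda>_. p)) = fat_arrow one_dot z (v' \<circ> (\<lambda>_. 0))"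
      using c unfolding l f u'(2) v'(2) Comp_fat_arrow[OF dm(1) u'(1)] Comp_fat_arrow[OF dm(2) v'(1)] .
    then have uv: "u' p = v' 0" by (auto dest: fat_arrow_eqD[where d = 0])
    \<comment> \<open>Dots of the final part are renumbered from \<open>p\<close>; at
      \<open>d = p\<close> both formulas give the same value by \<open>uv\<close>.\<close>
    define w where "w d = (if d \<le> p then u' d else v' (d - p))" for d
    have ulink: "body z (u' d) = body z (u' d')" if "d \<le> d'" "d' \<le> p" "body e d = body e d'" for d d'
      using that pp(5) by (intro dot_mapD(5)[OF u'(1)]) (auto simp: m_def initial_part_def)
    have vlink: "body z (v' (d - p)) = body z (v' (d' - p))"
      if "d \<le> d'" "p \<le> d" "d' \<le> src e" "body e d = body e d'" for d d'
      using that pp(6) by (intro dot_mapD(5)[OF v'(1)]) (auto simp: n_def final_part_def)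
    have vle: "v' 0 \<le> v' (d - p)" if "p \<le> d" "d \<le> src e" for d
      using dot_mapD(4)[OF v'(1), of 0 "d - p"] diff_le_mono[of d "src e" p] pp(6) that by (cases "d = p") auto
    have w: "dot_map e z w"
      unfolding dot_map_def
    proof (intro conjI allI impI)
      show "e \<in> Obj fat_delta" "z \<in> Obj fat_delta" using e u'(1) by (auto simp: dot_map_def)
      show "w d \<le> src z" if "d \<le> src e" for d
        using that u'(1) v'(1) pp(5,6) by (auto simp: w_def dot_map_def)
      fix d d' assume d: "d < d' \<and> d' \<le> src e"
      show "w d < w d'"
      proof (cases "d' \<le> p \<or> p < d")
        case True
        then show ?thesis
          using d dot_mapD(4)[OF u'(1), of d d'] dot_mapD(4)[OF v'(1), of "d - p" "d' - p"] pp(5,6)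
          by (auto simp: w_def diff_less_mono diff_le_mono)
      next
        case False
        have "u' d \<le> u' p" using False dot_mapD(4)[OF u'(1), of d p] pp(5) by (cases "d = p") auto
        moreover have "v' 0 < v' (d' - p)"
          using False d dot_mapD(4)[OF v'(1), of 0 "d' - p"] pp(6) by (auto simp: diff_le_mono)
        ultimately show ?thesis using False d uv by (auto simp: w_def)
      qed
      assume eq: "body e d = body e d'"
      show "body z (w d) = body z (w d')"
      proof (cases "d' \<le> p \<or> p < d")
        case True
        then show ?thesis using d eq ulink[of d d'] vlink[of d d'] by (auto simp: w_def)
      next
        case False
        \<comment> \<open>By monotonicity, dots in one fibre on either side of the cut lie in the
          fibre of \<open>p\<close> as well, so the two halves combine at \<open>p\<close>.\<close>
        then have "body e d \<le> body e p" "body e p \<le> body e d'" using d p by (auto intro: pr(2))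
        then show ?thesis using False d eq ulink[of d p] vlink[of p d'] uv by (auto simp: w_def)
      qed
    qed
    show ?thesis
    proof (rule ex1I[of _ "fat_arrow e z w"])
      show "fat_arrow e z w \<in> hom fat_delta e z \<and>
          Comp fat_delta (fat_arrow e z w) (fat_arrow m e (\<lambda>d. d)) = u \<and>
          Comp fat_delta (fat_arrow e z w) (fat_arrow n e (\<lambda>d. p + d)) = v"
        unfolding Comp_fat_arrow[OF pp(3) w] Comp_fat_arrow[OF pp(4) w] u'(2) v'(2)
        using dot_map_comp[OF pp(3) w] dot_map_comp[OF pp(4) w] uv pp(5,6)
        by (auto intro!: fat_arrow_hom w fat_arrow_cong simp: w_def)
      fix t assume t: "t \<in> hom fat_delta e z \<and> Comp fat_delta t (fat_arrow m e (\<lambda>d. d)) = u \<and>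
          Comp fat_delta t (fat_arrow n e (\<lambda>d. p + d)) = v"
      then obtain t' where t': "dot_map e z t'" "t = fat_arrow e z t'" using fat_arrow_cases by metis
      have "fat_arrow m z (t' \<circ> (\<lambda>d. d)) = fat_arrow m z u'" "fat_arrow n z (t' \<circ> (\<lambda>d. p + d)) = fat_arrow n z v'"
        using t Comp_fat_arrow[OF pp(3) t'(1)] Comp_fat_arrow[OF pp(4) t'(1)] u'(2) v'(2) t'(2) by auto
      note tu = this[THEN fat_arrow_eqD]
      have "t' d = w d" if "d \<le> src e" for d
        using that pp(5,6) tu(1)[of d] tu(2)[of "d - p"] by (auto simp: w_def diff_le_mono)
      then show "t = fat_arrow e z w" using t' fat_arrow_cong by simp
    qed
  qed
  have "Comp fat_delta (fat_arrow m e (\<lambda>d. d)) (last_dot m) = Comp fat_delta (fat_arrow n e (\<lambda>d. p + d)) (first_dot n)"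
    unfolding l f Comp_fat_arrow[OF dm(1) pp(3)] Comp_fat_arrow[OF dm(2) pp(4)] by (simp add: comp_def)
  then show ?thesis
    unfolding pushout_def m_def[symmetric] n_def[symmetric]
    using fat_arrow_hom[OF pp(3)] fat_arrow_hom[OF pp(4)] fat_arrow_hom[OF dm(1)] fat_arrow_hom[OF dm(2)] ex
    by (auto simp: l f homD)
qed

declare fat_delta_simps(1) [simp del]

section \<open>Sets\<close>

lemma SET_simps [simp]:
  "Obj (SET small) = {A. small A}" "Dom (SET small) = src" "Cod (SET small) = tgt"
  "Ident (SET small) A = Arrow A (\<lambda>x \<in> A. x) A"
  "Comp (SET small) g f = Arrow (src f) (compose (src f) (body g) (body f)) (tgt g)"
  "Disc (SET small) = {A. small A}"
  by (simp_all add: SET_def Let_def)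

lemma hom_SET: "f \<in> hom (SET small) A B \<longleftrightarrow> src f = A \<and> tgt f = B \<and> small A \<and> small B \<and> body f \<in> A \<rightarrow>\<^sub>E B"
  by (auto simp: SET_def Let_def)

lemma Arr_SET: "f \<in> Arr (SET small) \<longleftrightarrow> small (src f) \<and> small (tgt f) \<and> body f \<in> src f \<rightarrow>\<^sub>E tgt f"
  by (auto simp: SET_def Let_def)

lemma Col_SET: "f \<in> Col (SET small) \<longleftrightarrow> f \<in> Arr (SET small) \<and> bij_betw (body f) (src f) (tgt f)"
  by (auto simp: SET_def Let_def)

lemma category_SET: "category (SET small)"
  unfolding SET_def Let_def
proof (rule category_add_colours, rule category_cat_of_homs)
  fix w x y z :: "'a set" and f g h
  assume "f \<in> w \<rightarrow>\<^sub>E x" "g \<in> x \<rightarrow>\<^sub>E y" "h \<in> y \<rightarrow>\<^sub>E z"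
  then show "compose w h (compose w g f) = compose w (compose x h g) f"
    by (auto intro: compose_assoc)
qed (auto simp: compose_def fun_eq_iff PiE_iff extensional_def)

lemma coloured_category_SET: "coloured_category (SET small)"
proof -
  interpret category "SET small" by (rule category_SET)
  show ?thesis
  proof unfold_locales
    show "Ident (SET small) A \<in> Col (SET small)" if "A \<in> Obj (SET small)" for A
      using that by (auto simp: Col_SET Arr_SET bij_betw_def inj_on_def)
    fix f g assume f: "f \<in> Col (SET small)" and g: "g \<in> Col (SET small)"
      and fg: "Dom (SET small) g = Cod (SET small) f"
    then have "f \<in> hom (SET small) (src f) (tgt f)" "g \<in> hom (SET small) (tgt f) (tgt g)"
      by (auto simp: Col_SET Arr_SET hom_SET)
    then have "Comp (SET small) g f \<in> Arr (SET small)" by (rule homD(1)[OF Comp_hom])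
    moreover have "bij_betw (compose (src f) (body g) (body f)) (src f) (tgt g)"
      using f g fg by (intro bij_betw_compose) (auto simp: Col_SET)
    ultimately show "Comp (SET small) g f \<in> Col (SET small)" by (simp add: Col_SET)
  qed (auto simp: Col_SET)
qed

section \<open>The category of a fair presheaf\<close>

text \<open>The identity epimorphism of the ordinal \<open>n\<close>: a row of \<open>n + 1\<close>
  unlinked dots.\<close>

definition free :: "nat \<Rightarrow> fat_obj" where
  "free n = links n (\<lambda>d. d)"

lemma free_sel [simp]: "src (free n) = n" "tgt (free n) = n" "d \<le> n \<Longrightarrow> body (free n) d = d"
  by (simp_all add: free_def)

lemma free_Obj [simp]: "free n \<in> Obj fat_delta"
  unfolding free_def by (rule links_Obj) auto

lemma one_dot_free: "one_dot = free 0"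
  by (simp add: one_dot_links free_def)

section \<open>Lists of dots as maps from unlinked dots\<close>

definition dots :: "fat_obj \<Rightarrow> nat list \<Rightarrow> bool" where
  "dots e ds \<longleftrightarrow> e \<in> Obj fat_delta \<and> ds \<noteq> [] \<and> sorted_wrt (<) ds \<and> set ds \<subseteq> {..src e}"

lemma dots_simps:
  assumes "e \<in> Obj fat_delta"
  shows "dots e [d] \<longleftrightarrow> d \<le> src e"
    "dots e [d, d'] \<longleftrightarrow> d < d' \<and> d' \<le> src e"
    "dots e [d, d', d''] \<longleftrightarrow> d < d' \<and> d' < d'' \<and> d'' \<le> src e"
  using assms by (auto simp: dots_def)

declare dots_simps [OF free_Obj, simp]

text \<open>An unlinked source imposes no condition on links, so strict increase is enough. The
  index is shifted by one because \<open>free n\<close> has \<open>n + 1\<close> dots.\<close>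

lemma dot_map_dots: "dots e ds \<Longrightarrow> dot_map (free (length ds - 1)) e ((!) ds)"
  unfolding dot_map_def
proof (intro conjI allI impI)
  assume ds: "dots e ds"
  then have l: "d < length ds" if "d \<le> src (free (length ds - 1))" for d
    using that by (cases ds) (auto simp: dots_def)
  show "free (length ds - 1) \<in> Obj fat_delta" "e \<in> Obj fat_delta"
    using ds by (auto simp: dots_def)
  show "ds ! d \<le> src e" if "d \<le> src (free (length ds - 1))" for d
    using ds nth_mem[OF l[OF that]] by (auto simp: dots_def)
  fix d d' assume d: "d < d' \<and> d' \<le> src (free (length ds - 1))"
  then show "ds ! d < ds ! d'"
    using ds l[of d'] sorted_wrt_nth_less[of "(<)" ds d d'] by (simp add: dots_def)
  show "body e (ds ! d) = body e (ds ! d')"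
    if "body (free (length ds - 1)) d = body (free (length ds - 1)) d'"
    using that d by simp
qed

abbreviation linked2 :: fat_obj where "linked2 \<equiv> links 1 (\<lambda>_. 0)"
abbreviation linked3 :: fat_obj where "linked3 \<equiv> links 2 (\<lambda>_. 0)"

lemma linked_Obj: "links n (\<lambda>_. 0) \<in> Obj fat_delta"
  by (rule links_Obj) auto

lemma dot_map_links:
  assumes "links n b \<in> Obj fat_delta" and "dots e ds" and "length ds = Suc n"
    and "\<And>d d'. \<lbrakk>d < d'; d' \<le> n; b d = b d'\<rbrakk> \<Longrightarrow> body e (ds ! d) = body e (ds ! d')"
  shows "dot_map (links n b) e ((!) ds)"
  using dot_mapD[OF dot_map_dots[OF assms(2)]] assms by (auto simp: dot_map_def)

lemma initial_part_free: "p \<le> n \<Longrightarrow> initial_part (free n) p = free p"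
  by (auto simp: initial_part_def free_def intro: links_cong)

lemma final_part_free: "p \<le> n \<Longrightarrow> final_part (free n) p = free (n - p)"
  unfolding final_part_def by (simp, subst free_def, rule links_cong) auto

section \<open>Actions, faces and gluing in a fair presheaf\<close>

context fair_Set_category
begin

definition act :: "fat_obj \<Rightarrow> fat_obj \<Rightarrow> (nat \<Rightarrow> nat) \<Rightarrow> 'u \<Rightarrow> 'u" where
  "act e e' f = body (FArr X (fat_arrow e e' f))"

text \<open>In simplicial terms, the face of an element spanned by the listed dots.\<close>

definition restr :: "fat_obj \<Rightarrow> nat list \<Rightarrow> 'u \<Rightarrow> 'u" where
  "restr e ds = act (free (length ds - 1)) e ((!) ds)"

lemma FArr_fat_arrow:
  assumes "dot_map e e' f"
  shows "FArr X (fat_arrow e e' f) \<in> hom (SET small) (FObj X e') (FObj X e)"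
  using FArr_hom[of "fat_arrow e e' f" e' e] fat_arrow_hom[OF assms] by simp

lemma act_PiE:
  assumes "dot_map e e' f"
  shows "act e e' f \<in> FObj X e' \<rightarrow>\<^sub>E FObj X e"
  using FArr_fat_arrow[OF assms] by (simp add: hom_SET act_def)

lemma act_in: "\<lbrakk>dot_map e e' f; x \<in> FObj X e'\<rbrakk> \<Longrightarrow> act e e' f x \<in> FObj X e"
  using act_PiE by fast

lemma act_cong:
  assumes "dot_map e e' f" "\<And>d. d \<le> src e \<Longrightarrow> f d = f' d"
  shows "act e e' f = act e e' f'"
  using fat_arrow_cong[of e e' f f'] assms by (simp add: act_def)

lemma act_act:
  assumes f: "dot_map e e' f" and g: "dot_map e' e'' g" and x: "x \<in> FObj X e''"
  shows "act e e' f (act e' e'' g x) = act e e'' (g \<circ> f) x"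
proof -
  have "FArr X (Comp (opposite fat_delta) (fat_arrow e e' f) (fat_arrow e' e'' g))
      = Comp (SET small) (FArr X (fat_arrow e e' f)) (FArr X (fat_arrow e' e'' g))"
    using fat_arrow_hom[OF f] fat_arrow_hom[OF g] by (intro FArr_Comp) simp_all
  then show ?thesis
    using x FArr_fat_arrow[OF g] by (simp add: Comp_fat_arrow[OF f g] act_def compose_def hom_SET)
qed

lemma act_id:
  assumes "e \<in> Obj fat_delta" "x \<in> FObj X e" "\<And>d. d \<le> src e \<Longrightarrow> f d = d"
  shows "act e e f x = x"
proof -
  have "FArr X (Ident (opposite fat_delta) e) = Ident (SET small) (FObj X e)"
    using assms by (intro FArr_Id) simp
  then have "act e e (\<lambda>d. d) x = x"
    using assms by (simp add: Ident_fat_delta act_def)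
  then show ?thesis using act_cong[OF dot_map_id[OF assms(1)], of f] assms(3) by simp
qed

lemma act_bij:
  assumes "dot_map e e' f" "tgt e = tgt e'" "\<And>d. d \<le> src e \<Longrightarrow> body e' (f d) = body e d"
  shows "bij_betw (act e e' f) (FObj X e') (FObj X e)"
  using preserves_colours[of "fat_arrow e e' f"] fat_arrow_vertical[OF assms] FArr_fat_arrow[OF assms(1)]
  by (simp add: Col_SET act_def hom_SET)

text \<open>This is the fibre product axiom at the pushout obtained by cutting \<open>e\<close> at
  \<open>p\<close>, split into surjectivity and injectivity of the canonical map and rewritten in
  terms of faces.\<close>

lemma glue:
  assumes e: "e \<in> Obj fat_delta" and p: "p \<le> src e"
    and s: "s \<in> FObj X (initial_part e p)" and t: "t \<in> FObj X (final_part e p)"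
    and st: "restr (initial_part e p) [p] s = restr (final_part e p) [0] t"
  shows "\<exists>x \<in> FObj X e. act (initial_part e p) e (\<lambda>d. d) x = s \<and> act (final_part e p) e (\<lambda>d. p + d) x = t"
    and "\<lbrakk>x \<in> FObj X e; y \<in> FObj X e;
      act (initial_part e p) e (\<lambda>d. d) x = s; act (final_part e p) e (\<lambda>d. p + d) x = t;
      act (initial_part e p) e (\<lambda>d. d) y = s; act (final_part e p) e (\<lambda>d. p + d) y = t\<rbrakk> \<Longrightarrow> x = y"
proof -
  note pp = parts[OF e p]
  have l: "body (FArr X (last_dot (initial_part e p))) = restr (initial_part e p) [p]"
    using pp dot_inclusion_eq[of "initial_part e p" p] dot_map_one_dot[of "initial_part e p" p]
    by (auto simp: last_dot_def restr_def act_def one_dot_free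
        intro!: arg_cong[where f = "\<lambda>a. body (FArr X a)"] fat_arrow_cong)
  have f: "body (FArr X (first_dot (final_part e p))) = restr (final_part e p) [0]"
    using pp dot_inclusion_eq[of "final_part e p" 0] dot_map_one_dot[of "final_part e p" 0]
    by (auto simp: first_dot_def restr_def act_def one_dot_free
        intro!: arg_cong[where f = "\<lambda>a. body (FArr X a)"] fat_arrow_cong)
  have "bij_betw (\<lambda>x. (act (initial_part e p) e (\<lambda>d. d) x, act (final_part e p) e (\<lambda>d. p + d) x)) (FObj X e)
      {(s, t). s \<in> FObj X (initial_part e p) \<and> t \<in> FObj X (final_part e p) \<and>
        restr (initial_part e p) [p] s = restr (final_part e p) [0] t}"
    using preserves_fibre_products[OF pp(1,2) pushout_parts[OF e p]] unfolding l f
    by (simp add: act_def)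
  note b = this[unfolded bij_betw_def]
  have "(s, t) \<in> (\<lambda>x. (act (initial_part e p) e (\<lambda>d. d) x, act (final_part e p) e (\<lambda>d. p + d) x)) ` FObj X e"
    using b s t st by simp
  then show "\<exists>x \<in> FObj X e. act (initial_part e p) e (\<lambda>d. d) x = s \<and> act (final_part e p) e (\<lambda>d. p + d) x = t"
    by auto
  show "x = y" if "x \<in> FObj X e" "y \<in> FObj X e"
      "act (initial_part e p) e (\<lambda>d. d) x = s" "act (final_part e p) e (\<lambda>d. p + d) x = t"
      "act (initial_part e p) e (\<lambda>d. d) y = s" "act (final_part e p) e (\<lambda>d. p + d) y = t"
    using b that by (auto dest: inj_onD)
qed

lemma restr_in: "\<lbrakk>dots e ds; x \<in> FObj X e\<rbrakk> \<Longrightarrow> restr e ds x \<in> FObj X (free (length ds - 1))"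
  unfolding restr_def by (intro act_in dot_map_dots)

lemma restr_act:
  assumes f: "dot_map e e' f" and ds: "dots e ds" and x: "x \<in> FObj X e'"
  shows "restr e ds (act e e' f x) = restr e' (map f ds) x"
proof -
  have "restr e ds (act e e' f x) = act (free (length ds - 1)) e' (f \<circ> (!) ds) x"
    unfolding restr_def by (rule act_act[OF dot_map_dots[OF ds] f x])
  also have "act (free (length ds - 1)) e' (f \<circ> (!) ds) = act (free (length ds - 1)) e' ((!) (map f ds))"
  proof (intro act_cong dot_map_comp[OF dot_map_dots[OF ds] f])
    fix d assume "d \<le> src (free (length ds - 1))"
    then have "d < length ds" using ds by (cases ds) (auto simp: dots_def)
    then show "(f \<circ> (!) ds) d = map f ds ! d" by simp
  qed
  finally show ?thesis by (simp add: restr_def)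
qed

lemma restr_restr:
  assumes "dots e ds" "dots (free (length ds - 1)) is" "x \<in> FObj X e"
  shows "restr (free (length ds - 1)) is (restr e ds x) = restr e (map ((!) ds) is) x"
  unfolding restr_def[of e ds] by (rule restr_act[OF dot_map_dots[OF assms(1)] assms(2,3)])

lemma restr_free_id: "x \<in> FObj X (free 0) \<Longrightarrow> restr (free 0) [0] x = x"
  "x \<in> FObj X (free 1) \<Longrightarrow> restr (free 1) [0, 1] x = x"
  unfolding restr_def by (auto intro!: act_id simp: le_Suc_eq)

text \<open>The inclusion of one dot into a linked pair is vertical, so colour preservation
  applies.\<close>

lemma linked2_bij: "bij_betw (restr linked2 [0]) (FObj X linked2) (FObj X (free 0))"
  unfolding restr_def using dot_map_dots[of linked2 "[0]"] linked_Obj[of 1]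
  by (auto intro!: act_bij simp: dots_simps)

lemma linked2_ends:
  assumes y: "y \<in> FObj X linked2"
  shows "restr linked2 [0] y = restr linked2 [1] y"
proof -
  have d: "dots linked2 [i]" if "i \<le> 1" for i using that linked_Obj by (simp add: dots_simps)
  have m: "dot_map linked2 linked3 ((!) [i, j])" if "i < j" "j \<le> 2" for i j
    using that linked_Obj by (intro dot_map_links) (auto simp: dots_simps le_Suc_eq)
  \<comment> \<open>The inclusion of a linked pair as the last two of three linked dots is vertical,
    so \<open>y\<close> extends to an element over \<open>linked3\<close>.\<close>
  have "bij_betw (act linked2 linked3 ((!) [1, 2])) (FObj X linked3) (FObj X linked2)"
    by (intro act_bij m) (auto simp: le_Suc_eq)
  then obtain z where z: "z \<in> FObj X linked3" "y = act linked2 linked3 ((!) [1, 2]) z"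
    using y unfolding bij_betw_def by blast
  have r: "restr linked2 [0] (act linked2 linked3 ((!) [i, j]) z) = restr linked3 [i] z"
    "restr linked2 [1] (act linked2 linked3 ((!) [i, j]) z) = restr linked3 [j] z"
    if "i < j" "j \<le> 2" for i j
    using restr_act[OF m[OF that] d z(1)] by simp_all
  \<comment> \<open>Two elements over \<open>linked2\<close> with the same first dot agree, in particular the faces \<open>01\<close> and
    \<open>02\<close> of \<open>z\<close>; hence the dots \<open>1\<close> and \<open>2\<close> of \<open>z\<close> agree.\<close>
  have "restr linked2 [0] (act linked2 linked3 ((!) [0, 1]) z)
      = restr linked2 [0] (act linked2 linked3 ((!) [0, 2]) z)"
    using r(1)[of 0 1] r(1)[of 0 2] by simp
  then have "act linked2 linked3 ((!) [0, 1]) z = act linked2 linked3 ((!) [0, 2]) z"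
    by (rule inj_onD[OF bij_betw_imp_inj_on[OF linked2_bij] _ act_in[OF m z(1)] act_in[OF m z(1)]]) simp_all
  then have "restr linked3 [1] z = restr linked3 [2] z" using r(2)[of 0 1] r(2)[of 0 2] by simp
  then show ?thesis using r[of 1 2] z(2) by simp
qed

section \<open>The underlying category and its laws\<close>

definition ccomp :: "'u \<Rightarrow> 'u \<Rightarrow> 'u" where
  "ccomp g f = restr (free 2) [0, 2]
    (THE x. x \<in> FObj X (free 2) \<and> restr (free 2) [0, 1] x = f \<and> restr (free 2) [1, 2] x = g)"

text \<open>Stands in for the missing degeneracy: the inverse of a vertical bijection, followed by
  forgetting the link.\<close>

definition cid :: "'u \<Rightarrow> 'u" where
  "cid s = restr linked2 [0, 1] (inv_into (FObj X linked2) (restr linked2 [0]) s)"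

text \<open>The restrictions and the value \<open>undefined\<close> are those demanded by
  \<open>small_category\<close>, so that the result is an object of \<open>CAT\<close>.\<close>

definition Fcat :: "('u, 'u) cat" where
  "Fcat = \<lparr>Obj = FObj X (free 0), Arr = FObj X (free 1),
    Dom = (\<lambda>f \<in> FObj X (free 1). restr (free 1) [0] f),
    Cod = (\<lambda>f \<in> FObj X (free 1). restr (free 1) [1] f),
    Ident = (\<lambda>s \<in> FObj X (free 0). cid s),
    Comp = (\<lambda>g f. if f \<in> FObj X (free 1) \<and> g \<in> FObj X (free 1) \<and> restr (free 1) [0] g = restr (free 1) [1] f
      then ccomp g f else undefined)\<rparr>"

text \<open>This is \<open>glue\<close> for cutting off the last edge of a row of unlinked dots.
  Appending edges in this way fills pairs and then triples of composable arrows.\<close>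

lemma glue_free:
  assumes s: "s \<in> FObj X (free n)" and t: "t \<in> FObj X (free 1)"
    and st: "restr (free n) [n] s = restr (free 1) [0] t"
  shows "\<exists>x \<in> FObj X (free (Suc n)). restr (free (Suc n)) [0..<Suc n] x = s \<and> restr (free (Suc n)) [n, Suc n] x = t"
    and "\<lbrakk>x \<in> FObj X (free (Suc n)); y \<in> FObj X (free (Suc n));
      restr (free (Suc n)) [0..<Suc n] x = s; restr (free (Suc n)) [n, Suc n] x = t;
      restr (free (Suc n)) [0..<Suc n] y = s; restr (free (Suc n)) [n, Suc n] y = t\<rbrakk> \<Longrightarrow> x = y"
proof -
  have i: "act (free n) (free (Suc n)) (\<lambda>d. d) = restr (free (Suc n)) [0..<Suc n]"
    using parts(3)[of "free (Suc n)" n]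
    by (auto simp: restr_def initial_part_free nth_append simp del: upt_Suc intro!: act_cong)
  have j: "act (free 1) (free (Suc n)) (\<lambda>d. n + d) = restr (free (Suc n)) [n, Suc n]"
    using parts(4)[of "free (Suc n)" n]
    by (auto simp: restr_def final_part_free le_Suc_eq intro!: act_cong)
  note gl = glue[of "free (Suc n)" n s t, OF free_Obj, unfolded free_sel(1) initial_part_free[OF le_SucI[OF le_refl]]
      final_part_free[OF le_SucI[OF le_refl]] Suc_diff_Suc[OF lessI] diff_self_eq_0]
  show "\<exists>x \<in> FObj X (free (Suc n)). restr (free (Suc n)) [0..<Suc n] x = s \<and> restr (free (Suc n)) [n, Suc n] x = t"
    using gl(1) s t st i j by (simp del: upt_Suc)
  show "\<lbrakk>x \<in> FObj X (free (Suc n)); y \<in> FObj X (free (Suc n));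
      restr (free (Suc n)) [0..<Suc n] x = s; restr (free (Suc n)) [n, Suc n] x = t;
      restr (free (Suc n)) [0..<Suc n] y = s; restr (free (Suc n)) [n, Suc n] y = t\<rbrakk> \<Longrightarrow> x = y"
    using gl(2) s t st i j by (simp del: upt_Suc)
qed

lemma glue_free2:
  assumes "s \<in> FObj X (free 1)" "t \<in> FObj X (free 1)" "restr (free 1) [1] s = restr (free 1) [0] t"
  obtains x where "x \<in> FObj X (free 2)" "restr (free 2) [0, 1] x = s" "restr (free 2) [1, 2] x = t"
  using glue_free(1)[of s 1 t] assms by (auto simp: numeral_2_eq_2)

lemma glue_free2_unique:
  assumes "x \<in> FObj X (free 2)" "y \<in> FObj X (free 2)"
    "restr (free 2) [0, 1] x = restr (free 2) [0, 1] y" "restr (free 2) [1, 2] x = restr (free 2) [1, 2] y"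
  shows "x = y"
proof -
  have d: "dots (free 2) [0, 1]" "dots (free 2) [1, 2]" "dots (free 1) [0]" "dots (free 1) [1]"
    by (simp_all add: dots_simps del: One_nat_def)
  have upt: "[0..<2] = [0, 1]" by (simp add: numeral_2_eq_2)
  have "restr (free 1) [1] (restr (free 2) [0, 1] x) = restr (free 2) [1] x"
    using restr_restr[OF d(1), of "[1]" x] assms(1) by simp
  moreover have "restr (free 1) [0] (restr (free 2) [1, 2] x) = restr (free 2) [1] x"
    using restr_restr[OF d(2), of "[0]" x] assms(1) by simp
  moreover have "restr (free 2) [0, 1] x \<in> FObj X (free 1)" "restr (free 2) [1, 2] x \<in> FObj X (free 1)"
    using restr_in[OF d(1) assms(1)] restr_in[OF d(2) assms(1)] by simp_all
  moreover note glue_free(2)[of "restr (free 2) [0, 1] x" 1 "restr (free 2) [1, 2] x" x y,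
      unfolded Suc_1 upt]
  ultimately show ?thesis using assms by metis
qed

lemma ccomp_restr2:
  assumes "x \<in> FObj X (free 2)"
  shows "ccomp (restr (free 2) [1, 2] x) (restr (free 2) [0, 1] x) = restr (free 2) [0, 2] x"
proof -
  have "(THE z. z \<in> FObj X (free 2) \<and> restr (free 2) [0, 1] z = restr (free 2) [0, 1] x \<and>
      restr (free 2) [1, 2] z = restr (free 2) [1, 2] x) = x"
    using assms glue_free2_unique by (intro the_equality) auto
  then show ?thesis by (simp add: ccomp_def)
qed

lemma Fcat_sel [simp]: "Obj Fcat = FObj X (free 0)" "Arr Fcat = FObj X (free 1)"
  by (simp_all add: Fcat_def)

lemma Fcat_Dom_restr:
  assumes "x \<in> FObj X e" "e \<in> Obj fat_delta" "d < d'" "d' \<le> src e"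
  shows "Dom Fcat (restr e [d, d'] x) = restr e [d] x" "Cod Fcat (restr e [d, d'] x) = restr e [d'] x"
proof -
  have d: "dots e [d, d']" "dots (free 1) [0]" "dots (free 1) [1]"
    using assms by (simp_all add: dots_simps)
  show "Dom Fcat (restr e [d, d'] x) = restr e [d] x" "Cod Fcat (restr e [d, d'] x) = restr e [d'] x"
    using restr_restr[OF d(1), of "[0]" x] restr_restr[OF d(1), of "[1]" x] d(2,3) assms(1) restr_in[OF d(1) assms(1)]
    by (simp_all add: Fcat_def)
qed

lemma restr_Obj:
  assumes "x \<in> FObj X e" "e \<in> Obj fat_delta" "d \<le> src e"
  shows "restr e [d] x \<in> FObj X (free 0)"
  using restr_in[of e "[d]" x] assms by (simp add: dots_simps)

lemma restr_Arr:
  assumes "x \<in> FObj X e" "e \<in> Obj fat_delta" "d < d'" "d' \<le> src e"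
  shows "restr e [d, d'] x \<in> FObj X (free 1)"
  using restr_in[of e "[d, d']" x] assms by (simp add: dots_simps)

lemma restr_hom:
  assumes "x \<in> FObj X e" "e \<in> Obj fat_delta" "d < d'" "d' \<le> src e"
  shows "restr e [d, d'] x \<in> hom Fcat (restr e [d] x) (restr e [d'] x)"
  using restr_Arr[OF assms] Fcat_Dom_restr[OF assms] by (simp add: hom_def)

text \<open>The face on the three dots is the very element over \<open>free 2\<close> that defines
  the composite. Composites can thus be computed inside any element, which turns each law into the
  search for one element with the right faces.\<close>

lemma Fcat_Comp_restr:
  assumes x: "x \<in> FObj X e" and e: "e \<in> Obj fat_delta" and d: "d < d'" "d' < d''" "d'' \<le> src e"
  shows "Comp Fcat (restr e [d', d''] x) (restr e [d, d'] x) = restr e [d, d''] x"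
proof -
  have ds: "dots e [d, d', d'']" using e d by (simp add: dots_simps)
  define z where "z = restr e [d, d', d''] x"
  have z: "z \<in> FObj X (free 2)" unfolding z_def using restr_in[OF ds x] by (simp add: numeral_2_eq_2)
  have "restr (free 2) [0, 1] z = restr e [d, d'] x" "restr (free 2) [1, 2] z = restr e [d', d''] x"
    "restr (free 2) [0, 2] z = restr e [d, d''] x"
    unfolding z_def
    using restr_restr[OF ds, of "[0, 1]" x] restr_restr[OF ds, of "[1, 2]" x] restr_restr[OF ds, of "[0, 2]" x] x
    by (simp_all add: dots_simps numeral_2_eq_2)
  moreover have "restr (free 1) [0] (restr e [d', d''] x) = restr (free 1) [1] (restr e [d, d'] x)"
    using Fcat_Dom_restr(1)[OF x e d(2,3)] Fcat_Dom_restr(2)[OF x e d(1)] d restr_Arr[OF x e]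
    by (simp add: Fcat_def)
  ultimately show ?thesis
    using ccomp_restr2[OF z] restr_Arr[OF x e] d by (simp add: Fcat_def)
qed

lemma Ident_linked2:
  assumes "y \<in> FObj X linked2"
  shows "Ident Fcat (restr linked2 [0] y) = restr linked2 [0, 1] y"
  using assms linked2_bij restr_Obj[OF assms linked_Obj, of 0]
  by (simp add: Fcat_def cid_def bij_betw_def)

text \<open>Because \<open>d\<close> and \<open>d'\<close> lie in one fibre, the two dots form a map
  from \<open>linked2\<close>, so the edge between them comes from an element over a linked
  pair.\<close>

lemma linked_restr:
  assumes x: "x \<in> FObj X e" and e: "e \<in> Obj fat_delta" and d: "d < d'" "d' \<le> src e" "body e d = body e d'"
  shows "restr e [d, d'] x = Ident Fcat (restr e [d] x)" "restr e [d'] x = restr e [d] x"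
proof -
  have m: "dot_map linked2 e ((!) [d, d'])"
    using d e linked_Obj by (intro dot_map_links) (auto simp: dots_simps less_Suc_eq le_Suc_eq)
  define y where "y = act linked2 e ((!) [d, d']) x"
  have y: "y \<in> FObj X linked2" unfolding y_def by (rule act_in[OF m x])
  have "restr linked2 [0] y = restr e [d] x" "restr linked2 [1] y = restr e [d'] x"
    "restr linked2 [0, 1] y = restr e [d, d'] x"
    unfolding y_def using restr_act[OF m _ x] linked_Obj by (simp_all add: dots_simps)
  then show "restr e [d, d'] x = Ident Fcat (restr e [d] x)" "restr e [d'] x = restr e [d] x"
    using Ident_linked2[OF y] linked2_ends[OF y] by simp_all
qed

lemma linked_surj:
  assumes "s \<in> FObj X (free 0)"
  obtains x where "x \<in> FObj X (links n (\<lambda>_. 0))" "restr (links n (\<lambda>_. 0)) [0] x = s"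
proof -
  have "bij_betw (restr (links n (\<lambda>_. 0)) [0]) (FObj X (links n (\<lambda>_. 0))) (FObj X (free 0))"
    unfolding restr_def using dot_map_dots[of "links n (\<lambda>_. 0)" "[0]"] linked_Obj[of n]
    by (auto intro!: act_bij simp: dots_simps)
  then have "s \<in> restr (links n (\<lambda>_. 0)) [0] ` FObj X (links n (\<lambda>_. 0))"
    using assms by (simp add: bij_betw_def)
  then show thesis using that by auto
qed

lemma Fcat_Id_hom:
  assumes "s \<in> FObj X (free 0)" shows "Ident Fcat s \<in> hom Fcat s s"
proof -
  obtain y where y: "y \<in> FObj X linked2" "restr linked2 [0] y = s" using linked_surj[OF assms] by blast
  then show ?thesis
    using restr_hom[OF y(1) linked_Obj, of 0 1] Ident_linked2[OF y(1)] linked2_ends[OF y(1)] by simp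
qed

lemma composable_pair:
  assumes "f \<in> hom Fcat x y" "g \<in> hom Fcat y z"
  obtains u where "u \<in> FObj X (free 2)" "restr (free 2) [0, 1] u = f" "restr (free 2) [1, 2] u = g"
    "restr (free 2) [0] u = x" "restr (free 2) [1] u = y" "restr (free 2) [2] u = z"
proof -
  have "f \<in> FObj X (free 1)" "g \<in> FObj X (free 1)" "restr (free 1) [1] f = restr (free 1) [0] g"
    using assms by (auto simp: hom_def Fcat_def)
  then obtain u where u: "u \<in> FObj X (free 2)" "restr (free 2) [0, 1] u = f" "restr (free 2) [1, 2] u = g"
    by (rule glue_free2)
  then show thesis
    using that[OF u] Fcat_Dom_restr[OF u(1) free_Obj, of 0 1] Fcat_Dom_restr[OF u(1) free_Obj, of 1 2] assms
    by (simp add: hom_def)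
qed

lemma Fcat_Comp_hom:
  assumes "f \<in> hom Fcat x y" "g \<in> hom Fcat y z"
  shows "Comp Fcat g f \<in> hom Fcat x z"
proof -
  obtain u where "u \<in> FObj X (free 2)" "restr (free 2) [0, 1] u = f" "restr (free 2) [1, 2] u = g"
    "restr (free 2) [0] u = x" "restr (free 2) [1] u = y" "restr (free 2) [2] u = z"
    by (rule composable_pair[OF assms])
  then show ?thesis using Fcat_Comp_restr[of u "free 2" 0 1 2] restr_hom[of u "free 2" 0 2] by simp
qed

text \<open>The three arrows are the consecutive edges of one element over four unlinked dots, and
  both bracketings are its face \<open>[0, 3]\<close>.\<close>

lemma Fcat_Comp_assoc:
  assumes f: "f \<in> hom Fcat w x" and g: "g \<in> hom Fcat x y" and h: "h \<in> hom Fcat y z"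
  shows "Comp Fcat h (Comp Fcat g f) = Comp Fcat (Comp Fcat h g) f"
proof -
  obtain u where u: "u \<in> FObj X (free 2)" "restr (free 2) [0, 1] u = f" "restr (free 2) [1, 2] u = g"
    "restr (free 2) [0] u = w" "restr (free 2) [1] u = x" "restr (free 2) [2] u = y"
    by (rule composable_pair[OF f g])
  have "h \<in> FObj X (free 1)" "restr (free 2) [2] u = restr (free 1) [0] h"
    using h u by (auto simp: hom_def Fcat_def)
  with glue_free(1)[OF u(1), of h] obtain v where v: "v \<in> FObj X (free 3)"
    "restr (free 3) [0, 1, 2] v = u" "restr (free 3) [2, 3] v = h"
    by (auto simp: numeral_2_eq_2 numeral_3_eq_3)
  have ds: "dots (free 3) [0, 1, 2]" by (simp add: dots_simps)
  have "restr (free 3) [0, 1] v = f" "restr (free 3) [1, 2] v = g"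
    using restr_restr[OF ds, of "[0, 1]" v] restr_restr[OF ds, of "[1, 2]" v] v u
    by (simp_all add: dots_simps numeral_2_eq_2)
  then show ?thesis
    using Fcat_Comp_restr[OF v(1) free_Obj, of 0 1 2] Fcat_Comp_restr[OF v(1) free_Obj, of 1 2 3]
      Fcat_Comp_restr[OF v(1) free_Obj, of 0 1 3] Fcat_Comp_restr[OF v(1) free_Obj, of 0 2 3] v by simp
qed

text \<open>All edges of an element over three linked dots are the same identity, and two of them
  compose to the third.\<close>

lemma Id_Id:
  assumes "s \<in> FObj X (free 0)" shows "Comp Fcat (Ident Fcat s) (Ident Fcat s) = Ident Fcat s"
proof -
  obtain y where y: "y \<in> FObj X linked3" "restr linked3 [0] y = s" using linked_surj[OF assms] by blast
  note l = linked_restr[OF y(1) linked_Obj]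
  show ?thesis
    using Fcat_Comp_restr[OF y(1) linked_Obj, of 0 1 2] l[of 0 1] l[of 0 2] l[of 1 2] y(2) by simp
qed

text \<open>The vertical arrow from \<open>free 1\<close> that hits the outer dots of \<open>links 2 b\<close> makes composition with
  an identity surjective; as this operation is also idempotent, it is trivial.\<close>

lemma outer_dots:
  assumes b: "b 0 = 0" "b 1 \<le> 1" "b 2 = 1" and f: "f \<in> FObj X (free 1)"
  obtains x where "links 2 b \<in> Obj fat_delta" "x \<in> FObj X (links 2 b)" "restr (links 2 b) [0, 2] x = f"
proof -
  have o: "links 2 b \<in> Obj fat_delta"
    by (rule links_Obj) (use b in \<open>auto simp: less_Suc_eq numeral_2_eq_2\<close>)
  have ds: "dots (links 2 b) [0, 2]" using o by (simp add: dots_simps)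
  have "bij_betw (restr (links 2 b) [0, 2]) (FObj X (links 2 b)) (FObj X (free 1))"
    unfolding restr_def using dot_map_dots[OF ds] b
    by (auto intro!: act_bij simp: less_Suc_eq le_Suc_eq)
  then have "f \<in> restr (links 2 b) [0, 2] ` FObj X (links 2 b)" using f by (simp add: bij_betw_def)
  then show thesis using that[OF o] by auto
qed

lemma Fcat_Comp_Id:
  assumes f: "f \<in> FObj X (free 1)"
  shows "Comp Fcat f (Ident Fcat (Dom Fcat f)) = f"
proof -
  \<comment> \<open>Natural subtraction gives the values 0, 0, 1: only the first two dots are
    linked, so the edge \<open>[0, 1]\<close> is an identity.\<close>
  define e where "e = links 2 (\<lambda>d. d - 1)"
  obtain x where e: "e \<in> Obj fat_delta" and x: "x \<in> FObj X e" "restr e [0, 2] x = f"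
    unfolding e_def by (rule outer_dots[OF _ _ _ f, of "\<lambda>d. d - 1"]) auto
  have se: "src e = 2" "body e 0 = body e 1" by (simp_all add: e_def)
  define g s where "g = restr e [1, 2] x" and "s = Dom Fcat f"
  have s: "restr e [0] x = s" "restr e [1] x = s"
    using Fcat_Dom_restr[OF x(1) e, of 0 2] linked_restr(2)[OF x(1) e, of 0 1] se x(2) by (simp_all add: s_def)
  have sO: "s \<in> FObj X (free 0)" using restr_Obj[OF x(1) e, of 0] s by simp
  have "g \<in> hom Fcat s (Cod Fcat f)"
    using restr_hom[OF x(1) e, of 1 2] se s Fcat_Dom_restr(2)[OF x(1) e, of 0 2] x(2) by (simp add: g_def)
  note assoc = Fcat_Comp_assoc[OF Fcat_Id_hom[OF sO] Fcat_Id_hom[OF sO] this]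
  have "f = Comp Fcat g (Ident Fcat s)"
    using Fcat_Comp_restr[OF x(1) e, of 0 1 2] linked_restr(1)[OF x(1) e, of 0 1] s se x(2) by (simp add: g_def)
  then show ?thesis using assoc Id_Id[OF sO] unfolding s_def by metis
qed

lemma Fcat_Id_Comp:
  assumes f: "f \<in> FObj X (free 1)"
  shows "Comp Fcat (Ident Fcat (Cod Fcat f)) f = f"
proof -
  \<comment> \<open>The values are 0, 1, 1: only the last two dots are linked, so the edge
    \<open>[1, 2]\<close> is an identity.\<close>
  define e where "e = links 2 (\<lambda>d. min d 1)"
  obtain x where e: "e \<in> Obj fat_delta" and x: "x \<in> FObj X e" "restr e [0, 2] x = f"
    unfolding e_def by (rule outer_dots[OF _ _ _ f, of "\<lambda>d. min d 1"]) auto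
  have se: "src e = 2" "body e 1 = body e 2" by (simp_all add: e_def)
  define g s where "g = restr e [0, 1] x" and "s = Cod Fcat f"
  have s: "restr e [2] x = s" "restr e [1] x = s"
    using Fcat_Dom_restr[OF x(1) e, of 0 2] linked_restr(2)[OF x(1) e, of 1 2] se x(2) by (simp_all add: s_def)
  have sO: "s \<in> FObj X (free 0)" using restr_Obj[OF x(1) e, of 1] s se by simp
  have "g \<in> hom Fcat (Dom Fcat f) s"
    using restr_hom[OF x(1) e, of 0 1] se s Fcat_Dom_restr(1)[OF x(1) e, of 0 2] x(2) by (simp add: g_def)
  note assoc = Fcat_Comp_assoc[OF this Fcat_Id_hom[OF sO] Fcat_Id_hom[OF sO]]
  have "f = Comp Fcat (Ident Fcat s) g"
    using Fcat_Comp_restr[OF x(1) e, of 0 1 2] linked_restr(1)[OF x(1) e, of 1 2] s se x(2) by (simp add: g_def)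
  then show ?thesis using assoc Id_Id[OF sO] unfolding s_def by metis
qed

lemma small_category_Fcat: "small_category small Fcat"
proof unfold_locales
  fix f assume f: "f \<in> Arr Fcat"
  then have "restr (free 1) [0] f \<in> FObj X (free 0)" "restr (free 1) [1] f \<in> FObj X (free 0)"
    using restr_Obj[of f "free 1" 0] restr_Obj[of f "free 1" 1] by simp_all
  then show "Dom Fcat f \<in> Obj Fcat" "Cod Fcat f \<in> Obj Fcat" using f by (simp_all add: Fcat_def)
  show "Comp Fcat f (Ident Fcat (Dom Fcat f)) = f" "Comp Fcat (Ident Fcat (Cod Fcat f)) f = f"
    using f Fcat_Comp_Id Fcat_Id_Comp by simp_all
next
  show "small (Obj Fcat)" "small (Arr Fcat)"
    using FObj_Obj[of "free 0"] FObj_Obj[of "free 1"] free_Obj by simp_all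
  show "\<not> (f \<in> Arr Fcat \<and> g \<in> Arr Fcat \<and> Dom Fcat g = Cod Fcat f) \<Longrightarrow> Comp Fcat g f = undefined" for f g
    by (auto simp: Fcat_def)
qed (auto simp: Fcat_Id_hom intro: Fcat_Comp_hom Fcat_Comp_assoc, auto simp: Fcat_def)

section \<open>Elements as strings of consecutive edges\<close>

lemma final_part_step:
  assumes e: "e \<in> Obj fat_delta" and s: "src e = Suc m"
  shows "final_part e m = (if body e (Suc m) = body e m then linked2 else free 1)"
  using fat_obj_props(7)[OF e, of m] s
  by (auto simp: final_part_def free_def less_Suc_eq le_Suc_eq intro!: links_cong)

text \<open>Cutting at the last dot but one leaves a shorter object and a piece with two dots. An
  element over that piece is determined by its edge if the dots are unlinked, and by its first dot
  if they are linked.\<close>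

lemma spine_unique:
  assumes "e \<in> Obj fat_delta" "x \<in> FObj X e" "y \<in> FObj X e"
    and "\<And>d. d \<le> src e \<Longrightarrow> restr e [d] x = restr e [d] y"
    and "\<And>d. d < src e \<Longrightarrow> restr e [d, Suc d] x = restr e [d, Suc d] y"
  shows "x = y"
  using assms
proof (induction "src e" arbitrary: e x y)
  case 0
  then have "e = free 0"
    using links_body[OF 0(2)] fat_obj_props(5)[OF 0(2)] by (metis free_def le_0_eq links_cong)
  then show ?case using 0 restr_free_id(1) by simp
next
  case (Suc m)
  have m: "m \<le> src e" using Suc(2) by simp
  note pp = parts[OF Suc(3) m]
  let ?i = "initial_part e m" and ?j = "final_part e m"
  have dj: "dots ?j [0]" "dots ?j [0, 1]" using pp(2,6) Suc(2) by (auto simp: dots_simps)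
  have di: "dots ?i [d]" if "d \<le> m" for d using pp(1,5) that by (auto simp: dots_simps)
  have di': "dots ?i [d, Suc d]" if "d < m" for d using pp(1,5) that by (auto simp: dots_simps)
  have i: "act ?i e (\<lambda>d. d) x = act ?i e (\<lambda>d. d) y"
  proof (rule Suc(1))
    show "m = src ?i" "?i \<in> Obj fat_delta" by (simp_all only: pp)
    fix d
    show "restr ?i [d] (act ?i e (\<lambda>d. d) x) = restr ?i [d] (act ?i e (\<lambda>d. d) y)" if "d \<le> src ?i"
      using restr_act[OF pp(3) di Suc(4)] restr_act[OF pp(3) di Suc(5)] Suc(6)[of d] that m by (simp add: pp(5))
    show "restr ?i [d, Suc d] (act ?i e (\<lambda>d. d) x) = restr ?i [d, Suc d] (act ?i e (\<lambda>d. d) y)" if "d < src ?i"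
      using restr_act[OF pp(3) di' Suc(4)] restr_act[OF pp(3) di' Suc(5)] Suc(7)[of d] that m by (simp add: pp(5))
  qed (intro act_in[OF pp(3)] Suc)+
  have r0: "restr ?j [0] (act ?j e (\<lambda>d. m + d) x) = restr ?j [0] (act ?j e (\<lambda>d. m + d) y)"
    using restr_act[OF pp(4) dj(1) Suc(4)] restr_act[OF pp(4) dj(1) Suc(5)] Suc(6)[of m] m by simp
  have r1: "restr ?j [0, 1] (act ?j e (\<lambda>d. m + d) x) = restr ?j [0, 1] (act ?j e (\<lambda>d. m + d) y)"
    using restr_act[OF pp(4) dj(2) Suc(4)] restr_act[OF pp(4) dj(2) Suc(5)] Suc(7)[of m] Suc(2) by simp
  note jx = act_in[OF pp(4) Suc(4)] and jy = act_in[OF pp(4) Suc(5)]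
  have j: "act ?j e (\<lambda>d. m + d) x = act ?j e (\<lambda>d. m + d) y"
  proof (cases "body e (Suc m) = body e m")
    case True
    then have "?j = linked2" using final_part_step[OF Suc(3), of m] Suc(2) by simp
    then show ?thesis using r0 jx jy linked2_bij by (auto simp: bij_betw_def dest: inj_onD)
  next
    case False
    then have "?j = free 1" using final_part_step[OF Suc(3), of m] Suc(2) by simp
    then show ?thesis using r1 jx jy restr_free_id(2) by metis
  qed
  have "restr ?i [m] (act ?i e (\<lambda>d. d) y) = restr ?j [0] (act ?j e (\<lambda>d. m + d) y)"
    using restr_act[OF pp(3) di Suc(5), of m] restr_act[OF pp(4) dj(1) Suc(5)] by simp
  from glue(2)[OF Suc(3) m act_in[OF pp(3) Suc(5)] jy this Suc(4,5)] show ?case using i j by simp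
qed

text \<open>The induction of \<open>spine_unique\<close>, now with the existence half of
  \<open>glue\<close>. Over a link the prescribed edge is an identity; this forces its two ends to
  agree, and the edge comes from an element over \<open>linked2\<close>.\<close>

lemma spine_exists:
  assumes "e \<in> Obj fat_delta"
    and "\<And>d. d \<le> src e \<Longrightarrow> s d \<in> Obj Fcat"
    and "\<And>d. d < src e \<Longrightarrow> b d \<in> hom Fcat (s d) (s (Suc d))"
    and "\<And>d. \<lbrakk>d < src e; body e d = body e (Suc d)\<rbrakk> \<Longrightarrow> b d = Ident Fcat (s d)"
  shows "\<exists>x \<in> FObj X e. (\<forall>d \<le> src e. restr e [d] x = s d) \<and> (\<forall>d < src e. restr e [d, Suc d] x = b d)"
  using assms
proof (induction "src e" arbitrary: e)
  case 0
  then have e: "e = free 0"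
    using links_body[OF 0(2)] fat_obj_props(5)[OF 0(2)] by (metis free_def le_0_eq links_cong)
  show ?case using 0(3)[of 0] restr_free_id(1) unfolding e by (intro bexI[of _ "s 0"]) auto
next
  case (Suc m)
  have m: "m \<le> src e" "m < src e" using Suc(2) by simp_all
  note pp = parts[OF Suc(3) m(1)]
  let ?i = "initial_part e m" and ?j = "final_part e m"
  have dj: "dots ?j [0]" "dots ?j [1]" "dots ?j [0, 1]" using pp(2,6) Suc(2) by (auto simp: dots_simps)
  have di: "dots ?i [d]" if "d \<le> m" for d using pp(1,5) that by (auto simp: dots_simps)
  have di': "dots ?i [d, Suc d]" if "d < m" for d using pp(1,5) that by (auto simp: dots_simps)
  have bi: "body ?i d = body e d" if "d \<le> m" for d using that by (simp add: initial_part_def)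
  have "\<exists>x \<in> FObj X ?i. (\<forall>d \<le> src ?i. restr ?i [d] x = s d) \<and> (\<forall>d < src ?i. restr ?i [d, Suc d] x = b d)"
  proof (rule Suc(1))
    show "m = src ?i" "?i \<in> Obj fat_delta" by (simp_all only: pp)
  qed (use Suc(2,4-6) pp(5) bi in auto)
  then obtain x1 where x1: "x1 \<in> FObj X ?i" "\<And>d. d \<le> m \<Longrightarrow> restr ?i [d] x1 = s d"
    "\<And>d. d < m \<Longrightarrow> restr ?i [d, Suc d] x1 = b d"
    by (auto simp: pp(5))
  have "\<exists>x \<in> FObj X ?j. restr ?j [0] x = s m \<and> restr ?j [1] x = s (Suc m) \<and> restr ?j [0, 1] x = b m"
  proof (cases "body e (Suc m) = body e m")
    case True
    then have j: "?j = linked2" using final_part_step[OF Suc(3), of m] Suc(2) by simp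
    obtain y where y: "y \<in> FObj X linked2" "restr linked2 [0] y = s m"
      using linked_surj[of "s m"] Suc(4)[of m] m by auto
    have bm: "b m = Ident Fcat (s m)" using Suc(6)[of m] True m by simp
    then have "s (Suc m) = s m" using Suc(5)[of m] m Fcat_Id_hom[of "s m"] Suc(4)[of m] by (simp add: hom_def)
    then show ?thesis
      unfolding j using y linked2_ends[OF y(1)] Ident_linked2[OF y(1)] bm by (intro bexI[of _ y]) auto
  next
    case False
    then have j: "?j = free 1" using final_part_step[OF Suc(3), of m] Suc(2) by simp
    have "b m \<in> FObj X (free 1)" "Dom Fcat (b m) = s m" "Cod Fcat (b m) = s (Suc m)"
      using Suc(5)[of m] m by (auto simp: hom_def)
    then show ?thesis
      unfolding j using restr_free_id(2)[of "b m"] by (intro bexI[of _ "b m"]) (auto simp: Fcat_def)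
  qed
  then obtain x2 where x2: "x2 \<in> FObj X ?j" "restr ?j [0] x2 = s m" "restr ?j [1] x2 = s (Suc m)"
    "restr ?j [0, 1] x2 = b m" by blast
  obtain x where x: "x \<in> FObj X e" "act ?i e (\<lambda>d. d) x = x1" "act ?j e (\<lambda>d. m + d) x = x2"
    using glue(1)[OF Suc(3) m(1) x1(1) x2(1)] x1(2)[of m] x2(2) by auto
  have "restr e [d] x = s d" if "d \<le> src e" for d
  proof (cases "d \<le> m")
    case True
    then show ?thesis using restr_act[OF pp(3) di x(1), of d] x x1(2) by simp
  next
    case False
    then have "d = Suc m" using that Suc(2) by simp
    then show ?thesis using restr_act[OF pp(4) dj(2) x(1)] x x2(3) by simp
  qed
  moreover have "restr e [d, Suc d] x = b d" if "d < src e" for d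
  proof (cases "d < m")
    case True
    then show ?thesis using restr_act[OF pp(3) di' x(1), of d] x x1(3) by simp
  next
    case False
    then have "d = m" using that Suc(2) by simp
    then show ?thesis using restr_act[OF pp(4) dj(3) x(1)] x x2(4) by simp
  qed
  ultimately show ?case using x(1) by blast
qed

end

section \<open>The functor from fair presheaves to categories\<close>

lemma nat_trans_id:
  assumes "is_functor A B F"
  shows "nat_trans A B F F (\<lambda>x \<in> Obj A. Ident B (FObj F x))"
proof -
  interpret is_functor A B F by fact
  show ?thesis
  proof unfold_locales
    fix f x y assume f: "f \<in> hom A x y"
    show "Comp B ((\<lambda>x \<in> Obj A. Ident B (FObj F x)) y) (FArr F f)
        = Comp B (FArr F f) ((\<lambda>x \<in> Obj A. Ident B (FObj F x)) x)"
      using A.hom_Obj[OF f] B.Comp_Id'[OF FArr_hom[OF f]] B.Id_Comp'[OF FArr_hom[OF f]] by simp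
  qed (auto intro: B.Id_hom FObj_Obj)
qed

lemma nat_trans_comp:
  assumes "nat_trans A B F G \<sigma>" "nat_trans A B G H \<tau>"
  shows "nat_trans A B F H (\<lambda>x \<in> Obj A. Comp B (\<tau> x) (\<sigma> x))"
proof -
  interpret S: nat_trans A B F G \<sigma> by fact
  interpret T: nat_trans A B G H \<tau> by fact
  show ?thesis
  proof unfold_locales
    fix x assume "x \<in> Obj A"
    then show "(\<lambda>x \<in> Obj A. Comp B (\<tau> x) (\<sigma> x)) x \<in> hom B (FObj F x) (FObj H x)"
      using S.F.B.Comp_hom[OF S.component T.component] by simp
  next
    fix f x y assume f: "f \<in> hom A x y"
    have xy: "x \<in> Obj A" "y \<in> Obj A" using S.F.A.hom_Obj[OF f] by auto
    note assoc = S.F.B.Comp_assoc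
    have "Comp B (Comp B (\<tau> y) (\<sigma> y)) (FArr F f) = Comp B (\<tau> y) (Comp B (FArr G f) (\<sigma> x))"
      using assoc[OF S.F.FArr_hom[OF f] S.component[OF xy(2)] T.component[OF xy(2)]] S.natural[OF f] by simp
    also have "\<dots> = Comp B (Comp B (FArr H f) (\<tau> x)) (\<sigma> x)"
      using assoc[OF S.component[OF xy(1)] S.G.FArr_hom[OF f] T.component[OF xy(2)]] T.natural[OF f] by simp
    also have "\<dots> = Comp B (FArr H f) (Comp B (\<tau> x) (\<sigma> x))"
      using assoc[OF S.component[OF xy(1)] T.component[OF xy(1)] T.G.FArr_hom[OF f]] by simp
    finally show "Comp B ((\<lambda>x \<in> Obj A. Comp B (\<tau> x) (\<sigma> x)) y) (FArr F f)
        = Comp B (FArr H f) ((\<lambda>x \<in> Obj A. Comp B (\<tau> x) (\<sigma> x)) x)"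
      using xy by simp
  qed simp
qed

lemma category_SetFairCat: "category (SetFairCat small)"
  unfolding SetFairCat_def
proof (rule category_cat_of_homs)
  interpret S: category "SET small" by (rule category_SET)
  fix X :: "'a fat_presheaf" assume "X \<in> {X. fair_Set_category small X}"
  then interpret fair_Set_category small X by simp
  show "(\<lambda>e \<in> Obj fat_delta. Ident (SET small) (FObj X e))
      \<in> {\<tau>. nat_trans (opposite fat_delta) (SET small) X X \<tau>}"
    using nat_trans_id[OF is_functor_axioms] by simp
next
  fix X Y Z :: "'a fat_presheaf" and \<sigma> \<tau>
  assume "\<sigma> \<in> {\<tau>. nat_trans (opposite fat_delta) (SET small) X Y \<tau>}"
    and "\<tau> \<in> {\<tau>. nat_trans (opposite fat_delta) (SET small) Y Z \<tau>}"
  then show "(\<lambda>e \<in> Obj fat_delta. Comp (SET small) (\<tau> e) (\<sigma> e))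
      \<in> {\<tau>. nat_trans (opposite fat_delta) (SET small) X Z \<tau>}"
    using nat_trans_comp[of "opposite fat_delta" "SET small" X Y \<sigma> Z \<tau>] by simp
next
  fix X Y :: "'a fat_presheaf" and \<tau>
  assume "\<tau> \<in> {\<tau>. nat_trans (opposite fat_delta) (SET small) X Y \<tau>}"
  then interpret nat_trans "opposite fat_delta" "SET small" X Y \<tau> by simp
  have e: "\<tau> \<in> extensional (Obj fat_delta)" using component_extensional by simp
  have c: "\<tau> e \<in> hom (SET small) (FObj X e) (FObj Y e)" if "e \<in> Obj fat_delta" for e
    using component[of e] that by simp
  show "(\<lambda>e \<in> Obj fat_delta. Comp (SET small) (\<tau> e) ((\<lambda>e \<in> Obj fat_delta. Ident (SET small) (FObj X e)) e)) = \<tau>"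
    by (rule extensionalityI[OF _ e]) (simp_all add: F.B.Comp_Id'[OF c] del: SET_simps)
  show "(\<lambda>e \<in> Obj fat_delta. Comp (SET small) ((\<lambda>e \<in> Obj fat_delta. Ident (SET small) (FObj Y e)) e) (\<tau> e)) = \<tau>"
    by (rule extensionalityI[OF _ e]) (simp_all add: F.B.Id_Comp'[OF c] del: SET_simps)
next
  fix W X Y Z :: "'a fat_presheaf" and \<rho> \<sigma> \<tau>
  assume "\<rho> \<in> {\<tau>. nat_trans (opposite fat_delta) (SET small) W X \<tau>}"
    and "\<sigma> \<in> {\<tau>. nat_trans (opposite fat_delta) (SET small) X Y \<tau>}"
    and "\<tau> \<in> {\<tau>. nat_trans (opposite fat_delta) (SET small) Y Z \<tau>}"
  then interpret R: nat_trans "opposite fat_delta" "SET small" W X \<rho>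
    + S: nat_trans "opposite fat_delta" "SET small" X Y \<sigma>
    + T: nat_trans "opposite fat_delta" "SET small" Y Z \<tau> by simp_all
  have "Comp (SET small) (\<tau> e) (Comp (SET small) (\<sigma> e) (\<rho> e))
      = Comp (SET small) (Comp (SET small) (\<tau> e) (\<sigma> e)) (\<rho> e)" if "e \<in> Obj fat_delta" for e
    using R.F.B.Comp_assoc[OF R.component S.component T.component, of e] that by (simp del: SET_simps)
  then show "(\<lambda>e \<in> Obj fat_delta. Comp (SET small) (\<tau> e)
        ((\<lambda>e \<in> Obj fat_delta. Comp (SET small) (\<sigma> e) (\<rho> e)) e))
      = (\<lambda>e \<in> Obj fat_delta. Comp (SET small)
        ((\<lambda>e \<in> Obj fat_delta. Comp (SET small) (\<tau> e) (\<sigma> e)) e) (\<rho> e))"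
    by (intro restrict_ext) (simp del: SET_simps)
qed

lemma category_CAT: "category (CAT small)"
  unfolding CAT_def
proof (rule category_cat_of_homs)
  fix C :: "('a, 'a) cat" assume "C \<in> {C. small_category small C}"
  then show "id_fctr C \<in> {F. is_functor C C F}" by (simp add: small_category_def is_functor_id)
next
  fix C D :: "('a, 'a) cat" and F assume "F \<in> {F. is_functor C D F}"
  then have F: "is_functor C D F" by simp
  then interpret is_functor C D F .
  show "comp_fctr C F (id_fctr C) = F"
    by (rule functor_eqI[OF is_functor_comp[OF is_functor_id[OF A.category_axioms] F] F]) simp_all
  have "FArr F f \<in> Arr D" if "f \<in> Arr C" for f using FArr_hom[of f] that by (simp add: hom_def)
  then show "comp_fctr C (id_fctr D) F = F"
    by (intro functor_eqI[OF is_functor_comp[OF F is_functor_id[OF B.category_axioms]] F]) (simp_all add: FObj_Obj)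
next
  fix B C D E :: "('a, 'a) cat" and F G H
  assume "F \<in> {F. is_functor B C F}" "G \<in> {F. is_functor C D F}" "H \<in> {F. is_functor D E F}"
  then have F: "is_functor B C F" and G: "is_functor C D G" and H: "is_functor D E H" by simp_all
  interpret is_functor B C F by fact
  have "FArr F f \<in> Arr C" if "f \<in> Arr B" for f using FArr_hom[of f] that by (simp add: hom_def)
  then show "comp_fctr B H (comp_fctr B G F) = comp_fctr B (comp_fctr C H G) F"
    by (intro functor_eqI[OF is_functor_comp[OF is_functor_comp[OF F G] H]
        is_functor_comp[OF F is_functor_comp[OF G H]]]) (simp_all add: FObj_Obj)
qed (auto intro: is_functor_comp)

section \<open>Transformations of fair presheaves against functors\<close>

locale fair_pair = X: fair_Set_category small X + Y: fair_Set_category small Y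
  for small :: "'u set \<Rightarrow> bool" and X Y :: "'u fat_presheaf"
begin

abbreviation transformation where
  "transformation \<tau> \<equiv> nat_trans (opposite fat_delta) (SET small) X Y \<tau>"

definition functor_of :: "(fat_obj \<Rightarrow> ('u set, 'u \<Rightarrow> 'u) arrow) \<Rightarrow> ('u, 'u, 'u, 'u) fctr" where
  "functor_of \<tau> = \<lparr>FObj = body (\<tau> (free 0)), FArr = body (\<tau> (free 1))\<rparr>"

lemma component_PiE:
  assumes "transformation \<tau>" "e \<in> Obj fat_delta"
  shows "src (\<tau> e) = FObj X e" "tgt (\<tau> e) = FObj Y e" "body (\<tau> e) \<in> FObj X e \<rightarrow>\<^sub>E FObj Y e"
  using nat_trans.component[OF assms(1), of e] assms(2) by (simp_all add: hom_SET)

lemma component_in: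
  assumes "transformation \<tau>" "e \<in> Obj fat_delta" "x \<in> FObj X e"
  shows "body (\<tau> e) x \<in> FObj Y e"
  using component_PiE(3)[OF assms(1,2)] assms(3) by fast

lemma component_act:
  assumes t: "transformation \<tau>" and f: "dot_map e e' f" and x: "x \<in> FObj X e'"
  shows "body (\<tau> e) (X.act e e' f x) = Y.act e e' f (body (\<tau> e') x)"
proof -
  have "Comp (SET small) (\<tau> e) (FArr X (fat_arrow e e' f)) = Comp (SET small) (FArr Y (fat_arrow e e' f)) (\<tau> e')"
    using nat_trans.natural[OF t, of "fat_arrow e e' f" e' e] fat_arrow_hom[OF f] by (simp del: SET_simps)
  then have "compose (FObj X e') (body (\<tau> e)) (X.act e e' f) x
      = compose (FObj X e') (Y.act e e' f) (body (\<tau> e')) x"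
    by (simp add: X.FArr_fat_arrow[OF f, unfolded hom_SET] component_PiE[OF t dot_mapD(2)[OF f]]
        X.act_def Y.act_def)
  then show ?thesis using x by (simp add: compose_def)
qed

lemma component_restr:
  assumes "transformation \<tau>" "dots e ds" "x \<in> FObj X e"
  shows "Y.restr e ds (body (\<tau> e) x) = body (\<tau> (free (length ds - 1))) (X.restr e ds x)"
  unfolding X.restr_def Y.restr_def using component_act[OF assms(1) dot_map_dots[OF assms(2)] assms(3)] by simp

text \<open>Identities and composites are faces of elements over \<open>linked2\<close> and
  \<open>free 2\<close>, and components commute with taking faces.\<close>

lemma is_functor_functor_of:
  assumes t: "transformation \<tau>"
  shows "is_functor X.Fcat Y.Fcat (functor_of \<tau>)"
proof -
  interpret CX: small_category small X.Fcat by (rule X.small_category_Fcat)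
  interpret CY: small_category small Y.Fcat by (rule Y.small_category_Fcat)
  show ?thesis
  proof unfold_locales
    show "FObj (functor_of \<tau>) s \<in> Obj Y.Fcat" if "s \<in> Obj X.Fcat" for s
      using component_in[OF t free_Obj, of s 0] that by (simp add: functor_of_def)
    fix f x y assume "f \<in> hom X.Fcat x y"
    then have f: "f \<in> FObj X (free 1)" and xy: "x = X.restr (free 1) [0] f" "y = X.restr (free 1) [1] f"
      by (auto simp: hom_def X.Fcat_def)
    show "FArr (functor_of \<tau>) f \<in> hom Y.Fcat (FObj (functor_of \<tau>) x) (FObj (functor_of \<tau>) y)"
      using component_in[OF t free_Obj f] component_restr[OF t _ f, of "[0]"] component_restr[OF t _ f, of "[1]"]
      by (simp add: hom_def functor_of_def xy) (simp add: Y.Fcat_def)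
  next
    fix s assume "s \<in> Obj X.Fcat"
    then obtain y where y: "y \<in> FObj X linked2" "X.restr linked2 [0] y = s"
      using X.linked_surj[of s 1] by auto
    then show "FArr (functor_of \<tau>) (Ident X.Fcat s) = Ident Y.Fcat (FObj (functor_of \<tau>) s)"
      using X.Ident_linked2[OF y(1)] Y.Ident_linked2[OF component_in[OF t linked_Obj y(1)]]
        component_restr[OF t _ y(1), of "[0]"] component_restr[OF t _ y(1), of "[0, 1]"] linked_Obj
      by (simp add: functor_of_def dots_simps)
  next
    fix f g x y z assume fg: "f \<in> hom X.Fcat x y" "g \<in> hom X.Fcat y z"
    obtain u where u: "u \<in> FObj X (free 2)" "X.restr (free 2) [0, 1] u = f" "X.restr (free 2) [1, 2] u = g"
      by (rule X.composable_pair[OF fg])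
    show "FArr (functor_of \<tau>) (Comp X.Fcat g f)
        = Comp Y.Fcat (FArr (functor_of \<tau>) g) (FArr (functor_of \<tau>) f)"
      using X.Fcat_Comp_restr[OF u(1) free_Obj, of 0 1 2]
        Y.Fcat_Comp_restr[OF component_in[OF t free_Obj u(1)] free_Obj, of 0 1 2]
        component_restr[OF t _ u(1), of "[0, 1]"] component_restr[OF t _ u(1), of "[1, 2]"]
        component_restr[OF t _ u(1), of "[0, 2]"] u
      by (simp add: functor_of_def)
  next
    show "FObj (functor_of \<tau>) \<in> extensional (Obj X.Fcat)" "FArr (functor_of \<tau>) \<in> extensional (Arr X.Fcat)"
      using component_PiE(3)[OF t free_Obj] by (auto simp: functor_of_def PiE_def)
  qed
qed

text \<open>All pairs of dots are recorded, not only consecutive ones, because arrows of the fat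
  delta may skip dots. This makes the relation stable under the action, as \<open>lifts_act\<close>
  needs.\<close>

definition lifts :: "('u, 'u, 'u, 'u) fctr \<Rightarrow> fat_obj \<Rightarrow> 'u \<Rightarrow> 'u \<Rightarrow> bool" where
  "lifts \<phi> e x y \<longleftrightarrow> y \<in> FObj Y e \<and>
    (\<forall>d \<le> src e. Y.restr e [d] y = FObj \<phi> (X.restr e [d] x)) \<and>
    (\<forall>d d'. d < d' \<and> d' \<le> src e \<longrightarrow> Y.restr e [d, d'] y = FArr \<phi> (X.restr e [d, d'] x))"

lemma lifts_unique:
  assumes "e \<in> Obj fat_delta" "lifts \<phi> e x y" "lifts \<phi> e x y'"
  shows "y = y'"
  by (rule Y.spine_unique[OF assms(1)]) (use assms(2,3) in \<open>auto simp: lifts_def\<close>)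

text \<open>Since \<open>\<phi>\<close> preserves identities, the links of \<open>x\<close> go to
  identities and \<open>spine_exists\<close> supplies an element with the right consecutive edges.
  Since \<open>\<phi>\<close> preserves composites, the longer edges are right as well.\<close>

lemma lifts_exists:
  assumes \<phi>: "is_functor X.Fcat Y.Fcat \<phi>" and e: "e \<in> Obj fat_delta" and x: "x \<in> FObj X e"
  shows "\<exists>y. lifts \<phi> e x y"
proof -
  interpret is_functor X.Fcat Y.Fcat \<phi> by fact
  have "\<exists>y \<in> FObj Y e. (\<forall>d \<le> src e. Y.restr e [d] y = FObj \<phi> (X.restr e [d] x)) \<and>
      (\<forall>d < src e. Y.restr e [d, Suc d] y = FArr \<phi> (X.restr e [d, Suc d] x))"
  proof (rule Y.spine_exists[OF e])
    fix d
    show "FObj \<phi> (X.restr e [d] x) \<in> Obj Y.Fcat" if "d \<le> src e"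
      using X.restr_Obj[OF x e that] FObj_Obj by simp
    assume d: "d < src e"
    show "FArr \<phi> (X.restr e [d, Suc d] x)
        \<in> hom Y.Fcat (FObj \<phi> (X.restr e [d] x)) (FObj \<phi> (X.restr e [Suc d] x))"
      using X.restr_hom[OF x e, of d "Suc d"] d by (intro FArr_hom) simp
    show "FArr \<phi> (X.restr e [d, Suc d] x) = Ident Y.Fcat (FObj \<phi> (X.restr e [d] x))"
      if "body e d = body e (Suc d)"
      using X.linked_restr(1)[OF x e, of d "Suc d"] d that FArr_Id X.restr_Obj[OF x e, of d] by simp
  qed
  then obtain y where y: "y \<in> FObj Y e" "\<And>d. d \<le> src e \<Longrightarrow> Y.restr e [d] y = FObj \<phi> (X.restr e [d] x)"
    and s: "\<And>d. d < src e \<Longrightarrow> Y.restr e [d, Suc d] y = FArr \<phi> (X.restr e [d, Suc d] x)"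
    by blast
  have "Y.restr e [d, d'] y = FArr \<phi> (X.restr e [d, d'] x)" if "d < d'" "d' \<le> src e" for d d'
    using that
  proof (induction d')
    case (Suc c)
    show ?case
    proof (cases "d = c")
      case True
      then show ?thesis using s[of d] Suc by simp
    next
      case False
      then have c: "d < c" "c < Suc c" "Suc c \<le> src e" using Suc by auto
      show ?thesis
        using Y.Fcat_Comp_restr[OF y(1) e c] X.Fcat_Comp_restr[OF x e c] Suc.IH s[of c] c
          FArr_Comp[OF X.restr_hom[OF x e, of d c] X.restr_hom[OF x e, of c "Suc c"]] by simp
    qed
  qed simp
  then have "lifts \<phi> e x y" using y by (simp add: lifts_def)
  then show ?thesis ..
qed

lemma lifts_act:
  assumes f: "dot_map e e' f" and x: "x \<in> FObj X e'" and l: "lifts \<phi> e' x y"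
  shows "lifts \<phi> e (X.act e e' f x) (Y.act e e' f y)"
  unfolding lifts_def
proof (intro conjI allI impI)
  note dm = dot_mapD[OF f]
  have y: "y \<in> FObj Y e'" using l by (simp add: lifts_def)
  then show "Y.act e e' f y \<in> FObj Y e" by (rule Y.act_in[OF f])
  show "Y.restr e [d] (Y.act e e' f y) = FObj \<phi> (X.restr e [d] (X.act e e' f x))" if "d \<le> src e" for d
    using X.restr_act[OF f _ x, of "[d]"] Y.restr_act[OF f _ y, of "[d]"] that dm(3)[OF that] l dm(1)
    by (simp add: dots_simps lifts_def)
  show "Y.restr e [d, d'] (Y.act e e' f y) = FArr \<phi> (X.restr e [d, d'] (X.act e e' f x))"
    if "d < d' \<and> d' \<le> src e" for d d'
    using X.restr_act[OF f _ x, of "[d, d']"] Y.restr_act[OF f _ y, of "[d, d']"] that dm(3)[of d'] dm(4)[of d d'] l dm(1)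
    by (simp add: dots_simps lifts_def)
qed

text \<open>Together with \<open>lifts_unique\<close> this recovers a transformation from the
  functor it induces.\<close>

lemma lifts_component:
  assumes t: "transformation \<tau>" and e: "e \<in> Obj fat_delta" and x: "x \<in> FObj X e"
  shows "lifts (functor_of \<tau>) e x (body (\<tau> e) x)"
  unfolding lifts_def functor_of_def
  using component_in[OF t e x] component_restr[OF t _ x, of "[_]"] component_restr[OF t _ x, of "[_, _]"] e
  by (auto simp: dots_simps)

lemma functor_of_inj:
  assumes s: "transformation \<sigma>" and t: "transformation \<tau>" and eq: "functor_of \<sigma> = functor_of \<tau>"
  shows "\<sigma> = \<tau>"
proof (rule extensionalityI[of _ "Obj fat_delta"])
  show "\<sigma> \<in> extensional (Obj fat_delta)" "\<tau> \<in> extensional (Obj fat_delta)"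
    using nat_trans.component_extensional[OF s] nat_trans.component_extensional[OF t] by simp_all
  fix e assume e: "e \<in> Obj fat_delta"
  have "body (\<sigma> e) = body (\<tau> e)"
  proof (rule extensionalityI[of _ "FObj X e"])
    show "body (\<sigma> e) \<in> extensional (FObj X e)" "body (\<tau> e) \<in> extensional (FObj X e)"
      using component_PiE(3)[OF s e] component_PiE(3)[OF t e] by (auto simp: PiE_def)
    fix x assume x: "x \<in> FObj X e"
    show "body (\<sigma> e) x = body (\<tau> e) x"
      by (rule lifts_unique[OF e lifts_component[OF s e x]]) (unfold eq, rule lifts_component[OF t e x])
  qed
  then show "\<sigma> e = \<tau> e" using component_PiE(1,2)[OF s e] component_PiE(1,2)[OF t e] by (simp add: arrow.expand)
qed

definition lift :: "('u, 'u, 'u, 'u) fctr \<Rightarrow> fat_obj \<Rightarrow> ('u set, 'u \<Rightarrow> 'u) arrow" where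
  "lift \<phi> = (\<lambda>e \<in> Obj fat_delta. Arrow (FObj X e) (\<lambda>x \<in> FObj X e. THE y. lifts \<phi> e x y) (FObj Y e))"

lemma lifts_lift:
  assumes "is_functor X.Fcat Y.Fcat \<phi>" "e \<in> Obj fat_delta" "x \<in> FObj X e"
  shows "lifts \<phi> e x (body (lift \<phi> e) x)"
proof -
  have "\<exists>!y. lifts \<phi> e x y" using lifts_exists[OF assms] lifts_unique[OF assms(2)] by blast
  from theI'[OF this] show ?thesis using assms by (simp add: lift_def)
qed

lemma transformation_lift:
  assumes \<phi>: "is_functor X.Fcat Y.Fcat \<phi>"
  shows "transformation (lift \<phi>)"
proof -
  have c: "lift \<phi> e \<in> hom (SET small) (FObj X e) (FObj Y e)" if e: "e \<in> Obj fat_delta" for e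
  proof -
    have "body (lift \<phi> e) x \<in> FObj Y e" if "x \<in> FObj X e" for x
      using lifts_lift[OF \<phi> e that] by (simp add: lifts_def)
    moreover have "small (FObj X e)" "small (FObj Y e)"
      using X.FObj_Obj[of e] Y.FObj_Obj[of e] e by simp_all
    ultimately show ?thesis using e by (auto simp: hom_SET lift_def)
  qed
  show ?thesis
  proof (intro nat_trans.intro nat_trans_axioms.intro X.is_functor_axioms Y.is_functor_axioms)
    fix a e e' assume "a \<in> hom (opposite fat_delta) e' e"
    then obtain f where f: "dot_map e e' f" and a: "a = fat_arrow e e' f"
      using fat_arrow_cases[of a e e'] by auto
    note e = dot_mapD(1,2)[OF f]
    note h = c[OF e(1)] c[OF e(2)] X.FArr_fat_arrow[OF f] Y.FArr_fat_arrow[OF f]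
    \<comment> \<open>Both sides lift the same element \<open>X.act e e' f x\<close>, so naturality
      is uniqueness of lifts.\<close>
    have "body (lift \<phi> e) (X.act e e' f x) = Y.act e e' f (body (lift \<phi> e') x)" if x: "x \<in> FObj X e'" for x
      by (rule lifts_unique[OF e(1) lifts_lift[OF \<phi> e(1) X.act_in[OF f x]] lifts_act[OF f x lifts_lift[OF \<phi> e(2) x]]])
    then have "compose (FObj X e') (body (lift \<phi> e)) (X.act e e' f)
        = compose (FObj X e') (Y.act e e' f) (body (lift \<phi> e'))"
      unfolding compose_def by (rule restrict_ext)
    then show "Comp (SET small) (lift \<phi> e) (FArr X a) = Comp (SET small) (FArr Y a) (lift \<phi> e')"
      using h unfolding a by (simp add: hom_SET X.act_def Y.act_def)
  qed (use c in \<open>simp_all add: lift_def\<close>)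
qed

lemma functor_of_lift:
  assumes \<phi>: "is_functor X.Fcat Y.Fcat \<phi>"
  shows "functor_of (lift \<phi>) = \<phi>"
proof (rule functor_eqI[OF is_functor_functor_of[OF transformation_lift[OF \<phi>]] \<phi>])
  fix s assume "s \<in> Obj X.Fcat"
  then have s: "s \<in> FObj X (free 0)" by simp
  from lifts_lift[OF \<phi> free_Obj s] show "FObj (functor_of (lift \<phi>)) s = FObj \<phi> s"
    using X.restr_free_id(1)[OF s] Y.restr_free_id(1) by (force simp: lifts_def functor_of_def)
next
  fix f assume "f \<in> Arr X.Fcat"
  then have f: "f \<in> FObj X (free 1)" by simp
  from lifts_lift[OF \<phi> free_Obj f] show "FArr (functor_of (lift \<phi>)) f = FArr \<phi> f"
    using X.restr_free_id(2)[OF f] Y.restr_free_id(2) by (force simp: lifts_def functor_of_def)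
qed

lemma functor_of_bij:
  "bij_betw functor_of {\<tau>. transformation \<tau>} {\<phi>. is_functor X.Fcat Y.Fcat \<phi>}"
  by (rule bij_betw_byWitness[of _ lift])
    (use functor_of_inj transformation_lift is_functor_functor_of functor_of_lift in \<open>auto\<close>)

end

section \<open>The functor to small categories and its full faithfulness\<close>

lemma SetFairCat_sel [simp]:
  "Obj (SetFairCat small) = {X. fair_Set_category small X}"
  "Dom (SetFairCat small) = src" "Cod (SetFairCat small) = tgt"
  "Ident (SetFairCat small) X = Arrow X (\<lambda>e \<in> Obj fat_delta. Ident (SET small) (FObj X e)) X"
  "Comp (SetFairCat small) b a
    = Arrow (src a) (\<lambda>e \<in> Obj fat_delta. Comp (SET small) (body b e) (body a e)) (tgt b)"
  by (simp_all add: SetFairCat_def)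

lemma hom_SetFairCat: "a \<in> hom (SetFairCat small) X Y \<longleftrightarrow> src a = X \<and> tgt a = Y \<and>
    fair_Set_category small X \<and> fair_Set_category small Y \<and>
    nat_trans (opposite fat_delta) (SET small) X Y (body a)"
  by (simp add: SetFairCat_def)

lemma CAT_sel [simp]:
  "Obj (CAT small) = {C. small_category small C}" "Dom (CAT small) = src" "Cod (CAT small) = tgt"
  "Ident (CAT small) C = Arrow C (id_fctr C) C"
  "Comp (CAT small) b a = Arrow (src a) (comp_fctr (src a) (body b) (body a)) (tgt b)"
  by (simp_all add: CAT_def)

lemma hom_CAT: "a \<in> hom (CAT small) C D \<longleftrightarrow> src a = C \<and> tgt a = D \<and>
    small_category small C \<and> small_category small D \<and> is_functor C D (body a)"
  by (simp add: CAT_def)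

definition Fcat_arrow :: "('u fat_presheaf, fat_obj \<Rightarrow> ('u set, 'u \<Rightarrow> 'u) arrow) arrow
    \<Rightarrow> (('u, 'u) cat, ('u, 'u, 'u, 'u) fctr) arrow" where
  "Fcat_arrow a = Arrow (fair_Set_category.Fcat (src a)) (fair_pair.functor_of (body a))
    (fair_Set_category.Fcat (tgt a))"

definition Fcat_functor where
  "Fcat_functor small = \<lparr>FObj = (\<lambda>X \<in> Obj (SetFairCat small). fair_Set_category.Fcat X),
    FArr = (\<lambda>a \<in> Arr (SetFairCat small). Fcat_arrow a)\<rparr>"

lemma Fcat_functor_simps:
  "fair_Set_category small X \<Longrightarrow> FObj (Fcat_functor small) X = fair_Set_category.Fcat X"
  "a \<in> hom (SetFairCat small) X Y \<Longrightarrow> FArr (Fcat_functor small) a = Fcat_arrow a"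
  by (simp_all add: Fcat_functor_def hom_def)

lemma is_functor_Fcat_functor: "is_functor (SetFairCat small) (CAT small) (Fcat_functor small)"
proof -
  interpret SF: category "SetFairCat small" by (rule category_SetFairCat)
  interpret CA: category "CAT small" by (rule category_CAT)
  show ?thesis
  proof unfold_locales
    fix X assume "X \<in> Obj (SetFairCat small)"
    then interpret fair_Set_category small X by simp
    show "FObj (Fcat_functor small) X \<in> Obj (CAT small)"
      using small_category_Fcat fair_Set_category_axioms by (simp add: Fcat_functor_simps)
    interpret fair_pair small X X ..
    have id: "Ident (SetFairCat small) X \<in> hom (SetFairCat small) X X"
      by (rule SF.Id_hom) (simp add: fair_Set_category_axioms)
    have "functor_of (body (Ident (SetFairCat small) X)) = id_fctr Fcat"
      using id by (simp add: functor_of_def id_fctr_def)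
    then show "FArr (Fcat_functor small) (Ident (SetFairCat small) X)
        = Ident (CAT small) (FObj (Fcat_functor small) X)"
      unfolding Fcat_functor_simps(2)[OF id]
      by (simp add: Fcat_functor_simps(1) fair_Set_category_axioms Fcat_arrow_def)
  next
    fix a X Y assume a: "a \<in> hom (SetFairCat small) X Y"
    then interpret fair_pair small X Y by (auto simp: hom_SetFairCat intro: fair_pair.intro)
    show "FArr (Fcat_functor small) a \<in> hom (CAT small) (FObj (Fcat_functor small) X) (FObj (Fcat_functor small) Y)"
      using a X.small_category_Fcat Y.small_category_Fcat is_functor_functor_of[of "body a"]
        X.fair_Set_category_axioms Y.fair_Set_category_axioms
      by (simp add: Fcat_functor_simps(1) Fcat_functor_simps(2)[OF a] hom_CAT) (simp add: hom_SetFairCat Fcat_arrow_def)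
  next
    fix a b X Y Z assume a: "a \<in> hom (SetFairCat small) X Y" and b: "b \<in> hom (SetFairCat small) Y Z"
    interpret XY: fair_pair small X Y using a by (auto simp: hom_SetFairCat intro: fair_pair.intro)
    interpret YZ: fair_pair small Y Z using b by (auto simp: hom_SetFairCat intro: fair_pair.intro)
    interpret XZ: fair_pair small X Z ..
    note c = SF.Comp_hom[OF a b]
    have st: "src a = X" "tgt a = Y" "src b = Y" "tgt b = Z"
      and t: "nat_trans (opposite fat_delta) (SET small) X Y (body a)"
      using a b by (simp_all add: hom_SetFairCat)
    have "XZ.functor_of (body (Comp (SetFairCat small) b a))
        = comp_fctr XY.X.Fcat (YZ.functor_of (body b)) (XY.functor_of (body a))"
      using XY.component_PiE(1)[OF t free_Obj]
      by (simp add: XZ.functor_of_def YZ.functor_of_def XY.functor_of_def comp_fctr_def)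
    then show "FArr (Fcat_functor small) (Comp (SetFairCat small) b a)
        = Comp (CAT small) (FArr (Fcat_functor small) b) (FArr (Fcat_functor small) a)"
      unfolding Fcat_functor_simps(2)[OF a] Fcat_functor_simps(2)[OF b] Fcat_functor_simps(2)[OF c]
      by (simp add: Fcat_arrow_def st)
  qed (simp_all add: Fcat_functor_def)
qed

lemma fully_faithful_Fcat_functor: "fully_faithful (SetFairCat small) (CAT small) (Fcat_functor small)"
  unfolding fully_faithful_def
proof (intro ballI)
  fix X Y assume "X \<in> Obj (SetFairCat small)" "Y \<in> Obj (SetFairCat small)"
  then interpret fair_pair small X Y by (auto intro: fair_pair.intro)
  note b = functor_of_bij[unfolded bij_betw_def]
  have fair: "fair_Set_category small X" "fair_Set_category small Y" by unfold_locales
  have sc: "small_category small X.Fcat" "small_category small Y.Fcat"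
    by (rule X.small_category_Fcat Y.small_category_Fcat)+
  have F: "FArr (Fcat_functor small) a = Arrow X.Fcat (functor_of (body a)) Y.Fcat"
    if "a \<in> hom (SetFairCat small) X Y" for a
    using that Fcat_functor_simps(2)[OF that] by (simp add: hom_SetFairCat Fcat_arrow_def)
  show "bij_betw (FArr (Fcat_functor small)) (hom (SetFairCat small) X Y)
      (hom (CAT small) (FObj (Fcat_functor small) X) (FObj (Fcat_functor small) Y))"
    unfolding bij_betw_def
  proof
    show "inj_on (FArr (Fcat_functor small)) (hom (SetFairCat small) X Y)"
    proof (rule inj_onI)
      fix a a' assume a: "a \<in> hom (SetFairCat small) X Y" "a' \<in> hom (SetFairCat small) X Y"
        and "FArr (Fcat_functor small) a = FArr (Fcat_functor small) a'"
      then have "functor_of (body a) = functor_of (body a')" by (simp add: F)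
      then have "body a = body a'" using a by (intro functor_of_inj) (auto simp: hom_SetFairCat)
      then show "a = a'" using a by (simp add: hom_SetFairCat arrow.expand)
    qed
    show "FArr (Fcat_functor small) ` hom (SetFairCat small) X Y
        = hom (CAT small) (FObj (Fcat_functor small) X) (FObj (Fcat_functor small) Y)" (is "?l = ?r")
    proof
      show "?l \<subseteq> ?r"
        using is_functor.FArr_hom[OF is_functor_Fcat_functor] by blast
      show "?r \<subseteq> ?l"
      proof
        fix c assume "c \<in> ?r"
        then have c: "src c = X.Fcat" "tgt c = Y.Fcat" "is_functor X.Fcat Y.Fcat (body c)"
          by (simp_all add: hom_CAT Fcat_functor_simps fair)
        let ?a = "Arrow X (lift (body c)) Y"
        have a: "?a \<in> hom (SetFairCat small) X Y"
          using transformation_lift[OF c(3)] fair by (simp add: hom_SetFairCat)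
        have "c = FArr (Fcat_functor small) ?a"
          unfolding F[OF a] using c functor_of_lift[OF c(3)] by (simp add: arrow.expand)
        then show "c \<in> ?l" using a by blast
      qed
    qed
  qed
qed

section \<open>The fair presheaf of a category\<close>

text \<open>Inverting the two bijections gives a strict inverse functor, which is what an
  isomorphism in \<open>CAT\<close> demands.\<close>

lemma invertible_functor:
  assumes F: "is_functor A B F" and obj: "bij_betw (FObj F) (Obj A) (Obj B)"
    and arr: "bij_betw (FArr F) (Arr A) (Arr B)"
  obtains G where "is_functor B A G" "comp_fctr A G F = id_fctr A" "comp_fctr B F G = id_fctr B"
proof -
  interpret is_functor A B F by fact
  define gO gA where "gO = inv_into (Obj A) (FObj F)" and "gA = inv_into (Arr A) (FArr F)"
  have gO: "gO y \<in> Obj A" "FObj F (gO y) = y" if "y \<in> Obj B" for y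
    using that obj by (auto simp: gO_def bij_betw_def inv_into_into f_inv_into_f)
  have gO': "gO (FObj F x) = x" if "x \<in> Obj A" for x
    using that obj by (simp add: gO_def bij_betw_def)
  have gA: "gA f \<in> Arr A" "FArr F (gA f) = f" if "f \<in> Arr B" for f
    using that arr by (auto simp: gA_def bij_betw_def inv_into_into f_inv_into_f)
  have gA': "gA (FArr F f) = f" if "f \<in> Arr A" for f
    using that arr by (simp add: gA_def bij_betw_def)
  have g_hom: "gA f \<in> hom A (gO x) (gO y)" if f: "f \<in> hom B x y" for f x y
  proof -
    have fA: "f \<in> Arr B" using f by (rule homD)
    have "FArr F (gA f) \<in> hom B (FObj F (Dom A (gA f))) (FObj F (Cod A (gA f)))"
      by (rule FArr_hom) (simp add: hom_def gA fA)
    then have "FObj F (Dom A (gA f)) = x" "FObj F (Cod A (gA f)) = y"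
      using f fA by (auto simp: hom_def gA)
    then show ?thesis using gO' A.Dom_Obj A.Cod_Obj gA(1)[OF fA] by (auto simp: hom_def)
  qed
  define G where "G = \<lparr>FObj = restrict gO (Obj B), FArr = restrict gA (Arr B)\<rparr>"
  have G: "is_functor B A G"
  proof unfold_locales
    fix f x y assume f: "f \<in> hom B x y"
    then show "FArr G f \<in> hom A (FObj G x) (FObj G y)"
      using g_hom[OF f] B.hom_Obj[OF f] by (simp add: G_def homD)
  next
    fix x assume x: "x \<in> Obj B"
    have "gA (Ident B x) = gA (FArr F (Ident A (gO x)))" using FArr_Id gO[OF x] by simp
    then show "FArr G (Ident B x) = Ident A (FObj G x)"
      using gA' A.Id_hom[OF gO(1)[OF x]] B.Id_hom[OF x] x by (simp add: G_def homD)
  next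
    fix f g x y z assume f: "f \<in> hom B x y" and g: "g \<in> hom B y z"
    have "gA (Comp B g f) = gA (FArr F (Comp A (gA g) (gA f)))"
      using FArr_Comp[OF g_hom[OF f] g_hom[OF g]] f g gA by (simp add: homD)
    then show "FArr G (Comp B g f) = Comp A (FArr G g) (FArr G f)"
      using gA' A.Comp_hom[OF g_hom[OF f] g_hom[OF g]] B.Comp_hom[OF f g] f g by (simp add: G_def homD)
  qed (auto simp: G_def gO)
  have "FArr F f \<in> Arr B" if "f \<in> Arr A" for f
    using arr that by (auto simp: bij_betw_def)
  then have "comp_fctr A G F = id_fctr A"
    by (intro functor_eqI[OF is_functor_comp[OF F G] is_functor_id[OF A.category_axioms]])
      (simp_all add: G_def FObj_Obj gO' gA')
  moreover have "comp_fctr B F G = id_fctr B"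
    by (intro functor_eqI[OF is_functor_comp[OF G F] is_functor_id[OF B.category_axioms]])
      (simp_all add: G_def gO gA)
  ultimately show thesis using G that by blast
qed

text \<open>Two pushouts of one span are related by an isomorphism \<open>w\<close> compatible with
  the coprojections, and \<open>X\<close> sends \<open>w\<close> to a bijection. The fibre product
  condition thus passes from one choice of pushout to every other.\<close>

lemma pushout_transfer:
  assumes X: "is_functor (opposite fat_delta) (SET small) X"
    and p: "pushout fat_delta a b i j" and p': "pushout fat_delta a b i' j'"
    and bij: "bij_betw (\<lambda>x. (body (FArr X i) x, body (FArr X j) x)) (FObj X (Cod fat_delta i)) S"
  shows "bij_betw (\<lambda>x. (body (FArr X i') x, body (FArr X j') x)) (FObj X (Cod fat_delta i')) S"
proof -
  interpret X: is_functor "opposite fat_delta" "SET small" X by fact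
  interpret fat: category fat_delta by (rule category_fat_delta)
  have med: "\<exists>!w. w \<in> hom fat_delta (tgt i) z \<and> Comp fat_delta w i = u \<and> Comp fat_delta w j = v"
    if "pushout fat_delta a b i j" "u \<in> hom fat_delta (tgt a) z" "v \<in> hom fat_delta (tgt b) z"
      "Comp fat_delta u a = Comp fat_delta v b" for i j u v z
    using that unfolding pushout_def fat_delta_simps by blast
  have legs: "i \<in> hom fat_delta (tgt a) (tgt i)" "j \<in> hom fat_delta (tgt b) (tgt i)"
    "Comp fat_delta i a = Comp fat_delta j b" if "pushout fat_delta a b i j" for i j
    using that unfolding pushout_def by (auto simp: hom_def)
  note l = legs[OF p] and l' = legs[OF p']
  obtain w where w: "w \<in> hom fat_delta (tgt i) (tgt i')" "Comp fat_delta w i = i'" "Comp fat_delta w j = j'"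
    using med[OF p l'] by blast
  obtain v where v: "v \<in> hom fat_delta (tgt i') (tgt i)" "Comp fat_delta v i' = i" "Comp fat_delta v j' = j"
    using med[OF p' l] by blast
  have "Comp fat_delta v w \<in> hom fat_delta (tgt i) (tgt i)" "Comp fat_delta w v \<in> hom fat_delta (tgt i') (tgt i')"
    using fat.Comp_hom w(1) v(1) by blast+
  moreover have "Comp fat_delta (Comp fat_delta v w) i = i" "Comp fat_delta (Comp fat_delta v w) j = j"
    "Comp fat_delta (Comp fat_delta w v) i' = i'" "Comp fat_delta (Comp fat_delta w v) j' = j'"
    using fat.Comp_assoc[OF l(1) w(1) v(1)] fat.Comp_assoc[OF l(2) w(1) v(1)]
      fat.Comp_assoc[OF l'(1) v(1) w(1)] fat.Comp_assoc[OF l'(2)[unfolded w(3)[symmetric]] v(1) w(1)] w v by simp_all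
  moreover have "Ident fat_delta (tgt i) \<in> hom fat_delta (tgt i) (tgt i)"
    "Ident fat_delta (tgt i') \<in> hom fat_delta (tgt i') (tgt i')"
    using fat.Id_hom fat.hom_Obj l(1) l'(1) by blast+
  moreover have "Comp fat_delta (Ident fat_delta (tgt i)) i = i" "Comp fat_delta (Ident fat_delta (tgt i)) j = j"
    "Comp fat_delta (Ident fat_delta (tgt i')) i' = i'" "Comp fat_delta (Ident fat_delta (tgt i')) j' = j'"
    using fat.Id_Comp' l l' by blast+
  ultimately have vw: "Comp fat_delta v w = Ident fat_delta (tgt i)" "Comp fat_delta w v = Ident fat_delta (tgt i')"
    using med[OF p l] med[OF p' l'] by blast+
  have comp: "body (FArr X (Comp fat_delta g f)) x = body (FArr X f) (body (FArr X g) x)"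
    if "f \<in> hom fat_delta d e" "g \<in> hom fat_delta e e'" "x \<in> FObj X e'" for f g d e e' x
    using X.FArr_Comp[of g e' e f d] X.FArr_hom[of g e' e] that by (simp add: compose_def hom_SET)
  have into: "body (FArr X f) x \<in> FObj X d" if "f \<in> hom fat_delta d e" "x \<in> FObj X e" for f d e x
    using X.FArr_hom[of f e d] that by (auto simp: hom_SET)
  have ident: "body (FArr X (Ident fat_delta e)) x = x" if "e \<in> Obj fat_delta" "x \<in> FObj X e" for e x
    using X.FArr_Id[of e] that by simp
  have ii': "tgt i \<in> Obj fat_delta" "tgt i' \<in> Obj fat_delta" using fat.hom_Obj[OF w(1)] by simp_all
  have "bij_betw (body (FArr X w)) (FObj X (tgt i')) (FObj X (tgt i))"
    by (rule bij_betw_byWitness[of _ "body (FArr X v)"])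
      (use comp[OF v(1) w(1)] comp[OF w(1) v(1)] vw ident ii' into[OF v(1)] into[OF w(1)] in \<open>auto simp del: SET_simps\<close>)
  then have "bij_betw ((\<lambda>x. (body (FArr X i) x, body (FArr X j) x)) \<circ> body (FArr X w)) (FObj X (tgt i')) S"
    using bij by (auto intro: bij_betw_trans)
  moreover have "((\<lambda>x. (body (FArr X i) x, body (FArr X j) x)) \<circ> body (FArr X w)) x
      = (body (FArr X i') x, body (FArr X j') x)" if "x \<in> FObj X (tgt i')" for x
    using comp[OF l(1) w(1) that] comp[OF l(2) w(1) that] w by simp
  ultimately show ?thesis unfolding fat_delta_simps by (simp cong: bij_betw_cong)
qed

section \<open>Coding finite lists by single elements\<close>

lemma ex_pairing:
  assumes "infinite (UNIV :: 'u set)"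
  shows "\<exists>p :: 'u \<times> 'u \<Rightarrow> 'u. inj p"
proof -
  obtain p where "bij_betw p (UNIV \<times> UNIV :: ('u \<times> 'u) set) (UNIV :: 'u set)"
    using iffD2[OF card_of_ordIso card_of_Times_same_infinite[OF assms]] by blast
  then show ?thesis by (auto simp: bij_betw_def)
qed

primrec list_code :: "('u \<times> 'u \<Rightarrow> 'u) \<Rightarrow> 'u list \<Rightarrow> 'u" where
  "list_code p [] = undefined"
| "list_code p (x # xs) = p (x, list_code p xs)"

text \<open>Equal lengths are assumed because the end marker \<open>undefined\<close> may itself be
  the code of a pair.\<close>

lemma list_code_inj:
  assumes "inj p" "length xs = length ys" "list_code p xs = list_code p ys"
  shows "xs = ys"
  using assms(2,3) by (induction xs ys rule: list_induct2) (auto dest: injD[OF assms(1)])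

text \<open>Adding one entry produces a union over \<open>S\<close> of images, so induction on the
  length stays within the closure properties of \<open>smallness\<close> and forms no power
  set.\<close>

lemma (in smallness) small_list_code:
  assumes "small S"
  shows "small {list_code p xs |xs. length xs = n \<and> set xs \<subseteq> S}"
proof (induction n)
  case 0
  show ?case by (rule small_finite) simp
next
  case (Suc n)
  have "{list_code p xs |xs. length xs = Suc n \<and> set xs \<subseteq> S}
      \<subseteq> (\<Union>x \<in> S. (\<lambda>u. p (x, u)) ` {list_code p xs |xs. length xs = n \<and> set xs \<subseteq> S})"
    by (force simp: length_Suc_conv)
  moreover have "small (\<Union>x \<in> S. (\<lambda>u. p (x, u)) ` {list_code p xs |xs. length xs = n \<and> set xs \<subseteq> S})"
    by (intro small_Union assms small_image Suc)
  ultimately show ?case by (rule small_subset[rotated])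
qed

text \<open>Precomposition with \<open>g\<close> of a functor out of an ordinal; the value
  \<open>undefined\<close> outside the relevant pairs lets equality of chains be equality of
  functions.\<close>

definition reindex :: "nat \<Rightarrow> (nat \<Rightarrow> nat) \<Rightarrow> (nat \<Rightarrow> nat \<Rightarrow> 'u) \<Rightarrow> nat \<Rightarrow> nat \<Rightarrow> 'u" where
  "reindex k g a = (\<lambda>i j. if i \<le> j \<and> j \<le> k then a (g i) (g j) else undefined)"

lemma reindex_reindex:
  assumes "mono_on {..k} g" "g \<in> {..k} \<rightarrow> {..k'}"
  shows "reindex k g (reindex k' g' a) = reindex k (\<lambda>i. g' (g i)) a"
  using assms by (auto simp: reindex_def fun_eq_iff mono_on_def)

lemma reindex_cong: "(\<And>i. i \<le> k \<Longrightarrow> g i = h i) \<Longrightarrow> reindex k g = reindex k h"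
  by (auto simp: reindex_def fun_eq_iff)

section \<open>Chains in a category and the presheaf of their codes\<close>

locale nerve = smallness small + small_category small C
  for small :: "'u set \<Rightarrow> bool" and C :: "('u, 'u) cat"
begin

text \<open>An element of \<open>chains k\<close> is a functor from the ordinal \<open>k\<close> to \<open>C\<close>, given by the images
  \<open>a i j\<close> of the arrows \<open>i \<le> j\<close>.\<close>

definition chains :: "nat \<Rightarrow> (nat \<Rightarrow> nat \<Rightarrow> 'u) set" where
  "chains k = {a. (\<forall>i j. i \<le> j \<and> j \<le> k \<longrightarrow> a i j \<in> hom C (Dom C (a i i)) (Dom C (a j j))) \<and>
    (\<forall>i \<le> k. a i i = Ident C (Dom C (a i i))) \<and>
    (\<forall>i j l. i \<le> j \<and> j \<le> l \<and> l \<le> k \<longrightarrow> Comp C (a j l) (a i j) = a i l) \<and>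
    (\<forall>i j. \<not> (i \<le> j \<and> j \<le> k) \<longrightarrow> a i j = undefined)}"

lemma chainsD:
  assumes "a \<in> chains k"
  shows "\<lbrakk>i \<le> j; j \<le> k\<rbrakk> \<Longrightarrow> a i j \<in> hom C (Dom C (a i i)) (Dom C (a j j))"
    "i \<le> k \<Longrightarrow> a i i = Ident C (Dom C (a i i))"
    "\<lbrakk>i \<le> j; j \<le> l; l \<le> k\<rbrakk> \<Longrightarrow> Comp C (a j l) (a i j) = a i l"
    "\<not> (i \<le> j \<and> j \<le> k) \<Longrightarrow> a i j = undefined"
  using assms unfolding chains_def by blast+

lemma chains_eqI:
  assumes "a \<in> chains k" "b \<in> chains k" "\<And>i j. \<lbrakk>i \<le> j; j \<le> k\<rbrakk> \<Longrightarrow> a i j = b i j"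
  shows "a = b"
  using chainsD(4)[OF assms(1)] chainsD(4)[OF assms(2)] assms(3) by (metis ext)

lemma reindex_chains:
  assumes a: "a \<in> chains k'" and g: "mono_on {..k} g" "g \<in> {..k} \<rightarrow> {..k'}"
  shows "reindex k g a \<in> chains k"
proof -
  have m: "g i \<le> g j" "g j \<le> k'" if "i \<le> j" "j \<le> k" for i j
    using that g by (auto simp: mono_on_def)
  show ?thesis
    unfolding chains_def mem_Collect_eq
  proof (intro conjI allI impI)
    show "reindex k g a i i = Ident C (Dom C (reindex k g a i i))" if "i \<le> k" for i
      using that m[of i i] chainsD(2)[OF a, of "g i"] by (simp add: reindex_def)
  qed (use m chainsD(1,3)[OF a] in \<open>auto simp: reindex_def\<close>)
qed

lemma reindex_id: "a \<in> chains k \<Longrightarrow> reindex k (\<lambda>i. i) a = a"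
  using chainsD(4)[of a k] by (auto simp: reindex_def fun_eq_iff)

definition pairing :: "'u \<times> 'u \<Rightarrow> 'u" where
  "pairing = (SOME p. inj p)"

lemma inj_pairing: "inj pairing"
  unfolding pairing_def by (rule someI_ex[OF ex_pairing[OF infinite_type]])

definition edges :: "nat \<Rightarrow> (nat \<times> nat) list" where
  "edges k = filter (\<lambda>(i, j). i \<le> j) (List.product [0..<Suc k] [0..<Suc k])"

lemma set_edges: "set (edges k) = {(i, j). i \<le> j \<and> j \<le> k}"
  by (auto simp: edges_def simp del: upt_Suc)

text \<open>The sets in \<open>SET small\<close> consist of elements of \<open>'u\<close>, so a
  chain has to be stored as one such element: its arrows are listed along the fixed sequence
  \<open>edges k\<close> and paired up.\<close>

definition code :: "nat \<Rightarrow> (nat \<Rightarrow> nat \<Rightarrow> 'u) \<Rightarrow> 'u" where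
  "code k a = list_code pairing (map (\<lambda>(i, j). a i j) (edges k))"

lemma code_inj: "inj_on (code k) (chains k)"
proof (rule inj_onI)
  fix a b assume ab: "a \<in> chains k" "b \<in> chains k" and "code k a = code k b"
  then have "map (\<lambda>(i, j). a i j) (edges k) = map (\<lambda>(i, j). b i j) (edges k)"
    unfolding code_def by (intro list_code_inj[OF inj_pairing]) simp_all
  then show "a = b" by (intro chains_eqI[OF ab]) (auto simp: set_edges)
qed

definition simplices :: "nat \<Rightarrow> 'u set" where
  "simplices k = code k ` chains k"

text \<open>All codes of chains lie among the codes of lists of one fixed length over the small set
  \<open>Arr C\<close>.\<close>

lemma small_simplices: "small (simplices k)"
proof -
  have "simplices k \<subseteq> {list_code pairing xs |xs. length xs = length (edges k) \<and> set xs \<subseteq> Arr C}"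
  proof
    fix u assume "u \<in> simplices k"
    then obtain a where a: "a \<in> chains k" "u = code k a" by (auto simp: simplices_def)
    have "set (map (\<lambda>(i, j). a i j) (edges k)) \<subseteq> Arr C"
      using chainsD(1)[OF a(1)] by (auto simp: set_edges hom_def)
    then show "u \<in> {list_code pairing xs |xs. length xs = length (edges k) \<and> set xs \<subseteq> Arr C}"
      unfolding a(2) code_def by fastforce
  qed
  then show ?thesis using small_list_code[OF small_Arr] by (rule small_subset[rotated])
qed

definition decode :: "nat \<Rightarrow> 'u \<Rightarrow> nat \<Rightarrow> nat \<Rightarrow> 'u" where
  "decode k = inv_into (chains k) (code k)"

lemma decode_code [simp]: "a \<in> chains k \<Longrightarrow> decode k (code k a) = a"
  unfolding decode_def by (rule inv_into_f_f[OF code_inj])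

lemma code_decode [simp]: "u \<in> simplices k \<Longrightarrow> code k (decode k u) = u"
  by (auto simp: simplices_def)

lemma decode_chains: "u \<in> simplices k \<Longrightarrow> decode k u \<in> chains k"
  by (auto simp: simplices_def)

lemma code_simplices: "a \<in> chains k \<Longrightarrow> code k a \<in> simplices k"
  by (simp add: simplices_def)

definition presheaf :: "'u fat_presheaf" where
  "presheaf = \<lparr>FObj = (\<lambda>e \<in> Obj fat_delta. simplices (tgt e)),
    FArr = (\<lambda>a \<in> Arr fat_delta. Arrow (simplices (tgt (tgt a)))
      (\<lambda>u \<in> simplices (tgt (tgt a)).
        code (tgt (src a)) (reindex (tgt (src a)) (body (snd (body a))) (decode (tgt (tgt a)) u)))
      (simplices (tgt (src a))))\<rparr>"

lemma FObj_presheaf: "e \<in> Obj fat_delta \<Longrightarrow> FObj presheaf e = simplices (tgt e)"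
  by (simp add: presheaf_def)

lemma FArr_presheaf:
  assumes "a \<in> hom fat_delta e e'"
  shows "src (FArr presheaf a) = simplices (tgt e')" "tgt (FArr presheaf a) = simplices (tgt e)"
    "body (FArr presheaf a) = (\<lambda>u \<in> simplices (tgt e').
      code (tgt e) (reindex (tgt e) (body (snd (body a))) (decode (tgt e') u)))"
  using assms by (auto simp: presheaf_def hom_def)

lemma snd_body:
  assumes "a \<in> hom fat_delta e e'"
  shows "mono_on {..tgt e} (body (snd (body a)))" "body (snd (body a)) \<in> {..tgt e} \<rightarrow> {..tgt e'}"
proof -
  have "snd (body a) \<in> hom Delta (tgt e) (tgt e')" using assms unfolding hom_fat_delta by blast
  then show "mono_on {..tgt e} (body (snd (body a)))" "body (snd (body a)) \<in> {..tgt e} \<rightarrow> {..tgt e'}"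
    by (auto simp: hom_Delta)
qed

lemma reindex_snd_chains:
  assumes "a \<in> hom fat_delta e e'" "u \<in> simplices (tgt e')"
  shows "reindex (tgt e) (body (snd (body a))) (decode (tgt e') u) \<in> chains (tgt e)"
  using snd_body[OF assms(1)] decode_chains[OF assms(2)] by (intro reindex_chains)

lemma is_functor_presheaf: "is_functor (opposite fat_delta) (SET small) presheaf"
proof -
  interpret fat: category fat_delta by (rule category_fat_delta)
  interpret op: category "opposite fat_delta" by (rule category_opposite[OF fat.category_axioms])
  interpret S: category "SET small" by (rule category_SET)
  have hom: "FArr presheaf a \<in> hom (SET small) (FObj presheaf e') (FObj presheaf e)"
    if a: "a \<in> hom fat_delta e e'" for a e e'
  proof -
    have "body (FArr presheaf a) \<in> simplices (tgt e') \<rightarrow>\<^sub>E simplices (tgt e)"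
      unfolding FArr_presheaf(3)[OF a] by (intro restrict_PiE_iff[THEN iffD2] ballI code_simplices reindex_snd_chains[OF a])
    then show ?thesis
      using fat.hom_Obj[OF a] small_simplices by (simp add: hom_SET FArr_presheaf(1,2)[OF a] FObj_presheaf)
  qed
  show ?thesis
  proof unfold_locales
    show "FObj presheaf e \<in> Obj (SET small)" if "e \<in> Obj (opposite fat_delta)" for e
      using that small_simplices by (simp add: FObj_presheaf)
    show "FArr presheaf a \<in> hom (SET small) (FObj presheaf e) (FObj presheaf e')"
      if "a \<in> hom (opposite fat_delta) e e'" for a e e'
      using that by (intro hom) simp
  next
    fix e assume "e \<in> Obj (opposite fat_delta)"
    then have e: "e \<in> Obj fat_delta" by simp
    note i = fat.Id_hom[OF e]
    have "(reindex (tgt e) (body (snd (body (Ident fat_delta e)))) :: _ \<Rightarrow> _ \<Rightarrow> _ \<Rightarrow> 'u) = reindex (tgt e) (\<lambda>i. i)"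
      by (intro reindex_cong) (simp add: snd_body_Ident)
    then have "body (FArr presheaf (Ident fat_delta e)) = (\<lambda>u \<in> simplices (tgt e). u)"
      using reindex_id[OF decode_chains] unfolding FArr_presheaf(3)[OF i] by (intro restrict_ext) simp
    then show "FArr presheaf (Ident (opposite fat_delta) e) = Ident (SET small) (FObj presheaf e)"
      using FArr_presheaf(1,2)[OF i] e by (intro arrow.expand) (simp add: FObj_presheaf)
  next
    fix a b e e' e'' assume "a \<in> hom (opposite fat_delta) e'' e'" "b \<in> hom (opposite fat_delta) e' e"
    then have a: "a \<in> hom fat_delta e' e''" and b: "b \<in> hom fat_delta e e'" by simp_all
    note c = fat.Comp_hom[OF b a]
    have s: "(reindex (tgt e) (body (snd (body (Comp fat_delta a b)))) :: _ \<Rightarrow> _ \<Rightarrow> _ \<Rightarrow> 'u)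
        = reindex (tgt e) (\<lambda>i. body (snd (body a)) (body (snd (body b)) i))"
    proof (rule reindex_cong)
      have "snd (body b) \<in> hom Delta (tgt e) (tgt e')" using b unfolding hom_fat_delta by blast
      then show "body (snd (body (Comp fat_delta a b))) i = body (snd (body a)) (body (snd (body b)) i)"
        if "i \<le> tgt e" for i
        using that by (simp add: snd_body_Comp hom_Delta compose_def)
    qed
    have "body (FArr presheaf (Comp fat_delta a b)) u
        = body (FArr presheaf b) (body (FArr presheaf a) u)" if u: "u \<in> simplices (tgt e'')" for u
      using u reindex_snd_chains[OF a u] code_simplices[OF reindex_snd_chains[OF a u]]
      by (simp add: FArr_presheaf(3)[OF c] FArr_presheaf(3)[OF a] FArr_presheaf(3)[OF b] s
          reindex_reindex[OF snd_body[OF b]])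
    then have "body (FArr presheaf (Comp fat_delta a b))
        = compose (simplices (tgt e'')) (body (FArr presheaf b)) (body (FArr presheaf a))"
      by (intro extensionalityI[of _ "simplices (tgt e'')"])
        (simp_all add: compose_def FArr_presheaf(3)[OF c])
    then show "FArr presheaf (Comp (opposite fat_delta) b a)
        = Comp (SET small) (FArr presheaf b) (FArr presheaf a)"
      by (intro arrow.expand)
        (simp add: FArr_presheaf(1,2)[OF a] FArr_presheaf(1,2)[OF b] FArr_presheaf(1,2)[OF c])
  qed (simp_all add: presheaf_def)
qed

text \<open>The presheaf sees an arrow only through its second component, which is an identity for a
  vertical arrow; such an arrow therefore acts as the identity on simplices.\<close>

lemma colour_preserving_presheaf: "colour_preserving_functor (opposite fat_delta) (SET small) presheaf"
proof -
  interpret is_functor "opposite fat_delta" "SET small" presheaf by (rule is_functor_presheaf)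
  interpret cf: coloured_category "opposite fat_delta"
    by (rule coloured_category_opposite[OF coloured_category_fat_delta])
  interpret cS: coloured_category "SET small" by (rule coloured_category_SET)
  show ?thesis
  proof unfold_locales
    fix a assume "a \<in> Col (opposite fat_delta)"
    then have v: "a \<in> vertical" by simp
    then have a: "a \<in> hom fat_delta (src a) (tgt a)" by (simp add: vertical_iff hom_def)
    obtain k where k: "snd (body a) = Ident Delta k" using v unfolding vertical_iff by blast
    moreover have "snd (body a) \<in> hom Delta (tgt (src a)) (tgt (tgt a))"
      using a unfolding hom_fat_delta by blast
    ultimately have t: "tgt (src a) = k" "tgt (tgt a) = k" by (simp_all add: hom_Delta)
    have "(reindex k (body (snd (body a))) :: _ \<Rightarrow> _ \<Rightarrow> _ \<Rightarrow> 'u) = reindex k (\<lambda>i. i)" by (intro reindex_cong) (simp add: k)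
    then have "body (FArr presheaf a) = (\<lambda>u \<in> simplices k. u)"
      using reindex_id[OF decode_chains] unfolding FArr_presheaf(3)[OF a] t by (intro restrict_ext) simp
    then show "FArr presheaf a \<in> Col (SET small)"
      using FArr_hom[of a "tgt a" "src a"] a
      by (auto simp: Col_SET FArr_presheaf[OF a] t hom_SET Arr_SET bij_betw_def inj_on_def)
  qed
qed

section \<open>Gluing chains, and the fibre product condition\<close>

definition glue_chains :: "nat \<Rightarrow> nat \<Rightarrow> (nat \<Rightarrow> nat \<Rightarrow> 'u) \<Rightarrow> (nat \<Rightarrow> nat \<Rightarrow> 'u) \<Rightarrow> nat \<Rightarrow> nat \<Rightarrow> 'u" where
  "glue_chains k l a b = (\<lambda>i j. if \<not> (i \<le> j \<and> j \<le> k + l) then undefined else if j \<le> k then a i j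
    else if k \<le> i then b (i - k) (j - k) else Comp C (b 0 (j - k)) (a i k))"

text \<open>An arrow across the joint \<open>k\<close> can only be the composite through
  \<open>k\<close>. The chain laws split by the position of the joint, and associativity in
  \<open>C\<close> settles the triples that straddle it.\<close>

lemma glue_chains:
  assumes a: "a \<in> chains k" and b: "b \<in> chains l" and ab: "a k k = b 0 0"
  shows "glue_chains k l a b \<in> chains (k + l)"
    "\<lbrakk>i \<le> j; j \<le> k\<rbrakk> \<Longrightarrow> glue_chains k l a b i j = a i j"
    "\<lbrakk>i \<le> j; j \<le> l\<rbrakk> \<Longrightarrow> glue_chains k l a b (k + i) (k + j) = b i j"
proof -
  define c where "c = glue_chains k l a b"
  have c1: "c i j = a i j" if "i \<le> j" "j \<le> k" for i j
    using that by (simp add: c_def glue_chains_def)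
  have c2: "c i j = b (i - k) (j - k)" if "k \<le> i" "i \<le> j" "j \<le> k + l" for i j
    using that ab by (cases "j = k") (auto simp: c_def glue_chains_def)
  have ak: "a i k \<in> hom C (Dom C (a i i)) (Dom C (b 0 0))" if "i \<le> k" for i
    using chainsD(1)[OF a that] ab by simp
  have bk: "b 0 j \<in> hom C (Dom C (b 0 0)) (Dom C (b j j))" if "j \<le> l" for j
    using chainsD(1)[OF b, of 0 j] that by simp
  \<comment> \<open>The crossing formula also holds at the borders \<open>i = k\<close> and
    \<open>j = k\<close>, because composing with the entry at the joint changes nothing. This
    permits overlapping cases below.\<close>
  have c3: "c i j = Comp C (b 0 (j - k)) (a i k)" if ij: "i \<le> k" "k \<le> j" "j \<le> k + l" for i j
  proof -
    consider "j = k" | "i = k" "k < j" | "i < k" "k < j" using ij by linarith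
    then show ?thesis
    proof cases
      case 1
      then show ?thesis using c1[of i j] ij chainsD(3)[OF a, of i k k] ab by simp
    next
      case 2
      then show ?thesis using c2[of i j] ij chainsD(3)[OF b, of 0 0 "j - k"] ab by simp
    next
      case 3
      then show ?thesis using ij by (simp add: c_def glue_chains_def)
    qed
  qed
  show "glue_chains k l a b i j = a i j" if "i \<le> j" "j \<le> k" using c1[OF that] by (simp add: c_def)
  show "glue_chains k l a b (k + i) (k + j) = b i j" if "i \<le> j" "j \<le> l"
    using c2[of "k + i" "k + j"] that by (simp add: c_def)
  have d1: "c i i = a i i" if "i \<le> k" for i using c1 that by simp
  have d2: "c i i = b (i - k) (i - k)" if "k \<le> i" "i \<le> k + l" for i using c2 that by simp
  have "c \<in> chains (k + l)"
    unfolding chains_def mem_Collect_eq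
  proof (intro conjI allI impI)
    show "c i i = Ident C (Dom C (c i i))" if "i \<le> k + l" for i
      using that d1[of i] d2[of i] chainsD(2)[OF a, of i] chainsD(2)[OF b, of "i - k"]
      by (cases "i \<le> k") (simp_all add: le_diff_conv)
    fix i j
    show "c i j = undefined" if "\<not> (i \<le> j \<and> j \<le> k + l)"
      using that by (auto simp: c_def glue_chains_def)
    show "c i j \<in> hom C (Dom C (c i i)) (Dom C (c j j))" if ij: "i \<le> j \<and> j \<le> k + l"
    proof -
      consider "j \<le> k" | "k \<le> i" | "i \<le> k" "k \<le> j" by linarith
      then show ?thesis
      proof cases
        case 1
        then show ?thesis using ij c1[of i j] d1[of i] d1[of j] chainsD(1)[OF a, of i j] by simp
      next
        case 2
        then show ?thesis using ij c2[of i j] d2[of i] d2[of j] chainsD(1)[OF b, of "i - k" "j - k"]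
          by (simp add: diff_le_mono le_diff_conv add.commute)
      next
        case 3
        have "j - k \<le> l" using ij by linarith
        from Comp_hom[OF ak[OF 3(1)] bk[OF this]] show ?thesis
          using 3 ij c3[of i j] d1[of i] d2[of j] by simp
      qed
    qed
    fix p assume ijp: "i \<le> j \<and> j \<le> p \<and> p \<le> k + l"
    \<comment> \<open>The joint lies after \<open>p\<close>, before \<open>i\<close>, between
      \<open>j\<close> and \<open>p\<close>, or between \<open>i\<close> and
      \<open>j\<close>.\<close>
    consider "p \<le> k" | "k \<le> i" | "i \<le> k" "j \<le> k" "k \<le> p" | "i \<le> k" "k \<le> j" by linarith
    then show "Comp C (c j p) (c i j) = c i p"
    proof cases
      case 1
      then show ?thesis using ijp c1[of i j] c1[of j p] c1[of i p] chainsD(3)[OF a, of i j p] by simp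
    next
      case 2
      then show ?thesis using ijp c2[of i j] c2[of j p] c2[of i p] chainsD(3)[OF b, of "i - k" "j - k" "p - k"]
        by (simp add: diff_le_mono le_diff_conv add.commute)
    next
      case 3
      have p: "p - k \<le> l" using ijp by linarith
      show ?thesis
        using Comp_assoc[OF chainsD(1)[OF a, of i j] ak[OF 3(2)] bk[OF p]] chainsD(3)[OF a, of i j k]
          3 ijp c1[of i j] c3[of j p] c3[of i p] by simp
    next
      case 4
      have jp: "j - k \<le> p - k" "p - k \<le> l" "j - k \<le> l" using ijp by linarith+
      show ?thesis
        using Comp_assoc[OF ak[OF 4(1)] bk[OF jp(3)] chainsD(1)[OF b jp(1,2)]]
          chainsD(3)[OF b _ jp(1,2), of 0] 4 ijp c3[of i j] c2[of j p] c3[of i p] by simp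
    qed
  qed
  then show "glue_chains k l a b \<in> chains (k + l)" by (simp add: c_def)
qed

text \<open>Every arrow across the joint factors through it, so a chain is determined by its two
  halves. Chains carry their objects only as identity arrows, which is why the halves are matched by
  comparing the diagonal entries at the joint.\<close>

lemma simplices_glue:
  "bij_betw (\<lambda>u. (code k (reindex k (\<lambda>i. i) (decode (k + l) u)), code l (reindex l (\<lambda>i. k + i) (decode (k + l) u))))
    (simplices (k + l))
    {(s, t). s \<in> simplices k \<and> t \<in> simplices l \<and> decode k s k k = decode l t 0 0}"
  (is "bij_betw ?f _ ?S")
proof -
  have r: "reindex k (\<lambda>i. i) a \<in> chains k" "reindex l (\<lambda>i. k + i) a \<in> chains l"
    if "a \<in> chains (k + l)" for a
    using that by (auto intro!: reindex_chains[of a "k + l"] simp: mono_on_def)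
  show ?thesis
    unfolding bij_betw_def
  proof
    show "inj_on ?f (simplices (k + l))"
    proof (rule inj_onI)
      fix u v assume uv: "u \<in> simplices (k + l)" "v \<in> simplices (k + l)" and eq: "?f u = ?f v"
      define a b where "a = decode (k + l) u" and "b = decode (k + l) v"
      have ab: "a \<in> chains (k + l)" "b \<in> chains (k + l)" using uv by (auto simp: a_def b_def decode_chains)
      have e: "reindex k (\<lambda>i. i) a = reindex k (\<lambda>i. i) b" "reindex l (\<lambda>i. k + i) a = reindex l (\<lambda>i. k + i) b"
        using eq r[OF ab(1)] r[OF ab(2)] code_inj unfolding a_def[symmetric] b_def[symmetric]
        by (auto dest: inj_onD)
      have e1: "a i j = b i j" if "i \<le> j" "j \<le> k" for i j
        using fun_cong[OF fun_cong[OF e(1)], of i j] that by (simp add: reindex_def)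
      have e2: "a i j = b i j" if "k \<le> i" "i \<le> j" "j \<le> k + l" for i j
        using fun_cong[OF fun_cong[OF e(2)], of "i - k" "j - k"] that
        by (simp add: reindex_def diff_le_mono le_diff_conv add.commute)
      have "a = b"
      proof (rule chains_eqI[OF ab])
        fix i j assume ij: "i \<le> j" "j \<le> k + l"
        show "a i j = b i j"
        proof (cases "j \<le> k \<or> k \<le> i")
          case False
          then show ?thesis
            using chainsD(3)[OF ab(1), of i k j] chainsD(3)[OF ab(2), of i k j] e1[of i k] e2[of k j] ij by simp
        qed (use e1 e2 ij in auto)
      qed
      then show "u = v" using uv code_decode unfolding a_def b_def by metis
    qed
    show "?f ` simplices (k + l) = ?S"
    proof
      show "?f ` simplices (k + l) \<subseteq> ?S"
        using r[OF decode_chains] by (auto intro: code_simplices) (simp add: reindex_def)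
      show "?S \<subseteq> ?f ` simplices (k + l)"
      proof safe
        fix s t assume s: "s \<in> simplices k" and t: "t \<in> simplices l" and st: "decode k s k k = decode l t 0 0"
        define a b where "a = decode k s" and "b = decode l t"
        have ab: "a \<in> chains k" "b \<in> chains l" "a k k = b 0 0"
          using s t st by (simp_all add: a_def b_def decode_chains)
        note c = glue_chains[OF ab]
        have "reindex k (\<lambda>i. i) (glue_chains k l a b) = a"
          by (rule chains_eqI[OF r(1)[OF c(1)] ab(1)]) (simp add: reindex_def c(2))
        moreover have "reindex l (\<lambda>i. k + i) (glue_chains k l a b) = b"
          by (rule chains_eqI[OF r(2)[OF c(1)] ab(2)]) (simp add: reindex_def c(3))
        ultimately have "?f (code (k + l) (glue_chains k l a b)) = (s, t)"
          using c(1) s t by (simp add: a_def b_def)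
        then show "(s, t) \<in> ?f ` simplices (k + l)" using code_simplices[OF c(1)] by (metis (no_types, lifting) image_eqI)
      qed
    qed
  qed
qed

text \<open>The pushout of \<open>m\<close> and \<open>n\<close> is realised by their concatenation
  \<open>e\<close>, which returns \<open>m\<close> and \<open>n\<close> when cut at the dot
  \<open>src m\<close>. For it the condition is \<open>simplices_glue\<close>;
  \<open>pushout_transfer\<close> covers all other choices.\<close>

lemma fair_presheaf: "fair_Set_category small presheaf"
proof -
  interpret colour_preserving_functor "opposite fat_delta" "SET small" presheaf
    by (rule colour_preserving_presheaf)
  show ?thesis
  proof unfold_locales
    show "FObj presheaf x \<in> Disc (SET small)" if "x \<in> Disc (opposite fat_delta)" for x
      using that small_simplices one_dot_Obj by (simp add: FObj_presheaf)
    fix m n i j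
    assume m: "m \<in> Obj fat_delta" and n: "n \<in> Obj fat_delta"
      and p: "pushout fat_delta (last_dot m) (first_dot n) i j"
    note pm = fat_obj_props[OF m] and pn = fat_obj_props[OF n]
    \<comment> \<open>The fibres of \<open>n\<close> are renumbered from \<open>tgt m\<close>. The
      last dot of \<open>m\<close> doubles as the first dot of \<open>n\<close>; both formulas give
      \<open>tgt m\<close> there, since \<open>body m (src m) = tgt m\<close> and
      \<open>body n 0 = 0\<close>.\<close>
    define b where "b d = (if d \<le> src m then body m d else tgt m + body n (d - src m))" for d
    define e where "e = links (src m + src n) b"
    have b': "b (src m + d) = tgt m + body n d" for d
      using pm(6) pn(5) by (simp add: b_def)
    have e: "e \<in> Obj fat_delta"
      unfolding e_def
    proof (rule links_Obj)
      show "b 0 = 0" using pm(5) by (simp add: b_def)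
      fix d assume d: "d < src m + src n"
      show "b (Suc d) = b d \<or> b (Suc d) = Suc (b d)"
      proof (cases "d < src m")
        case True
        then show ?thesis using pm(7)[of d] by (simp add: b_def)
      next
        case False
        then obtain c where c: "d = src m + c" by (metis le_Suc_ex not_less)
        then show ?thesis using pn(7)[of c] d b'[of c] b'[of "Suc c"] by auto
      qed
    qed
    have te: "tgt e = tgt m + tgt n" using b'[of "src n"] pn(6) by (simp add: e_def)
    have im: "initial_part e (src m) = m"
    proof -
      have "initial_part e (src m) = links (src m) (body m)"
        unfolding initial_part_def by (rule links_cong) (simp add: e_def b_def)
      then show ?thesis using links_body[OF m] by simp
    qed
    have fn: "final_part e (src m) = n"
    proof -
      have "final_part e (src m) = links (src n) (body n)"
        unfolding final_part_def using b' b'[of 0] pn(5) by (auto simp: e_def intro!: links_cong)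
      then show ?thesis using links_body[OF n] by simp
    qed
    have le: "src m \<le> src e" by (simp add: e_def)
    note pp = parts(3,4)[OF e le, unfolded im fn]
    let ?i = "fat_arrow m e (\<lambda>d. d)" and ?j = "fat_arrow n e (\<lambda>d. src m + d)"
    note hi = fat_arrow_hom[OF pp(1)] and hj = fat_arrow_hom[OF pp(2)]
    have "body (snd (body ?i)) k = k" if k: "k \<le> tgt m" for k
    proof -
      obtain d where d: "d \<le> src m" "body m d = k" using pm(3)[OF k] by blast
      then show ?thesis using fat_arrow_snd[OF pp(1) d(1)] by (simp add: e_def b_def)
    qed
    then have ri: "(reindex (tgt m) (body (snd (body ?i))) :: _ \<Rightarrow> _ \<Rightarrow> _ \<Rightarrow> 'u) = reindex (tgt m) (\<lambda>k. k)"
      by (rule reindex_cong)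
    have "body (snd (body ?j)) k = tgt m + k" if k: "k \<le> tgt n" for k
    proof -
      obtain d where d: "d \<le> src n" "body n d = k" using pn(3)[OF k] by blast
      then show ?thesis using fat_arrow_snd[OF pp(2) d(1)] b'[of d] by (simp add: e_def)
    qed
    then have rj: "(reindex (tgt n) (body (snd (body ?j))) :: _ \<Rightarrow> _ \<Rightarrow> _ \<Rightarrow> 'u) = reindex (tgt n) (\<lambda>k. tgt m + k)"
      by (rule reindex_cong)
    \<comment> \<open>A chain over the ordinal 0 has a single entry, so agreement over the common
      dot is equality of the diagonal entries at the joint.\<close>
    have ends: "body (FArr presheaf (last_dot m)) s = body (FArr presheaf (first_dot n)) t
        \<longleftrightarrow> decode (tgt m) s (tgt m) (tgt m) = decode (tgt n) t 0 0"
      if s: "s \<in> simplices (tgt m)" and t: "t \<in> simplices (tgt n)" for s t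
    proof -
      have hl: "last_dot m \<in> hom fat_delta one_dot m" and hf: "first_dot n \<in> hom fat_delta one_dot n"
        unfolding last_dot_def first_dot_def
        using dot_inclusion_eq[OF m, of "src m"] dot_inclusion_eq[OF n, of 0]
          fat_arrow_hom[OF dot_map_one_dot[OF m]] fat_arrow_hom[OF dot_map_one_dot[OF n]] by simp_all
      define a b where "a = decode (tgt m) s" and "b = decode (tgt n) t"
      define x y where "x = reindex 0 (body (snd (body (last_dot m)))) a"
        and "y = reindex 0 (body (snd (body (first_dot n)))) b"
      have "x \<in> chains 0" "y \<in> chains 0"
        using reindex_snd_chains[OF hl s] reindex_snd_chains[OF hf t] by (simp_all add: x_def y_def a_def b_def)
      then have "code 0 x = code 0 y \<longleftrightarrow> x = y" using code_inj by (auto dest: inj_onD)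
      also have "\<dots> \<longleftrightarrow> x 0 0 = y 0 0"
        using chains_eqI[OF \<open>x \<in> chains 0\<close> \<open>y \<in> chains 0\<close>] by auto
      also have "\<dots> \<longleftrightarrow> a (tgt m) (tgt m) = b 0 0"
        using pm(6) pn(5) by (simp add: x_def y_def reindex_def last_dot_def first_dot_def dot_inclusion_def)
      finally show ?thesis
        using s t by (simp add: FArr_presheaf(3)[OF hl] FArr_presheaf(3)[OF hf] x_def y_def a_def b_def)
    qed
    have "bij_betw (\<lambda>x. (body (FArr presheaf ?i) x, body (FArr presheaf ?j) x)) (simplices (tgt m + tgt n))
        {(s, t). s \<in> simplices (tgt m) \<and> t \<in> simplices (tgt n) \<and> decode (tgt m) s (tgt m) (tgt m) = decode (tgt n) t 0 0}"
      using simplices_glue[of "tgt m" "tgt n"]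
      by (simp add: FArr_presheaf(3)[OF hi] FArr_presheaf(3)[OF hj] te ri rj cong: bij_betw_cong)
    moreover have "{(s, t). s \<in> simplices (tgt m) \<and> t \<in> simplices (tgt n) \<and> decode (tgt m) s (tgt m) (tgt m) = decode (tgt n) t 0 0}
      = {(s, t). s \<in> FObj presheaf m \<and> t \<in> FObj presheaf n \<and>
        body (FArr presheaf (last_dot m)) s = body (FArr presheaf (first_dot n)) t}"
      using ends by (auto simp: FObj_presheaf[OF m] FObj_presheaf[OF n])
    ultimately have "bij_betw (\<lambda>x. (body (FArr presheaf ?i) x, body (FArr presheaf ?j) x))
      (FObj presheaf (Cod fat_delta ?i)) {(s, t). s \<in> FObj presheaf m \<and> t \<in> FObj presheaf n \<and>
        body (FArr presheaf (last_dot m)) s = body (FArr presheaf (first_dot n)) t}"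
      using e by (simp add: FObj_presheaf te)
    then show "bij_betw (\<lambda>x. (body (FArr presheaf i) x, body (FArr presheaf j) x))
      (FObj presheaf (Cod fat_delta i)) {(s, t). s \<in> FObj presheaf m \<and> t \<in> FObj presheaf n \<and>
        body (FArr presheaf (last_dot m)) s = body (FArr presheaf (first_dot n)) t}"
      by (rule pushout_transfer[OF is_functor_presheaf pushout_parts[OF e le, unfolded im fn] p])
  qed
qed

section \<open>The counit from the underlying category of the nerve\<close>

sublocale N: fair_Set_category small presheaf
  by (rule fair_presheaf)

text \<open>Dots act on simplices through the ordinal to which \<open>e\<close> projects them, hence
  the indices \<open>body e (ds ! i)\<close>.\<close>

lemma decode_restr:
  assumes ds: "dots e ds" and u: "u \<in> simplices (tgt e)" and ij: "i \<le> j" "j < length ds"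
  shows "decode (length ds - 1) (N.restr e ds u) i j = decode (tgt e) u (body e (ds ! i)) (body e (ds ! j))"
proof -
  note f = dot_map_dots[OF ds]
  note h = fat_arrow_hom[OF f]
  let ?g = "body (snd (body (fat_arrow (free (length ds - 1)) e ((!) ds))))"
  have g: "?g i = body e (ds ! i)" if "i < length ds" for i
    using fat_arrow_snd[OF f, of i] that by simp
  have "decode (length ds - 1) (N.restr e ds u) = reindex (length ds - 1) ?g (decode (tgt e) u)"
    using reindex_snd_chains[OF h u] u unfolding N.restr_def N.act_def FArr_presheaf(3)[OF h] by simp
  moreover have "j \<le> length ds - 1" using ij by linarith
  ultimately show ?thesis using ij g by (simp add: reindex_def)
qed

text \<open>A 0-simplex stores an object as its identity arrow, so the object is recovered as the
  domain of that arrow.\<close>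

definition counit :: "('u, 'u, 'u, 'u) fctr" where
  "counit = \<lparr>FObj = (\<lambda>u \<in> simplices 0. Dom C (decode 0 u 0 0)), FArr = (\<lambda>u \<in> simplices 1. decode 1 u 0 1)\<rparr>"

lemma FObj_free: "FObj presheaf (free n) = simplices n"
  by (simp add: FObj_presheaf)

lemma is_functor_counit: "is_functor N.Fcat C counit"
proof -
  interpret F: small_category small N.Fcat by (rule N.small_category_Fcat)
  show ?thesis
  proof unfold_locales
    fix u assume "u \<in> Obj N.Fcat"
    then have u: "u \<in> simplices 0" by (simp add: FObj_free)
    show "FObj counit u \<in> Obj C"
      using chainsD(1)[OF decode_chains[OF u], of 0 0] u Dom_Obj by (auto simp: counit_def hom_def)
  next
    fix u x y assume "u \<in> hom N.Fcat x y"
    then have u: "u \<in> simplices 1" and x: "x = N.restr (free 1) [0] u" and y: "y = N.restr (free 1) [1] u"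
      by (auto simp: hom_def N.Fcat_def FObj_free)
    have "x \<in> simplices 0" "y \<in> simplices 0"
      using N.restr_Obj[of u "free 1" 0] N.restr_Obj[of u "free 1" 1] u by (simp_all add: FObj_free x y)
    then show "FArr counit u \<in> hom C (FObj counit x) (FObj counit y)"
      using u decode_restr[of "free 1" "[0]" u 0 0] decode_restr[of "free 1" "[1]" u 0 0]
        chainsD(1)[OF decode_chains[OF u], of 0 1] by (simp add: counit_def x y)
  next
    fix s assume "s \<in> Obj N.Fcat"
    then obtain y where y: "y \<in> FObj presheaf linked2" "N.restr linked2 [0] y = s"
      using N.linked_surj[of s 1] by auto
    \<comment> \<open>Two linked dots project to the ordinal 0, so \<open>y\<close> is a 0-simplex
      and its edge decodes to the identity stored in it.\<close>
    have y0: "y \<in> simplices 0" using y(1) linked_Obj by (simp add: FObj_presheaf)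
    have m: "s \<in> simplices 0" "N.restr linked2 [0, 1] y \<in> simplices 1"
      using N.restr_Obj[OF y(1) linked_Obj, of 0] N.restr_Arr[OF y(1) linked_Obj, of 0 1] y by (simp_all add: FObj_free)
    show "FArr counit (Ident N.Fcat s) = Ident C (FObj counit s)"
      using N.Ident_linked2[OF y(1)] y(2) m y0 linked_Obj
        decode_restr[of linked2 "[0]" y 0 0] decode_restr[of linked2 "[0, 1]" y 0 1]
        chainsD(2)[OF decode_chains[OF y0], of 0] by (simp add: counit_def dots_simps)
  next
    fix f g x y z assume fg: "f \<in> hom N.Fcat x y" "g \<in> hom N.Fcat y z"
    obtain u where u: "u \<in> FObj presheaf (free 2)" "N.restr (free 2) [0, 1] u = f" "N.restr (free 2) [1, 2] u = g"
      by (rule N.composable_pair[OF fg])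
    have u2: "u \<in> simplices 2" using u by (simp add: FObj_free)
    have m: "f \<in> simplices 1" "g \<in> simplices 1" "N.restr (free 2) [0, 2] u \<in> simplices 1"
      using fg N.restr_Arr[OF u(1) free_Obj, of 0 2] by (simp_all add: hom_def FObj_free)
    show "FArr counit (Comp N.Fcat g f) = Comp C (FArr counit g) (FArr counit f)"
      using N.Fcat_Comp_restr[OF u(1) free_Obj, of 0 1 2] u u2 m
        decode_restr[of "free 2" "[0, 1]" u 0 1] decode_restr[of "free 2" "[1, 2]" u 0 1]
        decode_restr[of "free 2" "[0, 2]" u 0 1] chainsD(3)[OF decode_chains[OF u2], of 0 1 2]
      by (simp add: counit_def)
  qed (simp_all add: counit_def FObj_free)
qed

text \<open>A 0-simplex amounts to the identity of an arbitrary object. A 1-simplex is determined by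
  its entry at \<open>0\<close>, \<open>1\<close>, because its diagonal entries are the identities
  of the domain and the codomain of that entry.\<close>

lemma counit_bij:
  "bij_betw (FObj counit) (Obj N.Fcat) (Obj C)" "bij_betw (FArr counit) (Arr N.Fcat) (Arr C)"
proof -
  show "bij_betw (FObj counit) (Obj N.Fcat) (Obj C)"
    unfolding bij_betw_def
  proof
    show "inj_on (FObj counit) (Obj N.Fcat)"
    proof (rule inj_onI)
      fix u v assume "u \<in> Obj N.Fcat" "v \<in> Obj N.Fcat" and eq: "FObj counit u = FObj counit v"
      then have uv: "u \<in> simplices 0" "v \<in> simplices 0" by (simp_all add: FObj_free)
      have "decode 0 u = decode 0 v"
        using chainsD(2)[OF decode_chains[OF uv(1)], of 0] chainsD(2)[OF decode_chains[OF uv(2)], of 0] eq uv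
        by (intro chains_eqI[OF decode_chains decode_chains]) (auto simp: counit_def)
      then show "u = v" using uv code_decode by metis
    qed
    show "FObj counit ` Obj N.Fcat = Obj C"
    proof
      show "FObj counit ` Obj N.Fcat \<subseteq> Obj C"
        using is_functor.FObj_Obj[OF is_functor_counit] by blast
      show "Obj C \<subseteq> FObj counit ` Obj N.Fcat"
      proof
        fix x assume x: "x \<in> Obj C"
        define a where "a i j = (if i = 0 \<and> j = 0 then Ident C x else undefined)" for i j :: nat
        have a: "a \<in> chains 0"
          using Id_hom[OF x] Comp_Id'[OF Id_hom[OF x]] by (auto simp: chains_def a_def hom_def)
        have "FObj counit (code 0 a) = x"
          using Id_hom[OF x] code_simplices[OF a] a by (simp add: counit_def) (simp add: a_def hom_def)
        then show "x \<in> FObj counit ` Obj N.Fcat"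
          using code_simplices[OF a] by (auto simp: FObj_free intro: rev_image_eqI)
      qed
    qed
  qed
  show "bij_betw (FArr counit) (Arr N.Fcat) (Arr C)"
    unfolding bij_betw_def
  proof
    show "inj_on (FArr counit) (Arr N.Fcat)"
    proof (rule inj_onI)
      fix u v assume "u \<in> Arr N.Fcat" "v \<in> Arr N.Fcat" and eq: "FArr counit u = FArr counit v"
      then have uv: "u \<in> simplices 1" "v \<in> simplices 1" by (simp_all add: FObj_free)
      define a b where "a = decode 1 u" and "b = decode 1 v"
      have ab: "a \<in> chains 1" "b \<in> chains 1" using uv by (auto simp: a_def b_def decode_chains)
      have "a 0 1 = b 0 1" using eq uv by (simp add: counit_def a_def b_def)
      moreover have "a i i = b i i" if "i \<le> 1" for i
      proof -
        have "Dom C (a i i) = Dom C (b i i)"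
          using chainsD(1)[OF ab(1), of 0 1] chainsD(1)[OF ab(2), of 0 1] \<open>a 0 1 = b 0 1\<close> that
          by (auto simp: hom_def le_Suc_eq)
        then show ?thesis using chainsD(2)[OF ab(1) that] chainsD(2)[OF ab(2) that] by simp
      qed
      ultimately have "a = b" by (intro chains_eqI[OF ab]) (auto simp: le_Suc_eq)
      then show "u = v" using uv code_decode unfolding a_def b_def by metis
    qed
    show "FArr counit ` Arr N.Fcat = Arr C"
    proof
      show "FArr counit ` Arr N.Fcat \<subseteq> Arr C"
      proof
        fix f assume "f \<in> FArr counit ` Arr N.Fcat"
        then obtain u where "u \<in> simplices 1" "f = FArr counit u" by (auto simp: FObj_free)
        then show "f \<in> Arr C" using chainsD(1)[OF decode_chains, of u 1 0 1] by (simp add: counit_def hom_def)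
      qed
      show "Arr C \<subseteq> FArr counit ` Arr N.Fcat"
      proof
        fix f assume f: "f \<in> Arr C"
        define a where "a i j = (if i = 0 \<and> j = 0 then Ident C (Dom C f) else if i = 0 \<and> j = 1 then f
          else if i = 1 \<and> j = 1 then Ident C (Cod C f) else undefined)" for i j :: nat
        note d = Id_hom[OF Dom_Obj[OF f]] and c = Id_hom[OF Cod_Obj[OF f]]
        have a: "a \<in> chains 1"
          unfolding chains_def mem_Collect_eq
        proof (intro conjI allI impI)
          fix i j :: nat
          show "a i i = Ident C (Dom C (a i i))" if "i \<le> 1"
            using that d c by (auto simp: a_def hom_def le_Suc_eq)
          show "a i j = undefined" if "\<not> (i \<le> j \<and> j \<le> 1)" using that by (auto simp: a_def)
          show "a i j \<in> hom C (Dom C (a i i)) (Dom C (a j j))" if "i \<le> j \<and> j \<le> 1"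
            using that d c f by (auto simp: a_def hom_def le_Suc_eq)
          fix l assume "i \<le> j \<and> j \<le> l \<and> l \<le> 1"
          then show "Comp C (a j l) (a i j) = a i l"
            using Comp_Id[OF f] Id_Comp[OF f] Comp_Id'[OF d] Comp_Id'[OF c] by (auto simp: a_def le_Suc_eq)
        qed
        have "FArr counit (code 1 a) = f"
          using code_simplices[OF a] a by (simp add: counit_def) (simp add: a_def)
        then show "f \<in> FArr counit ` Arr N.Fcat"
          using code_simplices[OF a] by (auto simp: FObj_free intro: rev_image_eqI)
      qed
    qed
  qed
qed

end

text \<open>Isomorphisms in \<open>CAT\<close> are strictly invertible functors; the counit
  qualifies because it is bijective on objects and on arrows and so has a strict inverse.\<close>

lemma essentially_surjective_Fcat_functor:
  assumes "smallness small"
  shows "essentially_surjective (SetFairCat small) (CAT small) (Fcat_functor small)"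
  unfolding essentially_surjective_def
proof
  interpret smallness small by fact
  fix C assume "C \<in> Obj (CAT small)"
  then interpret small_category small C by simp
  interpret nerve small C ..
  obtain G where G: "is_functor C N.Fcat G" "comp_fctr N.Fcat G counit = id_fctr N.Fcat"
    "comp_fctr C counit G = id_fctr C"
    by (rule invertible_functor[OF is_functor_counit counit_bij])
  have F: "FObj (Fcat_functor small) presheaf = N.Fcat"
    by (rule Fcat_functor_simps(1)[OF fair_presheaf])
  let ?f = "Arrow N.Fcat counit C" and ?g = "Arrow C G N.Fcat"
  have h: "?f \<in> hom (CAT small) N.Fcat C" "?g \<in> hom (CAT small) C N.Fcat"
    using is_functor_counit G(1) small_category_axioms N.small_category_Fcat by (simp_all add: hom_CAT)
  have "is_iso (CAT small) ?f" by (rule is_isoI[OF h]) (simp_all add: G)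
  then show "\<exists>X \<in> Obj (SetFairCat small). \<exists>f \<in> hom (CAT small) (FObj (Fcat_functor small) X) C. is_iso (CAT small) f"
    using fair_presheaf F h(1) by (intro bexI[of _ presheaf] bexI[of _ ?f]) simp_all
qed

theorem proposition4p12:
  fixes small :: "'u set \<Rightarrow> bool"
  assumes "smallness small"
  shows "\<exists>F G \<eta> \<epsilon>. adjoint_equivalence (SetFairCat small) (CAT small) F G \<eta> \<epsilon>"
  using adjoint_equivalence_of_fully_faithful[OF is_functor_Fcat_functor fully_faithful_Fcat_functor
      essentially_surjective_Fcat_functor[OF assms]] by blast

end
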